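(* Let $k\in[0,1)$ and $K:=(1+k)/(1-k)$. Let $h:\mathbb{H}\to\mathbb{C}$ be a holomorphic function. Suppose that there exists a closed hyperbolic disk $D\subset\mathbb{H}$ of radius $\frac12\log K$ such that the condition $$\frac{h(z)+a}{h'(z)}-z\in D$$ holds for all $z\in\mathbb{H}$ and some $a\in\mathbb{C}$ (independent of $z$). Then $h$ has a $k$-quasiconformal extension to $\overline{\mathbb{C}}$ with a fixed point at $\infty$.
   Context: $\mathbb{H}:=\{z\in\mathbb{C}:\operatorname{Re} z>0\}$ and $\overline{\mathbb{C}}=\mathbb{C}\cup\{\infty\}$. The hyperbolic distance in $\mathbb{H}$ is normalized as $\mathrm{dist}(z_1,z_2)=\frac12\log\frac{1+\rho}{1-\rho}$, $\rho=\left|\frac{z_1-z_2}{z_1+\overline{z_2}}\right|$; thus a closed hyperbolic disk of radius $\frac12\log\frac{1+k}{1-k}$ centered at $c\in\mathbb{H}$ is $\{w\in\mathbb{H}:|w-c|\le k|w+\overline{c}|\}$. A $k$-quasiconformal map is an orientation-preserving homeomorphism $F$ with distributional derivatives $\partial_zF,\partial_{\bar z}F\in L^1_{\rm loc}$ satisfying $|\partial_{\bar z}F|\le k|\partial_zF|$ a.e. (in local coordinates on $\overline{\mathbb{C}}$). A function $h$ on $\mathbb{H}$ has a $k$-quasiconformal extension to $\overline{\mathbb{C}}$ with a fixed point at $\infty$ if there is a $k$-quasiconformal homeomorphism $F:\overline{\mathbb{C}}\to\overline{\mathbb{C}}$ with $F|_{\mathbb{H}}=h$ and $F(\infty)=\infty$.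 *)

theory Defs
  imports "HOL-Complex_Analysis.Complex_Analysis"
begin

definition right_halfplane :: "complex set" where
  "right_halfplane = {z. Re z > 0}"

definition hyp_dist :: "complex \<Rightarrow> complex \<Rightarrow> real" where
  "hyp_dist z1 z2 =
     (let \<rho> = norm ((z1 - z2) / (z1 + cnj z2)) in 1/2 * ln ((1 + \<rho>) / (1 - \<rho>)))"

definition hyp_cball :: "complex \<Rightarrow> real \<Rightarrow> complex set" where
  "hyp_cball c r = {w \<in> right_halfplane. hyp_dist w c \<le> r}"

text \<open>Check of the normalization: the Euclidean description of closed hyperbolic disks.\<close>

lemma hyp_cball_eq:
  assumes c: "c \<in> right_halfplane" and k: "0 \<le> k" "k < 1"
  shows "hyp_cball c (1/2 * ln ((1 + k) / (1 - k))) =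
           {w \<in> right_halfplane. norm (w - c) \<le> k * norm (w + cnj c)}"
proof -
  have "hyp_dist w c \<le> 1/2 * ln ((1 + k) / (1 - k)) \<longleftrightarrow> norm (w - c) \<le> k * norm (w + cnj c)"
    if w: "w \<in> right_halfplane" for w
  proof -
    define r where "r = norm ((w - c) / (w + cnj c))"
    have pos: "Re w > 0" "Re c > 0"
      using w c by (auto simp: right_halfplane_def)
    have "(norm (w - c))\<^sup>2 < (norm (w + cnj c))\<^sup>2"
      using mult_pos_pos[OF pos] unfolding cmod_power2
      by (simp add: power2_eq_square algebra_simps)
    then have lt: "norm (w - c) < norm (w + cnj c)"
      by (rule power2_less_imp_less) simp
    then have n0: "norm (w + cnj c) > 0"
      using norm_ge_zero[of "w - c"] by linarith
    have r: "0 \<le> r" "r < 1"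
      using lt n0 by (auto simp: r_def norm_divide)
    have "hyp_dist w c \<le> 1/2 * ln ((1 + k) / (1 - k))
            \<longleftrightarrow> ln ((1 + r) / (1 - r)) \<le> ln ((1 + k) / (1 - k))"
      by (simp add: hyp_dist_def r_def[symmetric] Let_def)
    also have "\<dots> \<longleftrightarrow> (1 + r) / (1 - r) \<le> (1 + k) / (1 - k)"
      using r k by (intro ln_le_cancel_iff) auto
    also have "\<dots> \<longleftrightarrow> r \<le> k"
      using r k by (simp add: divide_simps) (simp add: algebra_simps)
    also have "\<dots> \<longleftrightarrow> norm (w - c) \<le> k * norm (w + cnj c)"
      using n0 by (simp add: r_def norm_divide divide_simps)
    finally show ?thesis .
  qed
  then show ?thesis
    by (auto simp: hyp_cball_def)
qed

text \<open>\<open>Cn n \<phi>\<close>: the function \<open>\<phi>\<close> is \<open>n\<close> times continuously differentiable in the real sense,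
  with \<open>\<phi>x\<close> and \<open>\<phi>y\<close> its partial derivatives.\<close>

fun Cn :: "nat \<Rightarrow> (complex \<Rightarrow> complex) \<Rightarrow> bool" where
  "Cn 0 \<phi> \<longleftrightarrow> continuous_on UNIV \<phi>"
| "Cn (Suc n) \<phi> \<longleftrightarrow>
     (\<exists>\<phi>x \<phi>y. (\<forall>z. (\<phi> has_derivative (\<lambda>h. Re h *\<^sub>R \<phi>x z + Im h *\<^sub>R \<phi>y z)) (at z))
             \<and> Cn n \<phi>x \<and> Cn n \<phi>y)"

definition test_function :: "complex set \<Rightarrow> (complex \<Rightarrow> complex) \<Rightarrow> bool" where
  "test_function U \<phi> \<longleftrightarrow>
     (\<forall>n. Cn n \<phi>) \<and> (\<exists>C. compact C \<and> C \<subseteq> U \<and> (\<forall>z. z \<notin> C \<longrightarrow> \<phi> z = 0))"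

text \<open>The classical Wirtinger derivatives; they are only applied to test functions.\<close>

definition wirtinger_dz :: "(complex \<Rightarrow> complex) \<Rightarrow> complex \<Rightarrow> complex" where
  "wirtinger_dz \<phi> z =
     (frechet_derivative \<phi> (at z) 1 - \<i> * frechet_derivative \<phi> (at z) \<i>) / 2"

definition wirtinger_dzbar :: "(complex \<Rightarrow> complex) \<Rightarrow> complex \<Rightarrow> complex" where
  "wirtinger_dzbar \<phi> z =
     (frechet_derivative \<phi> (at z) 1 + \<i> * frechet_derivative \<phi> (at z) \<i>) / 2"

definition locally_L1 :: "complex set \<Rightarrow> (complex \<Rightarrow> complex) \<Rightarrow> bool" where
  "locally_L1 U p \<longleftrightarrow> (\<forall>C. compact C \<and> C \<subseteq> U \<longrightarrow> set_integrable lebesgue C p)"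

definition weak_dz :: "complex set \<Rightarrow> (complex \<Rightarrow> complex) \<Rightarrow> (complex \<Rightarrow> complex) \<Rightarrow> bool" where
  "weak_dz U f p \<longleftrightarrow>
     (\<forall>\<phi>. test_function U \<phi> \<longrightarrow>
        (LINT z:U|lebesgue. f z * wirtinger_dz \<phi> z) = - (LINT z:U|lebesgue. p z * \<phi> z))"

definition weak_dzbar :: "complex set \<Rightarrow> (complex \<Rightarrow> complex) \<Rightarrow> (complex \<Rightarrow> complex) \<Rightarrow> bool" where
  "weak_dzbar U f q \<longleftrightarrow>
     (\<forall>\<phi>. test_function U \<phi> \<longrightarrow>
        (LINT z:U|lebesgue. f z * wirtinger_dzbar \<phi> z) = - (LINT z:U|lebesgue. q z * \<phi> z))"

text \<open>For a homeomorphism \<open>f\<close> of a plane open set onto its image, preserving the orientation means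
  that the image of every positively oriented circle bounding a disk in the domain has winding number
  \<open>+1\<close> about the image of its centre.\<close>

definition orientation_preserving_on :: "complex set \<Rightarrow> (complex \<Rightarrow> complex) \<Rightarrow> bool" where
  "orientation_preserving_on U f \<longleftrightarrow>
     (\<forall>z\<in>U. \<forall>r>0. cball z r \<subseteq> U \<longrightarrow> winding_number (f \<circ> circlepath z r) (f z) = 1)"

definition quasiconformal_on :: "real \<Rightarrow> complex set \<Rightarrow> (complex \<Rightarrow> complex) \<Rightarrow> bool" where
  "quasiconformal_on k U f \<longleftrightarrow>
     open U \<and> (\<exists>g. homeomorphism U (f ` U) f g) \<and> orientation_preserving_on U f \<and>
     (\<exists>p q. locally_L1 U p \<and> locally_L1 U q \<and> weak_dz U f p \<and> weak_dzbar U f q \<and>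
            (AE z in lebesgue. z \<in> U \<longrightarrow> norm (q z) \<le> k * norm (p z)))"

text \<open>The Riemann sphere is the one-point compactification of the plane; the point at infinity
  is \<^const>\<open>None\<close>.\<close>

definition riemann_sphere :: "complex option topology" where
  "riemann_sphere = Alexandroff_compactification euclidean"

text \<open>The map \<open>w \<mapsto> 1/w\<close> of the sphere, which exchanges the two standard charts.\<close>

fun sphere_inverse :: "complex option \<Rightarrow> complex option" where
  "sphere_inverse None = Some 0"
| "sphere_inverse (Some z) = (if z = 0 then None else Some (inverse z))"

text \<open>With \<open>A\<close> and \<open>B\<close> the identity or \<open>w \<mapsto> 1/w\<close>, the map \<open>B \<circ> F \<circ> A\<close>, restricted to the finite
  points with finite image, is the expression of \<open>F\<close> in the local coordinates \<open>z\<close> or \<open>1/z\<close>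
  on the source and on the target.\<close>

definition quasiconformal_sphere :: "real \<Rightarrow> (complex option \<Rightarrow> complex option) \<Rightarrow> bool" where
  "quasiconformal_sphere k F \<longleftrightarrow>
     homeomorphic_map riemann_sphere riemann_sphere F \<and>
     (\<forall>A\<in>{id, sphere_inverse}. \<forall>B\<in>{id, sphere_inverse}.
        quasiconformal_on k {z. (B \<circ> F \<circ> A) (Some z) \<noteq> None}
                            (\<lambda>z. the ((B \<circ> F \<circ> A) (Some z))))"

definition has_qc_extension_fixing_infinity :: "real \<Rightarrow> (complex \<Rightarrow> complex) \<Rightarrow> bool" where
  "has_qc_extension_fixing_infinity k h \<longleftrightarrow>
     (\<exists>F. quasiconformal_sphere k F \<and> (\<forall>z\<in>right_halfplane. F (Some z) = Some (h z)) \<and> F None = None)"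

end

theory Submission
  imports Defs
begin

text \<open>
  Put \<open>p(z) = (h(z) + a)/h'(z) - z\<close>, a function with values in the disk \<open>D\<close>, and use the
  coordinates \<open>\<zeta> = (z + c)/Re c\<close>, in which the half plane is \<open>Re \<zeta> > 1\<close>, and \<open>u = 2/\<zeta> - 1\<close>, which
  maps it onto the unit disk. With \<open>b = (p - c)/(p + cnj c)\<close> the hypothesis says \<open>\<bar>b\<bar> \<le> k\<close>, and for the
  logarithm \<open>E(u) = log ((h + a)/\<zeta>)\<close> a computation gives \<open>E' = b/(1 + u b)\<close>, that is,
  \<open>\<bar>E'\<bar> \<le> k \<bar>1 - u E'\<bar>\<close> on the unit disk. In particular \<open>E\<close> is Lipschitz with constant \<open>k/(1 - k)\<close> and
  extends to the closed disk. The locale \<open>disk_logarithm\<close> collects exactly this information.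

  The extension is \<open>\<Psi>(\<zeta>) = \<zeta> exp (E(2 \<tau>/\<zeta> - 1))\<close>, where \<open>\<tau>\<close> is \<open>Re \<zeta>\<close> truncated to \<open>[0, 1]\<close>. It equals
  \<open>h + a\<close> for \<open>Re \<zeta> \<ge> 1\<close> and a multiple of \<open>\<zeta>\<close> for \<open>Re \<zeta> \<le> 0\<close>; in the strip between, it is
  \<open>\<zeta> exp (E(cnj \<zeta>/\<zeta>))\<close>. Geometrically, the univalent functions \<open>s h(z/s)\<close>, \<open>1 \<ge> s > 0\<close> (for \<open>a = 0\<close>
  and \<open>c = 1\<close>) form a Loewner chain which starts at \<open>h\<close>, is driven by \<open>p(z/s)\<close> and tends to a linear map as
  \<open>s \<rightarrow> 0\<close>; the strip is filled with the boundary values of its members, as in Becker's extension.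

  Three things have to be shown.

  \<^item> Dilatation. If \<open>E\<close> has the tangential derivative \<open>X\<close> at \<open>u = cnj \<zeta>/\<zeta>\<close>, then at \<open>\<zeta>\<close> the complex
    derivatives of \<open>\<Psi>\<close> are \<open>e (1 - u X)\<close> and \<open>e X\<close> with \<open>e = exp (E u)\<close>. For \<open>\<bar>u\<bar> = 1\<close> the inequality
    \<open>\<bar>X\<bar> \<le> k \<bar>1 - u X\<bar>\<close> describes a closed disk of values \<open>X\<close>; by convexity it passes from \<open>E'\<close> in the open
    disk to difference quotients on the boundary (lemma \<open>boundary_log_derivative\<close>). The derivative exists at
    almost every boundary point because Lipschitz functions of a real variable are differentiable almost
    everywhere, which is proved here from the Vitali covering theorem.

  \<^item> Injectivity. For \<open>Re \<zeta> > 1\<close> the logarithm of \<open>\<Psi>\<close> has a derivative \<open>1/W\<close>, where \<open>Re W\<close> is bounded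
    below by a positive constant. So it is injective up to the boundary line, and its imaginary part increases along vertical lines from \<open>Im E(-1) - \<pi>/2\<close> to
    \<open>Im E(-1) + \<pi>/2\<close>. Hence the image of \<open>Re \<zeta> > 0\<close> lies in a half plane, whose complement is the image of
    \<open>Re \<zeta> \<le> 0\<close>, and the strip is mapped onto the radial segments from \<open>0\<close> to the boundary curve
    (lemma \<open>inj_\<Psi>\<close>).

  \<^item> Regularity. \<open>\<Psi>\<close> is globally Lipschitz and grows linearly. For a locally Lipschitz map, derivatives that
    exist almost everywhere are weak derivatives: the difference quotients are bounded, so one may pass to the
    limit in the discrete integration by parts (lemma \<open>weak_derivatives_exist\<close>). The winding number that
    defines orientation is locally constant in the circle and equals 1 where the map is conformal. The bounds
    on \<open>\<Psi>\<close> make \<open>1/\<Psi>(1/z)\<close> Lipschitz near \<open>0\<close>, so all four charts of the sphere are covered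
    (theorem \<open>quasiconformal_sphereI\<close>).
\<close>

section \<open>Lipschitz functions of one real variable are differentiable almost everywhere\<close>

text \<open>An inequality between two measures on the members of a disjoint family is inherited by their union.
  It is applied to Vitali families and to the measures \<open>df\<close> and \<open>dx\<close>.\<close>
lemma emeasure_UN_mono_disjoint:
  assumes "countable C" and "disjoint_family_on X C"
    and "\<And>i. i \<in> C \<Longrightarrow> X i \<in> sets M" "\<And>i. i \<in> C \<Longrightarrow> X i \<in> sets N"
    and "\<And>i. i \<in> C \<Longrightarrow> \<alpha> * emeasure M (X i) \<le> \<beta> * emeasure N (X i)"
  shows "\<alpha> * emeasure M (\<Union>i\<in>C. X i) \<le> \<beta> * emeasure N (\<Union>i\<in>C. X i)"
  using assms
  by (simp add: emeasure_UN_countable nn_integral_cmult[symmetric])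
     (auto intro!: nn_integral_mono)

lemma open_intervals_cover:
  fixes P :: "real \<Rightarrow> real \<Rightarrow> bool"
  shows "open (\<Union>{{a<..<b} |a b. a < b \<and> b - a < d \<and> P a b})"
  by (intro open_Union) auto

lemma interval_as_ball:
  fixes a b :: real
  obtains c r where "c + r = b" "c - r = a" "b - a = 2 * r" "ball c r = {a<..<b}" "cball c r = {a..b}"
proof -
  have eq: "(a + b) / 2 + (b - a) / 2 = b" "(a + b) / 2 - (b - a) / 2 = a" "b - a = 2 * ((b - a) / 2)"
    by (simp_all add: field_simps)
  show thesis
    by (rule that[OF eq]) (simp_all only: ball_eq_greaterThanLessThan cball_eq_atLeastAtMost eq(1,2))
qed

text \<open>The next two lemmas compare the Stieltjes measure of \<open>f\<close> with Lebesgue measure. Intervals of slope at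
  most \<open>p\<close> (at least \<open>q\<close>) form a Vitali cover of \<open>E\<close>; a disjoint subfamily covers almost all of \<open>E\<close> and the
  slope bounds add up. The upper estimate is stated for an open set \<open>U\<close> instead of \<open>E\<close>, so that
  the lower estimate can afterwards be applied inside \<open>U\<close>.\<close>
lemma vitali_increments_le:
  fixes f :: "real \<Rightarrow> real" and p :: real
  assumes mono: "mono f" and cont: "continuous_on UNIV f" and p: "0 \<le> p"
    and G: "open G" "E \<subseteq> G"
    and E: "\<And>x d. x \<in> E \<Longrightarrow> 0 < d \<Longrightarrow> \<exists>a b. a < x \<and> x < b \<and> b - a < d \<and> f b - f a \<le> p * (b - a)"
  obtains U where "open U" "U \<subseteq> G" "negligible (E - U)"
    "emeasure (interval_measure f) U \<le> ennreal p * emeasure lborel G"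
proof -
  define K where "K = {(c, r). 0 < r \<and> ball c r \<subseteq> G \<and> f (c + r) - f (c - r) \<le> p * (2 * r)}"
  have "\<exists>i. i \<in> K \<and> x \<in> ball (fst i) (snd i) \<and> snd i < d" if x: "x \<in> E" "0 < d" for x d :: real
  proof -
    obtain e where e: "e > 0" "ball x e \<subseteq> G"
      using G x by (meson open_contains_ball subsetD)
    obtain a b where ab: "a < x" "x < b" "b - a < min d e" "f b - f a \<le> p * (b - a)"
      using E[of x "min d e"] x e by auto
    obtain c r where cr: "c + r = b" "c - r = a" "b - a = 2 * r"
      and ball_cr: "ball c r = {a<..<b}" "cball c r = {a..b}"
      by (rule interval_as_ball)
    have "{a<..<b} \<subseteq> ball x e"
      using ab by (auto simp: dist_real_def)
    moreover have "r < d" "0 < r" using ab cr(3) by auto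
    ultimately show ?thesis
      using e ab cr by (intro exI[of _ "(c, r)"]) (auto simp: K_def ball_cr)
  qed
  then obtain C where C: "countable C" "C \<subseteq> K"
     "pairwise (\<lambda>i j. disjnt (ball (fst i) (snd i)) (ball (fst j) (snd j))) C"
     "negligible (E - (\<Union>i \<in> C. ball (fst i) (snd i)))"
    using Vitali_covering_theorem_balls[of E K fst snd] by (metis (no_types, lifting))
  let ?X = "\<lambda>i. ball (fst i) (snd i) :: real set"
  let ?U = "\<Union>i\<in>C. ?X i"
  have disj: "disjoint_family_on ?X C"
    using C(3) by (auto simp: disjoint_family_on_def pairwise_def disjnt_def)
  have "1 * emeasure (interval_measure f) ?U \<le> ennreal p * emeasure lborel ?U"
  proof (rule emeasure_UN_mono_disjoint[OF C(1) disj])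
    fix i assume "i \<in> C"
    then obtain c r where i: "i = (c, r)" "0 < r" "f (c + r) - f (c - r) \<le> p * (2 * r)"
      using C(2) by (auto simp: K_def)
    have "emeasure (interval_measure f) (?X i) \<le> emeasure (interval_measure f) {c - r .. c + r}"
      by (rule emeasure_mono) (auto simp: i dist_real_def)
    also have "\<dots> = ennreal (f (c + r) - f (c - r))"
      using i monoD[OF mono] cont by (intro emeasure_interval_measure_Icc) auto
    also have "\<dots> \<le> ennreal (p * (2 * r))"
      using i by (intro ennreal_leI)
    also have "\<dots> = ennreal p * emeasure lborel (?X i)"
      using i p by (simp add: ennreal_mult[symmetric] ball_eq_greaterThanLessThan)
    finally show "1 * emeasure (interval_measure f) (?X i) \<le> ennreal p * emeasure lborel (?X i)"
      by simp
  qed auto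
  moreover have "?U \<subseteq> G"
  proof (rule UN_least)
    show "?X i \<subseteq> G" if "i \<in> C" for i using subsetD[OF C(2) that] by (auto simp: K_def)
  qed
  then have "emeasure lborel ?U \<le> emeasure lborel G"
    using G by (intro emeasure_mono) auto
  ultimately have "emeasure (interval_measure f) ?U \<le> ennreal p * emeasure lborel G"
    by (metis (no_types, lifting) mult_left_mono mult_1 order_trans zero_le)
  then show thesis
    using that[of ?U] C(4) \<open>?U \<subseteq> G\<close> by auto
qed

lemma vitali_increments_ge:
  fixes f :: "real \<Rightarrow> real" and q :: real
  assumes mono: "mono f" and cont: "continuous_on UNIV f" and q: "0 \<le> q"
    and G: "open G" "E \<subseteq> G" and meas: "E \<in> sets borel"
    and E: "\<And>x d. x \<in> E \<Longrightarrow> 0 < d \<Longrightarrow> \<exists>a b. a < x \<and> x < b \<and> b - a < d \<and> f b - f a \<ge> q * (b - a)"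
  shows "ennreal q * emeasure lborel E \<le> emeasure (interval_measure f) G"
proof -
  define K where "K = {(c, r). 0 < r \<and> cball c r \<subseteq> G \<and> f (c + r) - f (c - r) \<ge> q * (2 * r)}"
  have "\<exists>i. i \<in> K \<and> x \<in> cball (fst i) (snd i) \<and> snd i < d" if x: "x \<in> E" "0 < d" for x d :: real
  proof -
    obtain e where e: "e > 0" "ball x e \<subseteq> G"
      using G x by (meson open_contains_ball subsetD)
    obtain a b where ab: "a < x" "x < b" "b - a < min d e" "f b - f a \<ge> q * (b - a)"
      using E[of x "min d e"] x e by auto
    obtain c r where cr: "c + r = b" "c - r = a" "b - a = 2 * r"
      and ball_cr: "ball c r = {a<..<b}" "cball c r = {a..b}"
      by (rule interval_as_ball)
    have "{a..b} \<subseteq> ball x e"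
      using ab by (auto simp: dist_real_def)
    moreover have "r < d" "0 < r" using ab cr(3) by auto
    ultimately show ?thesis
      using e ab cr by (intro exI[of _ "(c, r)"]) (auto simp: K_def ball_cr)
  qed
  moreover have "\<And>i. i \<in> K \<Longrightarrow> 0 < snd i" by (auto simp: K_def)
  ultimately obtain C where C: "countable C" "C \<subseteq> K"
     "pairwise (\<lambda>i j. disjnt (cball (fst i) (snd i)) (cball (fst j) (snd j))) C"
     "negligible (E - (\<Union>i \<in> C. cball (fst i) (snd i)))"
    using Vitali_covering_theorem_cballs[of K snd E fst] by (metis (no_types, lifting))
  let ?X = "\<lambda>i. cball (fst i) (snd i) :: real set"
  let ?U = "\<Union>i\<in>C. ?X i"
  have disj: "disjoint_family_on ?X C"
    using C(3) by (auto simp: disjoint_family_on_def pairwise_def disjnt_def)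
  have U: "?U \<in> sets borel" using C(1) by (intro sets.countable_UN'') auto
  have "emeasure lborel E \<le> emeasure lborel (?U \<union> (E - ?U))"
    using meas U by (intro emeasure_mono) auto
  also have "\<dots> \<le> emeasure lborel ?U + emeasure lborel (E - ?U)"
    using meas U by (intro emeasure_subadditive) auto
  also have "emeasure lborel (E - ?U) = 0"
  proof -
    have "emeasure lebesgue (E - ?U) = 0"
      using C(4) by (meson emeasure_eq_0_AE negligible_iff_null_sets null_setsD1)
    moreover have "E - ?U \<in> sets lborel" using meas U by auto
    ultimately show ?thesis by simp
  qed
  finally have le: "emeasure lborel E \<le> emeasure lborel ?U" by simp
  have "ennreal q * emeasure lborel ?U \<le> 1 * emeasure (interval_measure f) ?U"
  proof (rule emeasure_UN_mono_disjoint[OF C(1) disj])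
    fix i assume "i \<in> C"
    then obtain c r where i: "i = (c, r)" "0 < r" "f (c + r) - f (c - r) \<ge> q * (2 * r)"
      using C(2) by (auto simp: K_def)
    have "ennreal q * emeasure lborel (?X i) = ennreal (q * (2 * r))"
      using i q by (simp add: ennreal_mult[symmetric] cball_eq_atLeastAtMost)
    also have "\<dots> \<le> ennreal (f (c + r) - f (c - r))"
      using i by (intro ennreal_leI)
    also have "\<dots> = emeasure (interval_measure f) {c - r .. c + r}"
      using i monoD[OF mono] cont by (intro emeasure_interval_measure_Icc[symmetric]) auto
    finally show "ennreal q * emeasure lborel (?X i) \<le> 1 * emeasure (interval_measure f) (?X i)"
      by (simp add: i cball_eq_atLeastAtMost)
  qed auto
  also have "\<dots> \<le> emeasure (interval_measure f) G"
  proof -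
    have "?X i \<subseteq> G" if "i \<in> C" for i using subsetD[OF C(2) that] by (auto simp: K_def)
    then have "?U \<subseteq> G" by (rule UN_least)
    then show ?thesis using G by (simp add: emeasure_mono)
  qed
  finally show ?thesis
    using le by (meson mult_left_mono order_trans zero_le)
qed

text \<open>The points lying in arbitrarily short open intervals on which the mean slope of \<open>f\<close> satisfies \<open>P\<close>.
  Requiring the point to be interior makes this a countable intersection of open sets, so measurability is
  automatic.\<close>
definition small_slopes :: "(real \<Rightarrow> real) \<Rightarrow> (real \<Rightarrow> bool) \<Rightarrow> real set" where
  "small_slopes f P =
     (\<Inter>n::nat. \<Union>{{a<..<b} |a b. a < b \<and> b - a < 1 / (real n + 1) \<and> P ((f b - f a) / (b - a))})"

lemma small_slopes_borel: "small_slopes f P \<in> sets borel"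
  unfolding small_slopes_def
  by (intro sets.countable_INT'' countableI_type borel_open open_intervals_cover) auto

lemma small_slopesD:
  assumes "x \<in> small_slopes f P" "0 < d"
  shows "\<exists>a b. a < x \<and> x < b \<and> b - a < d \<and> P ((f b - f a) / (b - a))"
proof -
  obtain n where n: "1 / (real n + 1) < d"
    using reals_Archimedean[OF assms(2)] by (auto simp: inverse_eq_divide add.commute)
  have "x \<in> (\<Union>{{a<..<b} |a b. a < b \<and> b - a < 1 / (real n + 1) \<and> P ((f b - f a) / (b - a))})"
    using assms(1) unfolding small_slopes_def by blast
  then obtain a b where "a < x" "x < b" "b - a < 1 / (real n + 1)" "P ((f b - f a) / (b - a))"
    by auto
  with n show ?thesis by (intro exI[of _ a] exI[of _ b]) auto
qed

lemma small_slopesI: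
  assumes "\<And>d. 0 < d \<Longrightarrow> \<exists>a b. a < x \<and> x < b \<and> b - a < d \<and> P ((f b - f a) / (b - a))"
  shows "x \<in> small_slopes f P"
  unfolding small_slopes_def
proof (intro INT_I)
  fix n :: nat
  have "1 / (real n + 1) > 0" by simp
  from assms[OF this] obtain a b where "a < x" "x < b" "b - a < 1 / (real n + 1)" "P ((f b - f a) / (b - a))"
    by blast
  then show "x \<in> (\<Union>{{a<..<b} |a b. a < b \<and> b - a < 1 / (real n + 1) \<and> P ((f b - f a) / (b - a))})"
    by (intro UnionI[of "{a<..<b}"] CollectI exI[of _ a] exI[of _ b]) auto
qed

text \<open>On \<open>E\<close>, the part of the set in a bounded interval, the two Vitali estimates give
  \<open>q \<bar>E\<bar> \<le> p (\<bar>E\<bar> + e)\<close> for every \<open>e > 0\<close>, and \<open>p < q\<close> leaves only \<open>\<bar>E\<bar> = 0\<close>.\<close>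
lemma negligible_oscillating_slopes:
  fixes f :: "real \<Rightarrow> real"
  assumes mono: "mono f" and cont: "continuous_on UNIV f" and pq: "0 \<le> p" "p < q"
  shows "negligible (small_slopes f (\<lambda>s. s < p) \<inter> small_slopes f (\<lambda>s. s > q))"
proof -
  have "negligible (small_slopes f (\<lambda>s. s < p) \<inter> small_slopes f (\<lambda>s. s > q) \<inter> cbox a b)" for a b
  proof -
    define E where "E = small_slopes f (\<lambda>s. s < p) \<inter> small_slopes f (\<lambda>s. s > q) \<inter> cbox a b"
    have E: "E \<in> sets borel"
      unfolding E_def by (intro sets.Int small_slopes_borel) auto
    have fin: "emeasure lborel E < \<infinity>"
    proof -
      have "emeasure lborel E \<le> emeasure lborel (cbox a b)"
        by (rule emeasure_mono) (auto simp: E_def)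
      then show ?thesis
        using emeasure_lborel_cbox_finite[of a b] by (rule le_less_trans)
    qed
    have "ennreal q * emeasure lborel E \<le> ennreal p * emeasure lborel E + ennreal p * ennreal e"
      if e: "0 < e" for e
    proof -
      have "E \<in> sets lebesgue" using E by simp
      then obtain G where G: "open G" "E \<subseteq> G" "emeasure lebesgue (G - E) < ennreal e"
        using e by (rule sets_lebesgue_outer_open)
      have GE: "emeasure lborel (G - E) < ennreal e"
        using G E by simp
      obtain U where U: "open U" "U \<subseteq> G" "negligible (E - U)"
        "emeasure (interval_measure f) U \<le> ennreal p * emeasure lborel G"
      proof (rule vitali_increments_le[OF mono cont pq(1) G(1,2)])
        fix x d :: real assume "x \<in> E" "0 < d"
        then obtain a b where ab: "a < x" "x < b" "b - a < d" "(f b - f a) / (b - a) < p"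
          using small_slopesD[of x f "\<lambda>s. s < p" d] by (auto simp: E_def)
        then have "f b - f a \<le> p * (b - a)"
          by (simp add: divide_simps mult.commute split: if_splits)
        with ab show "\<exists>a b. a < x \<and> x < b \<and> b - a < d \<and> f b - f a \<le> p * (b - a)" by blast
      qed
      have "ennreal q * emeasure lborel (E \<inter> U) \<le> emeasure (interval_measure f) U"
      proof (rule vitali_increments_ge[OF mono cont _ U(1)])
        fix x d :: real assume "x \<in> E \<inter> U" "0 < d"
        then obtain a b where ab: "a < x" "x < b" "b - a < d" "(f b - f a) / (b - a) > q"
          using small_slopesD[of x f "\<lambda>s. s > q" d] by (auto simp: E_def)
        then have "f b - f a \<ge> q * (b - a)"
          by (simp add: divide_simps mult.commute split: if_splits)
        with ab show "\<exists>a b. a < x \<and> x < b \<and> b - a < d \<and> f b - f a \<ge> q * (b - a)" by blast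
      qed (use pq E U in auto)
      moreover have "emeasure lborel E = emeasure lborel (E \<inter> U)"
      proof -
        have "E - U \<in> null_sets lborel"
          using U(1,3) E null_sets_completion_iff[of "E - U" lborel]
          by (simp add: negligible_iff_null_sets)
        then have "emeasure lborel (E - (E - U)) = emeasure lborel E"
          using E by (intro emeasure_Diff_null_set) auto
        then show ?thesis
          by (simp add: Diff_Diff_Int)
      qed
      moreover have "emeasure lborel G \<le> emeasure lborel E + ennreal e"
      proof -
        have "emeasure lborel G = emeasure lborel E + emeasure lborel (G - E)"
          using E G by (subst plus_emeasure) (auto simp: Un_absorb1)
        with GE show ?thesis by (simp add: add_left_mono)
      qed
      ultimately have "ennreal q * emeasure lborel E \<le> emeasure (interval_measure f) U"
          and "ennreal p * emeasure lborel G \<le> ennreal p * (emeasure lborel E + ennreal e)"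
        by (auto intro: mult_left_mono)
      then have "ennreal q * emeasure lborel E \<le> ennreal p * (emeasure lborel E + ennreal e)"
        using U(4) by (meson order_trans)
      then show ?thesis by (simp add: distrib_left)
    qed
    note bound = this
    have real_bound: "q * measure lborel E \<le> p * measure lborel E + p * e" if "0 < e" for e
    proof -
      have eq: "emeasure lborel E = ennreal (measure lborel E)"
        using fin by (simp add: emeasure_eq_ennreal_measure less_top)
      from bound[OF that] show ?thesis
        using pq that by (simp add: eq ennreal_mult[symmetric] ennreal_plus[symmetric] del: ennreal_plus)
    qed
    have "q * measure lborel E \<le> p * measure lborel E"
    proof -
      have "q * measure lborel E \<le> p * measure lborel E + e" if "0 < e" for e
      proof (cases "p = 0")
        case True then show ?thesis using real_bound[of 1] that by simp
      next
        case False
        then show ?thesis using real_bound[of "e / p"] that pq by simp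
      qed
      then show ?thesis by (rule field_le_epsilon)
    qed
    then have "measure lborel E = 0"
      using pq measure_nonneg[of lborel E] by (simp add: mult_le_cancel_right)
    then have "emeasure lborel E = 0"
      using fin by (simp add: emeasure_eq_ennreal_measure less_top)
    then show ?thesis
      using E unfolding E_def[symmetric]
      by (simp add: negligible_iff_null_sets null_setsI null_sets_completionI)
  qed
  then show ?thesis by (subst negligible_on_intervals) auto
qed

lemma frequently_at_zero_symmetric:
  "frequently P (at (0::real)) \<Longrightarrow> 0 < d \<Longrightarrow> \<exists>h. h \<noteq> 0 \<and> \<bar>h\<bar> < d \<and> P h"
  by (auto simp: frequently_at dist_real_def)

text \<open>The difference quotient is the slope over an interval that has \<open>x\<close> as an end point; by continuity the
  interval can be enlarged slightly on both sides without leaving the open set \<open>S\<close>.\<close>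
lemma small_slopes_quotient:
  fixes f :: "real \<Rightarrow> real"
  assumes cont: "continuous_on UNIV f" and S: "open S"
    and freq: "frequently (\<lambda>h. (f (x + h) - f x) / h \<in> S) (at 0)"
  shows "x \<in> small_slopes f (\<lambda>s. s \<in> S)"
proof (rule small_slopesI)
  fix d :: real assume d: "0 < d"
  obtain h where h: "h \<noteq> 0" "\<bar>h\<bar> < d / 2" "(f (x + h) - f x) / h \<in> S"
    using frequently_at_zero_symmetric[OF freq, of "d / 2"] d by auto
  define a b where "a = min x (x + h)" and "b = max x (x + h)"
  have ab: "a < b" "a \<le> x" "x \<le> b" "b - a < d / 2"
    using h by (auto simp: a_def b_def min_def max_def)
  have slope: "(f b - f a) / (b - a) \<in> S"
    using h(3) by (cases "h > 0") (auto simp: a_def b_def min_def max_def minus_divide_left)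
  have "isCont f y" for y
    using cont by (simp add: continuous_on_eq_continuous_at)
  then have lim: "(\<lambda>t. f (g t)) \<midarrow>0\<rightarrow> f y" if "g \<midarrow>0\<rightarrow> y" for g y
    using that by (rule isCont_tendsto_compose)
  have "(\<lambda>t. b + t) \<midarrow>0\<rightarrow> b + 0" "(\<lambda>t. a - t) \<midarrow>0\<rightarrow> a - 0"
    by (intro tendsto_intros)+
  then have ba: "(\<lambda>t. b + t) \<midarrow>0\<rightarrow> b" "(\<lambda>t. a - t) \<midarrow>0\<rightarrow> a"
    by simp_all
  have "(\<lambda>t. (f (b + t) - f (a - t)) / ((b + t) - (a - t))) \<midarrow>0\<rightarrow> (f b - f a) / (b - a)"
    using ab(1) by (intro tendsto_divide tendsto_diff lim ba) auto
  then have "\<forall>\<^sub>F t in at 0. (f (b + t) - f (a - t)) / ((b + t) - (a - t)) \<in> S"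
    using S slope by (auto dest: topological_tendstoD)
  then obtain e where e: "e > 0"
    "\<And>t. t \<noteq> 0 \<Longrightarrow> \<bar>t\<bar> < e \<Longrightarrow> (f (b + t) - f (a - t)) / ((b + t) - (a - t)) \<in> S"
    by (auto simp: eventually_at dist_real_def)
  define t where "t = min (e / 2) (d / 8)"
  have t: "0 < t" "t < e" "t \<le> d / 8" using e d by (auto simp: t_def)
  show "\<exists>a b. a < x \<and> x < b \<and> b - a < d \<and> (f b - f a) / (b - a) \<in> S"
    using t ab d e(2)[of t] by (intro exI[of _ "a - t"] exI[of _ "b + t"]) auto
qed

text \<open>Where the difference quotients have no limit, rational numbers \<open>p < q\<close> separate their lower and upper
  limits, and there are only countably many such pairs.\<close>
lemma mono_lipschitz_differentiable_ae:
  fixes f :: "real \<Rightarrow> real"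
  assumes mono: "mono f" and lip: "M-lipschitz_on UNIV f"
  obtains N where "negligible N" "\<And>x. x \<notin> N \<Longrightarrow> \<exists>d. (f has_real_derivative d) (at x)"
proof -
  have cont: "continuous_on UNIV f"
    using lip by (rule lipschitz_on_continuous_on)
  define N where "N = (\<Union>(p, q)\<in>{(p, q). p \<in> \<rat> \<and> q \<in> \<rat> \<and> 0 \<le> p \<and> p < q}.
      small_slopes f (\<lambda>s. s \<in> {..<p}) \<inter> small_slopes f (\<lambda>s. s \<in> {q<..}))"
  have "countable {(p, q). p \<in> \<rat> \<and> q \<in> (\<rat>::real set) \<and> 0 \<le> p \<and> p < q}"
    by (rule countable_subset[of _ "\<rat> \<times> \<rat>"]) (auto simp: countable_rat)
  then have "negligible N"
    unfolding N_def
    by (intro negligible_countable_Union) (auto intro!: negligible_oscillating_slopes mono cont)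
  moreover have "\<exists>d. (f has_real_derivative d) (at x)" if x: "x \<notin> N" for x
  proof -
    define \<phi> where "\<phi> = (\<lambda>h. (f (x + h) - f x) / h)"
    have bd: "0 \<le> \<phi> h" "\<phi> h \<le> M" if "h \<noteq> 0" for h
    proof -
      show "0 \<le> \<phi> h"
        using monoD[OF mono, of x "x + h"] monoD[OF mono, of "x + h" x] that
        by (cases "h > 0") (auto simp: \<phi>_def divide_simps)
      have "\<bar>f (x + h) - f x\<bar> \<le> M * \<bar>h\<bar>"
        using lipschitz_onD[OF lip, of "x + h" x] by (simp add: dist_real_def)
      then have "\<bar>\<phi> h\<bar> \<le> M"
        using that by (simp add: \<phi>_def abs_divide divide_simps)
      then show "\<phi> h \<le> M" by simp
    qed
    have ev: "\<forall>\<^sub>F h in at 0. 0 \<le> \<phi> h \<and> \<phi> h \<le> M"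
      using bd by (auto simp: eventually_at intro!: exI[of _ 1])
    let ?l = "Liminf (at 0) (\<lambda>h. ereal (\<phi> h))" and ?L = "Limsup (at 0) (\<lambda>h. ereal (\<phi> h))"
    have le: "?l \<le> ?L" by (rule Liminf_le_Limsup) simp
    have l0: "0 \<le> ?l"
      by (rule Liminf_bounded) (use ev in \<open>auto elim: eventually_mono simp: zero_ereal_def\<close>)
    have LM: "?L \<le> ereal M"
      by (rule Limsup_bounded) (use ev in \<open>auto elim: eventually_mono\<close>)
    have eq: "?l = ?L"
    proof (rule ccontr)
      assume "?l \<noteq> ?L"
      with le have less: "?l < ?L" by simp
      then obtain p :: rat where p: "?l < ereal (of_rat p)" "ereal (of_rat p) < ?L"
        using ereal_dense3 by blast
      obtain q :: rat where q: "ereal (of_rat p) < ereal (of_rat q)" "ereal (of_rat q) < ?L"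
        using ereal_dense3[OF p(2)] by blast
      have "frequently (\<lambda>h. \<phi> h \<in> {..<of_rat p}) (at 0)"
      proof (rule ccontr)
        assume "\<not> ?thesis"
        then have "\<forall>\<^sub>F h in at 0. ereal (of_rat p) \<le> ereal (\<phi> h)"
          by (simp add: not_frequently not_less)
        then have "ereal (of_rat p) \<le> ?l" by (rule Liminf_bounded)
        with p(1) show False by simp
      qed
      moreover have "frequently (\<lambda>h. \<phi> h \<in> {of_rat q<..}) (at 0)"
      proof (rule ccontr)
        assume "\<not> ?thesis"
        then have "\<forall>\<^sub>F h in at 0. ereal (\<phi> h) \<le> ereal (of_rat q)"
          by (simp add: not_frequently not_less)
        then have "?L \<le> ereal (of_rat q)" by (rule Limsup_bounded)
        with q(2) show False by simp
      qed
      ultimately have "x \<in> small_slopes f (\<lambda>s. s \<in> {..<of_rat p})"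
          "x \<in> small_slopes f (\<lambda>s. s \<in> {of_rat q<..})"
        unfolding \<phi>_def
        using small_slopes_quotient[OF cont open_lessThan] small_slopes_quotient[OF cont open_greaterThan]
        by blast+
      moreover have "0 \<le> (of_rat p :: real)" "(of_rat p :: real) < of_rat q"
        using q(1) le_less_trans[OF l0 p(1)] by (auto simp: zero_ereal_def)
      ultimately have "(of_rat p, of_rat q) \<in> {(p, q). p \<in> \<rat> \<and> q \<in> \<rat> \<and> 0 \<le> p \<and> p < (q::real)}"
          "x \<in> small_slopes f (\<lambda>s. s \<in> {..<of_rat p}) \<inter> small_slopes f (\<lambda>s. s \<in> {of_rat q<..})"
        by auto
      then have "x \<in> N"
        unfolding N_def by (intro UN_I[of "(of_rat p, of_rat q)"]; simp only: prod.case)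
      with x show False by simp
    qed
    have "?L \<noteq> \<infinity>" "?L \<noteq> -\<infinity>"
      using l0 LM le by auto
    then obtain d where "?L = ereal d" by (cases ?L) auto
    with eq have "((\<lambda>h. ereal (\<phi> h)) \<longlongrightarrow> ereal d) (at 0)"
      by (subst tendsto_iff_Liminf_eq_Limsup) auto
    then have "(\<phi> \<longlongrightarrow> d) (at 0)" by simp
    then show ?thesis
      unfolding DERIV_def \<phi>_def by blast
  qed
  ultimately show thesis by (rule that)
qed

text \<open>Adding \<open>M x\<close> to an \<open>M\<close>-Lipschitz function makes it monotone.\<close>
theorem lipschitz_real_differentiable_ae:
  fixes f :: "real \<Rightarrow> real"
  assumes lip: "M-lipschitz_on UNIV f"
  obtains N where "negligible N" "\<And>x. x \<notin> N \<Longrightarrow> \<exists>d. (f has_real_derivative d) (at x)"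
proof -
  define g where "g = (\<lambda>x. f x + M * x)"
  have M: "0 \<le> M" using lip by (rule lipschitz_on_nonneg)
  have "mono g"
  proof (rule monoI)
    fix x y :: real assume "x \<le> y"
    then show "g x \<le> g y"
      using lipschitz_onD[OF lip, of x y] by (auto simp: g_def dist_real_def algebra_simps)
  qed
  moreover have "(M + M)-lipschitz_on UNIV g"
    unfolding g_def using M
    by (intro lipschitz_on_add lip lipschitz_onI)
       (auto simp: dist_real_def abs_mult right_diff_distrib[symmetric])
  ultimately obtain N where N: "negligible N" "\<And>x. x \<notin> N \<Longrightarrow> \<exists>d. (g has_real_derivative d) (at x)"
    by (rule mono_lipschitz_differentiable_ae) (rule that)
  have "\<exists>d. (f has_real_derivative d) (at x)" if x: "x \<notin> N" for x
  proof -
    obtain d where "(g has_real_derivative d) (at x)" using N(2)[OF x] by blast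
    then have "((\<lambda>x. g x - M * x) has_real_derivative d - M) (at x)"
      by (auto intro!: derivative_eq_intros)
    then have "(f has_real_derivative d - M) (at x)" by (simp add: g_def)
    then show ?thesis ..
  qed
  then show thesis by (rule that[OF N(1)])
qed

corollary lipschitz_complex_differentiable_ae:
  fixes f :: "real \<Rightarrow> complex"
  assumes lip: "M-lipschitz_on UNIV f"
  obtains N where "negligible N" "\<And>x. x \<notin> N \<Longrightarrow> \<exists>d. (f has_vector_derivative d) (at x)"
proof -
  have bound: "norm (f x - f y) \<le> M * dist x y" for x y
    using lipschitz_onD[OF lip, of x y] by (simp add: dist_norm)
  have M: "0 \<le> M" using lip by (rule lipschitz_on_nonneg)
  have "M-lipschitz_on UNIV (\<lambda>x. Re (f x))"
  proof (rule lipschitz_onI)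
    show "dist (Re (f x)) (Re (f y)) \<le> M * dist x y" for x y
      using order_trans[OF abs_Re_le_cmod bound[of x y]] by (simp add: dist_real_def)
  qed (rule M)
  then obtain N1 where N1:
    "negligible N1" "\<And>x. x \<notin> N1 \<Longrightarrow> \<exists>d. ((\<lambda>x. Re (f x)) has_real_derivative d) (at x)"
    by (rule lipschitz_real_differentiable_ae) (rule that)
  have "M-lipschitz_on UNIV (\<lambda>x. Im (f x))"
  proof (rule lipschitz_onI)
    show "dist (Im (f x)) (Im (f y)) \<le> M * dist x y" for x y
      using order_trans[OF abs_Im_le_cmod bound[of x y]] by (simp add: dist_real_def)
  qed (rule M)
  then obtain N2 where N2:
    "negligible N2" "\<And>x. x \<notin> N2 \<Longrightarrow> \<exists>d. ((\<lambda>x. Im (f x)) has_real_derivative d) (at x)"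
    by (rule lipschitz_real_differentiable_ae) (rule that)
  note N = N1 N2
  show thesis
  proof
    show "negligible (N1 \<union> N2)" using N by simp
    fix x assume "x \<notin> N1 \<union> N2"
    then obtain d e where "((\<lambda>x. Re (f x)) has_real_derivative d) (at x)"
        "((\<lambda>x. Im (f x)) has_real_derivative e) (at x)"
      using N by blast
    then have "(f has_vector_derivative Complex d e) (at x)"
      by (simp add: has_vector_derivative_complex_iff has_real_derivative_iff_has_vector_derivative)
    then show "\<exists>d. (f has_vector_derivative d) (at x)" by blast
  qed
qed

section \<open>Almost everywhere derivatives of locally Lipschitz maps are weak derivatives\<close>

text \<open>The balls are required to lie in \<open>U\<close>, so the definition also forces \<open>U\<close> to be open.\<close>
definition locally_lipschitz :: "complex set \<Rightarrow> (complex \<Rightarrow> complex) \<Rightarrow> bool" where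
  "locally_lipschitz U f \<longleftrightarrow> (\<forall>z\<in>U. \<exists>e>0. \<exists>M. ball z e \<subseteq> U \<and> M-lipschitz_on (ball z e) f)"

lemma locally_lipschitzI:
  assumes "\<And>z. z \<in> U \<Longrightarrow> \<exists>e>0. \<exists>M. ball z e \<subseteq> U \<and> M-lipschitz_on (ball z e) f"
  shows "locally_lipschitz U f"
  using assms by (auto simp: locally_lipschitz_def)

lemma locally_lipschitz_imp_open: "locally_lipschitz U f \<Longrightarrow> open U"
  unfolding locally_lipschitz_def open_contains_ball by blast

lemma locally_lipschitz_imp_continuous:
  assumes "locally_lipschitz U f"
  shows "continuous_on U f"
proof -
  have "isCont f z" if "z \<in> U" for z
  proof -
    obtain e M where "e > 0" "M-lipschitz_on (ball z e) f"
      using assms \<open>z \<in> U\<close> by (auto simp: locally_lipschitz_def)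
    then show ?thesis
      by (meson centre_in_ball continuous_on_eq_continuous_at lipschitz_on_continuous_on open_ball)
  qed
  then show ?thesis
    by (simp add: continuous_at_imp_continuous_on)
qed

text \<open>Local Lipschitz constants become uniform for steps of bounded length that start in a compact set. This
  provides the integrable majorants for difference quotients.\<close>
lemma locally_lipschitz_near_compact:
  assumes f: "locally_lipschitz U f" and C: "compact C" "C \<subseteq> U"
  obtains d M where "d > 0" "M \<ge> 0"
    "\<And>z w. z \<in> C \<Longrightarrow> dist w z < d \<Longrightarrow> w \<in> U \<and> norm (f w - f z) \<le> M * norm (w - z)"
proof -
  obtain e M where eM: "\<And>z. z \<in> U \<Longrightarrow> e z > 0 \<and> ball z (e z) \<subseteq> U \<and> (M z)-lipschitz_on (ball z (e z)) f"
    using f unfolding locally_lipschitz_def by metis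
  have "C \<subseteq> (\<Union>z\<in>C. ball z (e z / 2))"
    using eM C by force
  then obtain T where T: "T \<subseteq> C" "finite T" "C \<subseteq> (\<Union>z\<in>T. ball z (e z / 2))"
    using compactE_image[OF C(1), of C "\<lambda>z. ball z (e z / 2)"] by auto
  define d where "d = Min (insert 1 ((\<lambda>z. e z / 2) ` T))"
  have TU: "T \<subseteq> U" using T C by blast
  have Mpos: "0 \<le> M z" if "z \<in> T" for z
    using eM TU that lipschitz_on_nonneg by blast
  have "d > 0" using T eM TU by (auto simp: d_def)
  moreover have "0 \<le> sum M T" using Mpos by (rule sum_nonneg)
  moreover have "w \<in> U \<and> norm (f w - f z) \<le> sum M T * norm (w - z)" if zw: "z \<in> C" "dist w z < d" for z w
  proof -
    obtain t where t: "t \<in> T" "dist t z < e t / 2" using T zw by force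
    have "d \<le> e t / 2" unfolding d_def using T t by (intro Min_le) auto
    then have "dist t w < e t"
      using t zw dist_triangle[of t w z] by (simp add: dist_commute)
    moreover have "dist t z < e t" using t zero_le_dist[of t z] by linarith
    ultimately have *: "w \<in> ball t (e t)" "z \<in> ball t (e t)" by auto
    have et: "ball t (e t) \<subseteq> U" "(M t)-lipschitz_on (ball t (e t)) f" using eM TU t by auto
    have "norm (f w - f z) \<le> M t * norm (w - z)"
      using lipschitz_onD[OF et(2) *] by (simp add: dist_norm)
    also have "\<dots> \<le> sum M T * norm (w - z)"
      using member_le_sum[OF t(1), of M] Mpos T by (intro mult_right_mono) auto
    finally show ?thesis using * et by auto
  qed
  ultimately show thesis by (rule that)
qed

lemma test_function_differentiable:
  assumes "test_function U \<phi>"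
  shows "\<phi> differentiable (at z)"
proof -
  have "Cn (Suc 0) \<phi>" using assms unfolding test_function_def by blast
  then show ?thesis by (auto simp: differentiable_def)
qed

lemma test_function_locally_lipschitz:
  assumes "test_function U \<phi>"
  shows "locally_lipschitz UNIV \<phi>"
proof (rule locally_lipschitzI)
  fix z
  have "Cn (Suc 0) \<phi>" using assms unfolding test_function_def by blast
  then obtain \<phi>x \<phi>y where d: "\<And>z. (\<phi> has_derivative (\<lambda>h. Re h *\<^sub>R \<phi>x z + Im h *\<^sub>R \<phi>y z)) (at z)"
      and cont: "continuous_on UNIV \<phi>x" "continuous_on UNIV \<phi>y" by auto
  have "continuous_on (cball z 1) \<phi>x" "continuous_on (cball z 1) \<phi>y"
    using cont continuous_on_subset by blast+
  then have "bounded (\<phi>x ` cball z 1)" "bounded (\<phi>y ` cball z 1)"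
    by (meson compact_cball compact_continuous_image compact_imp_bounded)+
  then obtain A B where AB: "\<And>w. w \<in> cball z 1 \<Longrightarrow> norm (\<phi>x w) \<le> A" "\<And>w. w \<in> cball z 1 \<Longrightarrow> norm (\<phi>y w) \<le> B"
    unfolding bounded_iff by (meson image_eqI)
  have "norm (\<phi> x - \<phi> y) \<le> (A + B) * norm (x - y)" if "x \<in> ball z 1" "y \<in> ball z 1" for x y
  proof (rule differentiable_bound[OF convex_ball _ _ that])
    fix w assume w: "w \<in> ball z 1"
    show "(\<phi> has_derivative (\<lambda>h. Re h *\<^sub>R \<phi>x w + Im h *\<^sub>R \<phi>y w)) (at w within ball z 1)"
      using d by (rule has_derivative_at_withinI)
    show "onorm (\<lambda>h. Re h *\<^sub>R \<phi>x w + Im h *\<^sub>R \<phi>y w) \<le> A + B"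
    proof (rule onorm_le)
      fix h
      have "norm (Re h *\<^sub>R \<phi>x w + Im h *\<^sub>R \<phi>y w) \<le> \<bar>Re h\<bar> * norm (\<phi>x w) + \<bar>Im h\<bar> * norm (\<phi>y w)"
        by (metis norm_scaleR norm_triangle_ineq)
      also have "\<dots> \<le> norm h * A + norm h * B"
        using AB w by (intro add_mono mult_mono abs_Re_le_cmod abs_Im_le_cmod) auto
      finally show "norm (Re h *\<^sub>R \<phi>x w + Im h *\<^sub>R \<phi>y w) \<le> (A + B) * norm h"
        by (simp add: algebra_simps)
    qed
  qed
  moreover have "0 \<le> A + B" using AB[of z] norm_ge_zero[of "\<phi>x z"] norm_ge_zero[of "\<phi>y z"] 
    by (simp add: add_nonneg_nonneg order_trans[OF norm_ge_zero])
  ultimately have "(A + B)-lipschitz_on (ball z 1) \<phi>"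
    by (intro lipschitz_onI) (auto simp: dist_norm)
  then show "\<exists>e>0. \<exists>M. ball z e \<subseteq> UNIV \<and> M-lipschitz_on (ball z e) \<phi>"
    by (intro exI[of _ 1] exI[of _ "A + B"]) auto
qed

lemma directional_quotient_tendsto:
  fixes f :: "'a::real_normed_vector \<Rightarrow> 'b::real_normed_vector"
  assumes f: "(f has_derivative D) (at z)" and t: "t \<longlonglongrightarrow> 0" "\<And>n. t n \<noteq> (0::real)"
  shows "(\<lambda>n. (f (z + t n *\<^sub>R v) - f z) /\<^sub>R t n) \<longlonglongrightarrow> D v"
proof -
  have "((\<lambda>s. f (z + s *\<^sub>R v)) has_derivative (\<lambda>s. D (s *\<^sub>R v))) (at 0)"
    by (rule has_derivative_compose[of "\<lambda>s. z + s *\<^sub>R v" "\<lambda>s. s *\<^sub>R v" 0 UNIV f D])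
       (auto intro!: derivative_eq_intros simp: f)
  moreover have "D (s *\<^sub>R v) = s *\<^sub>R D v" for s
    using f by (simp add: has_derivative_def bounded_linear.linear linear_cmul)
  ultimately have "(\<lambda>s. norm (f (z + s *\<^sub>R v) - f z - s *\<^sub>R D v) / norm s) \<midarrow>0\<rightarrow> 0"
    by (simp add: has_derivative_at)
  moreover have "filterlim t (at 0) sequentially"
    using t by (simp add: filterlim_at)
  ultimately have "(\<lambda>n. norm (f (z + t n *\<^sub>R v) - f z - t n *\<^sub>R D v) / norm (t n)) \<longlonglongrightarrow> 0"
    by (rule filterlim_compose)
  moreover have "norm (f (z + t n *\<^sub>R v) - f z - t n *\<^sub>R D v) / norm (t n)
      = norm ((f (z + t n *\<^sub>R v) - f z) /\<^sub>R t n - D v)" for n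
  proof -
    have "(f (z + t n *\<^sub>R v) - f z) /\<^sub>R t n - D v = (f (z + t n *\<^sub>R v) - f z - t n *\<^sub>R D v) /\<^sub>R t n"
      using t(2)[of n] by (simp add: scaleR_diff_right)
    then show ?thesis by (simp add: divide_inverse_commute)
  qed
  ultimately show ?thesis
    by (simp add: LIM_zero_iff tendsto_norm_zero_iff)
qed

text \<open>The limit is taken along one fixed sequence, and \<^const>\<open>lim\<close> is total; the result is therefore a Borel
  function on the whole plane, whatever happens on the exceptional null set.\<close>
definition directional :: "(complex \<Rightarrow> complex) \<Rightarrow> complex \<Rightarrow> complex \<Rightarrow> complex" where
  "directional f v z = lim (\<lambda>n. (f (z + (- inverse (real (Suc n))) *\<^sub>R v) - f z) /\<^sub>R - inverse (real (Suc n)))"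

lemma inverse_Suc_tendsto: "(\<lambda>n. - inverse (real (Suc n))) \<longlonglongrightarrow> 0"
  using tendsto_minus[OF LIMSEQ_inverse_real_of_nat] by simp

lemma directional_tendsto:
  fixes f :: "complex \<Rightarrow> complex"
  assumes "(f has_derivative D) (at z)"
  shows "(\<lambda>n. (f (z + (- inverse (real (Suc n))) *\<^sub>R v) - f z) /\<^sub>R - inverse (real (Suc n))) \<longlonglongrightarrow> D v"
  by (rule directional_quotient_tendsto[OF assms inverse_Suc_tendsto]) simp

lemma directional_eq:
  assumes "(f has_derivative D) (at z)"
  shows "directional f v z = D v"
  unfolding directional_def by (rule limI) (rule directional_tendsto[OF assms])


lemma lborel_integral_translate:
  fixes H :: "complex \<Rightarrow> complex"
  assumes "integrable lborel H"
  shows "integrable lborel (\<lambda>z. H (a + z))" "(\<integral>z. H (a + z) \<partial>lborel) = (\<integral>z. H z \<partial>lborel)"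
proof -
  have H: "H \<in> borel_measurable borel" using assms by auto
  have "integrable (distr lborel borel ((+) a)) H"
    by (simp add: lborel_distr_plus assms)
  then show "integrable lborel (\<lambda>z. H (a + z))"
    by (subst (asm) integrable_distr_eq) (use H in auto)
  have "(\<integral>z. H z \<partial>lborel) = (\<integral>z. H z \<partial>distr lborel borel ((+) a))"
    by (simp add: lborel_distr_plus)
  also have "\<dots> = (\<integral>z. H (a + z) \<partial>lborel)"
    by (rule integral_distr) (use H in auto)
  finally show "(\<integral>z. H (a + z) \<partial>lborel) = (\<integral>z. H z \<partial>lborel)" ..
qed

lemma negligible_imp_AE_lborel: "negligible N \<Longrightarrow> AE z in lborel. z \<notin> N"
  using AE_not_in[of N lebesgue] by (simp add: negligible_iff_null_sets AE_completion_iff)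

lemma integrable_compact_support:
  fixes g :: "complex \<Rightarrow> complex"
  assumes "compact C" "continuous_on C g" "\<And>z. z \<notin> C \<Longrightarrow> h z = 0" "\<And>z. z \<in> C \<Longrightarrow> h z = g z"
  shows "integrable lborel h"
proof -
  have "h = (\<lambda>z. indicator C z *\<^sub>R g z)"
    using assms(3,4) by (auto simp: fun_eq_iff indicator_def)
  with borel_integrable_compact[OF assms(1,2)] show ?thesis by simp
qed

lemma directional_measurable:
  assumes [measurable]: "f \<in> borel_measurable borel"
  shows "directional f v \<in> borel_measurable borel"
  unfolding directional_def by measurable

lemma zero_extension_measurable:
  fixes f :: "complex \<Rightarrow> complex"
  assumes "locally_lipschitz U f"
  shows "(\<lambda>z. indicator U z *\<^sub>R f z) \<in> borel_measurable borel"
  using locally_lipschitz_imp_open[OF assms] locally_lipschitz_imp_continuous[OF assms]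
  by (intro borel_measurable_continuous_on_indicator) auto

lemma zero_extension_has_derivative:
  fixes f :: "complex \<Rightarrow> complex"
  assumes "open U" "z \<in> U" "(f has_derivative D) (at z)"
  shows "((\<lambda>z. indicator U z *\<^sub>R f z) has_derivative D) (at z)"
  using assms(3,1,2) by (rule has_derivative_transform_within_open) auto

text \<open>Translation invariance of Lebesgue measure gives
  \<open>\<integral> G(z) (\<phi>(z - t v) - \<phi>(z))/t = \<integral> ((G(z + t v) - G(z))/t) \<phi>(z)\<close> for small \<open>t\<close>, and both sides converge by
  dominated convergence as \<open>t \<rightarrow> 0\<close>. The function \<open>G\<close> extends \<open>f\<close> by
  zero; its values outside \<open>U\<close> never meet the support of \<open>\<phi>\<close>.\<close>
lemma directional_by_parts:
  fixes f :: "complex \<Rightarrow> complex"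
  assumes f: "locally_lipschitz U f" and test: "test_function U \<phi>"
    and N: "negligible N" "\<And>z. z \<in> U \<Longrightarrow> z \<notin> N \<Longrightarrow> f differentiable (at z)"
  defines "G \<equiv> \<lambda>z. indicator U z *\<^sub>R f z"
  shows "integrable lborel (\<lambda>z. G z * frechet_derivative \<phi> (at z) v)"
    and "integrable lborel (\<lambda>z. directional G v z * \<phi> z)"
    and "(\<integral>z. G z * frechet_derivative \<phi> (at z) v \<partial>lborel) = - (\<integral>z. directional G v z * \<phi> z \<partial>lborel)"
proof -
  let ?\<phi>' = "\<lambda>z. frechet_derivative \<phi> (at z) v"
  have G_eq: "G z = f z" if "z \<in> U" for z using that by (simp add: G_def)
  have [measurable]: "G \<in> borel_measurable borel"
    unfolding G_def by (rule zero_extension_measurable[OF f])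
  have [measurable]: "directional G v \<in> borel_measurable borel"
    by (rule directional_measurable) measurable
  obtain C where C: "compact C" "C \<subseteq> U" "\<And>z. z \<notin> C \<Longrightarrow> \<phi> z = 0"
    using test by (auto simp: test_function_def)
  have \<phi>_cont: "continuous_on A \<phi>" for A
    using locally_lipschitz_imp_continuous[OF test_function_locally_lipschitz[OF test]]
    by (rule continuous_on_subset) simp
  have [measurable]: "\<phi> \<in> borel_measurable borel"
    by (rule borel_measurable_continuous_onI) (rule \<phi>_cont)
  have \<phi>_der: "(\<phi> has_derivative frechet_derivative \<phi> (at z)) (at z)" for z
    using test_function_differentiable[OF test] by (simp add: frechet_derivative_works)
  obtain d1 M where d1: "d1 > 0" "M \<ge> 0"
    "\<And>z w. z \<in> C \<Longrightarrow> dist w z < d1 \<Longrightarrow> w \<in> U \<and> norm (f w - f z) \<le> M * norm (w - z)"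
    using locally_lipschitz_near_compact[OF f C(1,2)] by metis
  obtain d2 L where d2: "d2 > 0" "L \<ge> 0"
    "\<And>z w. z \<in> C \<Longrightarrow> dist w z < d2 \<Longrightarrow> norm (\<phi> w - \<phi> z) \<le> L * norm (w - z)"
    using locally_lipschitz_near_compact[OF test_function_locally_lipschitz[OF test] C(1)] by (metis UNIV_I subsetI)
  \<comment> \<open>Steps of length at most \<open>d\<close> from the support \<open>C\<close> of \<open>\<phi>\<close> stay in the compact set \<open>C1 \<subseteq> U\<close>, where all
    integrands live.\<close>
  define d where "d = min d1 d2 / 2"
  have d: "d > 0" "d < d1" "d < d2" using d1 d2 by (auto simp: d_def)
  define C1 where "C1 = {x + y |x y. x \<in> C \<and> y \<in> cball 0 d}"
  have "compact C1" unfolding C1_def by (rule compact_sums[OF C(1) compact_cball])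
  have C1: "z \<in> C1" if "c \<in> C" "norm (z - c) \<le> d" for z c
    unfolding C1_def using that by (intro CollectI exI[of _ c] exI[of _ "z - c"]) auto
  have "C1 \<subseteq> U"
    using d1(3) d by (force simp: C1_def dist_norm)
  have f_cont: "continuous_on A f" if "A \<subseteq> U" for A
    using locally_lipschitz_imp_continuous[OF f] that by (rule continuous_on_subset)

  define t where "t = (\<lambda>n. - inverse (real (Suc n)))"
  have t0: "t \<longlonglongrightarrow> 0" unfolding t_def by (rule inverse_Suc_tendsto)
  have tn0: "t n \<noteq> 0" for n by (simp add: t_def)
  have "(\<lambda>n. \<bar>t n\<bar> * norm v) \<longlonglongrightarrow> \<bar>0\<bar> * norm v"
    by (intro tendsto_intros t0)
  then have "\<forall>\<^sub>F n in sequentially. \<bar>t n\<bar> * norm v < d"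
    using d by (auto dest: order_tendstoD)
  then obtain n0 where n0: "\<And>n. n \<ge> n0 \<Longrightarrow> \<bar>t n\<bar> * norm v < d"
    by (auto simp: eventually_sequentially)
  \<comment> \<open>The same sequence of steps as in \<^const>\<open>directional\<close>, with the long ones dropped.\<close>
  define s where "s = (\<lambda>n. t (n + n0))"
  have s0: "s \<longlonglongrightarrow> 0" unfolding s_def using t0 by (rule LIMSEQ_ignore_initial_segment)
  have sn0: "s n \<noteq> 0" for n by (simp add: s_def tn0)
  have sd: "norm (s n *\<^sub>R v) < d" for n using n0[of "n + n0"] by (simp add: s_def)

  have \<phi>_quot: "(\<lambda>n. (\<phi> (z + s n *\<^sub>R (- v)) - \<phi> z) /\<^sub>R s n) \<longlonglongrightarrow> - ?\<phi>' z" for z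
  proof -
    have "frechet_derivative \<phi> (at z) (- v) = - ?\<phi>' z"
      using \<phi>_der by (simp add: has_derivative_def bounded_linear.linear linear_neg)
    then show ?thesis
      using directional_quotient_tendsto[OF \<phi>_der s0 sn0, of z "- v"] by simp
  qed
  have \<phi>_step: "norm (\<phi> (z + s n *\<^sub>R (- v)) - \<phi> z) \<le> indicator C1 z * (L * (\<bar>s n\<bar> * norm v))" for z n
  proof -
    let ?w = "z + s n *\<^sub>R (- v)"
    have dw: "norm (?w - z) < d" "norm (z - ?w) < d" "norm (?w - z) = \<bar>s n\<bar> * norm v" "norm (z - ?w) = \<bar>s n\<bar> * norm v"
      using sd[of n] by (auto simp: norm_minus_commute)
    consider "z \<in> C" | "z \<notin> C" "?w \<in> C" | "z \<notin> C" "?w \<notin> C" by blast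
    then show ?thesis
    proof cases
      case 1
      then have "norm (\<phi> ?w - \<phi> z) \<le> L * norm (?w - z)"
        using d2(3)[of z ?w] dw(1) d by (simp add: dist_norm)
      moreover have "z \<in> C1" using C1[of z z] 1 d by simp
      ultimately show ?thesis unfolding dw by simp
    next
      case 2
      then have "norm (\<phi> z - \<phi> ?w) \<le> L * norm (z - ?w)"
        using d2(3)[of ?w z] dw(2) d by (simp add: dist_norm)
      moreover have "z \<in> C1" using C1[of ?w z] 2 dw(2) by simp
      ultimately show ?thesis unfolding dw by (simp add: norm_minus_commute)
    next
      case 3
      then show ?thesis using C(3) d2 by simp
    qed
  qed
  have \<phi>'_zero: "?\<phi>' z = 0" if "z \<notin> C" for z
  proof -
    have "open (- C)" using C(1) by (simp add: compact_imp_closed open_Compl)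
    then have "(\<phi> has_derivative (\<lambda>h. 0)) (at z)"
      using has_derivative_transform_within_open[of "\<lambda>_. 0" "\<lambda>h. 0" z UNIV "- C" \<phi>] that C(3) by simp
    then show ?thesis using frechet_derivative_at by metis
  qed
  have \<phi>'_meas: "(\<lambda>z. ?\<phi>' z) \<in> borel_measurable borel"
  proof -
    have "(\<lambda>z. ?\<phi>' z) = directional \<phi> v"
      using directional_eq[OF \<phi>_der] by (simp add: fun_eq_iff)
    then show ?thesis using directional_measurable by simp
  qed

  let ?A = "\<lambda>n z. G z * ((\<phi> (z + s n *\<^sub>R (- v)) - \<phi> z) /\<^sub>R s n)"
  let ?B = "\<lambda>n z. ((G (z + s n *\<^sub>R v) - G z) /\<^sub>R s n) * \<phi> z"
  have A_lim: "integrable lborel (\<lambda>z. G z * - ?\<phi>' z)"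
    "(\<lambda>n. \<integral>z. ?A n z \<partial>lborel) \<longlonglongrightarrow> (\<integral>z. G z * - ?\<phi>' z \<partial>lborel)"
  proof -
    let ?w = "\<lambda>z. indicator C1 z *\<^sub>R (norm (f z) * (L * norm v))"
    have 1: "(\<lambda>z. G z * - ?\<phi>' z) \<in> borel_measurable lborel"
      using \<phi>'_meas by simp
    have 2: "?A n \<in> borel_measurable lborel" for n by measurable
    have 3: "integrable lborel ?w"
      by (intro borel_integrable_compact \<open>compact C1\<close> continuous_intros f_cont \<open>C1 \<subseteq> U\<close>)
    have 4: "AE z in lborel. (\<lambda>n. ?A n z) \<longlonglongrightarrow> G z * - ?\<phi>' z"
      by (intro AE_I2 tendsto_mult_left \<phi>_quot)
    have 5: "AE z in lborel. norm (?A n z) \<le> ?w z" for n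
    proof (intro AE_I2)
      fix z
      have "norm (?A n z) = norm (G z) * (norm (\<phi> (z + s n *\<^sub>R (- v)) - \<phi> z) / \<bar>s n\<bar>)"
        by (simp add: norm_mult divide_inverse_commute)
      also have "\<dots> \<le> norm (G z) * ((indicator C1 z * (L * (\<bar>s n\<bar> * norm v))) / \<bar>s n\<bar>)"
        by (intro mult_left_mono divide_right_mono \<phi>_step) auto
      also have "\<dots> = ?w z"
        using sn0[of n] G_eq[of z] \<open>C1 \<subseteq> U\<close> by (auto simp: indicator_def)
      finally show "norm (?A n z) \<le> ?w z" .
    qed
    show "integrable lborel (\<lambda>z. G z * - ?\<phi>' z)"
      by (rule integrable_dominated_convergence[OF 1 2 3 4 5])
    show "(\<lambda>n. \<integral>z. ?A n z \<partial>lborel) \<longlonglongrightarrow> (\<integral>z. G z * - ?\<phi>' z \<partial>lborel)"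
      by (rule integral_dominated_convergence[OF 1 2 3 4 5])
  qed
  have B_lim: "integrable lborel (\<lambda>z. directional G v z * \<phi> z)"
    "(\<lambda>n. \<integral>z. ?B n z \<partial>lborel) \<longlonglongrightarrow> (\<integral>z. directional G v z * \<phi> z \<partial>lborel)"
  proof -
    let ?w = "\<lambda>z. indicator C z *\<^sub>R (M * norm v * norm (\<phi> z))"
    have 1: "(\<lambda>z. directional G v z * \<phi> z) \<in> borel_measurable lborel" by measurable
    have 2: "?B n \<in> borel_measurable lborel" for n by measurable
    have 3: "integrable lborel ?w"
      by (intro borel_integrable_compact C(1) continuous_intros \<phi>_cont)
    have 4: "AE z in lborel. (\<lambda>n. ?B n z) \<longlonglongrightarrow> directional G v z * \<phi> z"
      using negligible_imp_AE_lborel[OF N(1)]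
    proof eventually_elim
      case (elim z)
      show ?case
      proof (cases "z \<in> C")
        case True
        then have "z \<in> U" using C by auto
        then obtain D where "(f has_derivative D) (at z)"
          using N(2)[OF _ elim] by (auto simp: differentiable_def)
        then have "(G has_derivative D) (at z)"
          unfolding G_def using locally_lipschitz_imp_open[OF f] \<open>z \<in> U\<close>
          by (intro zero_extension_has_derivative)
        then show ?thesis
          by (intro tendsto_mult_right) (simp add: directional_eq directional_quotient_tendsto[OF _ s0 sn0])
      qed (simp add: C(3))
    qed
    have 5: "AE z in lborel. norm (?B n z) \<le> ?w z" for n
    proof (intro AE_I2)
      fix z
      show "norm (?B n z) \<le> ?w z"
      proof (cases "z \<in> C")
        case True
        have "z + s n *\<^sub>R v \<in> U \<and> norm (f (z + s n *\<^sub>R v) - f z) \<le> M * norm (s n *\<^sub>R v)"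
          using d1(3)[OF True, of "z + s n *\<^sub>R v"] sd[of n] d by (simp add: dist_norm)
        moreover have "z \<in> U" using True C by auto
        ultimately have "norm (G (z + s n *\<^sub>R v) - G z) \<le> M * (\<bar>s n\<bar> * norm v)"
          by (simp add: G_eq)
        then have "norm (G (z + s n *\<^sub>R v) - G z) / \<bar>s n\<bar> \<le> M * norm v"
          using sn0[of n] by (simp add: divide_simps mult_ac)
        then have "norm (G (z + s n *\<^sub>R v) - G z) / \<bar>s n\<bar> * norm (\<phi> z) \<le> M * norm v * norm (\<phi> z)"
          by (rule mult_right_mono) simp
        then show ?thesis
          using True by (simp add: norm_mult divide_inverse_commute)
      qed (simp add: C(3))
    qed
    show "integrable lborel (\<lambda>z. directional G v z * \<phi> z)"
      by (rule integrable_dominated_convergence[OF 1 2 3 4 5])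
    show "(\<lambda>n. \<integral>z. ?B n z \<partial>lborel) \<longlonglongrightarrow> (\<integral>z. directional G v z * \<phi> z \<partial>lborel)"
      by (rule integral_dominated_convergence[OF 1 2 3 4 5])
  qed
  have AB: "(\<integral>z. ?A n z \<partial>lborel) = (\<integral>z. ?B n z \<partial>lborel)" for n
  proof -
    let ?a = "s n *\<^sub>R v"
    let ?H = "\<lambda>z. G z * \<phi> (z - ?a)"
    have H: "integrable lborel ?H"
    proof (rule integrable_compact_support[OF \<open>compact C1\<close>, of "\<lambda>z. f z * \<phi> (z - ?a)"])
      show "continuous_on C1 (\<lambda>z. f z * \<phi> (z - ?a))"
        by (intro continuous_intros f_cont \<open>C1 \<subseteq> U\<close> continuous_on_compose2[OF \<phi>_cont[of UNIV]]) auto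
      show "?H z = f z * \<phi> (z - ?a)" if "z \<in> C1" for z
        using that \<open>C1 \<subseteq> U\<close> G_eq by auto
      show "?H z = 0" if "z \<notin> C1" for z
      proof -
        have "z - ?a \<notin> C" using that C1[of "z - ?a" z] sd[of n] by (auto simp: less_imp_le)
        then show ?thesis using C(3) by simp
      qed
    qed
    have G\<phi>: "integrable lborel (\<lambda>z. G z * \<phi> z)"
    proof (rule integrable_compact_support[OF C(1), of "\<lambda>z. f z * \<phi> z"])
      show "continuous_on C (\<lambda>z. f z * \<phi> z)"
        by (intro continuous_intros f_cont C \<phi>_cont)
      show "G z * \<phi> z = f z * \<phi> z" if "z \<in> C" for z
        using that C G_eq by auto
    qed (simp add: C(3))
    note H' = lborel_integral_translate[OF H, of ?a]
    have "(\<integral>z. ?A n z \<partial>lborel) = (\<integral>z. (?H z - G z * \<phi> z) /\<^sub>R s n \<partial>lborel)"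
      by (simp add: algebra_simps)
    also have "\<dots> = ((\<integral>z. ?H z \<partial>lborel) - (\<integral>z. G z * \<phi> z \<partial>lborel)) /\<^sub>R s n"
      using H G\<phi> by simp
    also have "(\<integral>z. ?H z \<partial>lborel) = (\<integral>z. ?H (?a + z) \<partial>lborel)"
      using H'(2) by simp
    also have "((\<integral>z. ?H (?a + z) \<partial>lborel) - (\<integral>z. G z * \<phi> z \<partial>lborel)) /\<^sub>R s n
        = (\<integral>z. (?H (?a + z) - G z * \<phi> z) /\<^sub>R s n \<partial>lborel)"
      using H'(1) G\<phi> by simp
    also have "\<dots> = (\<integral>z. ?B n z \<partial>lborel)"
      by (simp add: algebra_simps)
    finally show ?thesis .
  qed
  show "integrable lborel (\<lambda>z. G z * ?\<phi>' z)"
    using A_lim(1) by simp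
  show "integrable lborel (\<lambda>z. directional G v z * \<phi> z)" by (rule B_lim(1))
  show "(\<integral>z. G z * ?\<phi>' z \<partial>lborel) = - (\<integral>z. directional G v z * \<phi> z \<partial>lborel)"
    using LIMSEQ_unique[OF A_lim(2)[unfolded AB] B_lim(2)] by (simp add: minus_equation_iff eq_commute)
qed

lemma directional_bound:
  assumes f: "locally_lipschitz U f" and C: "compact C" "C \<subseteq> U"
    and N: "\<And>z. z \<in> U \<Longrightarrow> z \<notin> N \<Longrightarrow> f differentiable (at z)"
  obtains B where "\<And>z v. z \<in> C \<Longrightarrow> z \<notin> N \<Longrightarrow> norm (directional (\<lambda>z. indicator U z *\<^sub>R f z) v z) \<le> B * norm v"
proof -
  obtain d M where dM: "d > 0" "M \<ge> 0"
    "\<And>z w. z \<in> C \<Longrightarrow> dist w z < d \<Longrightarrow> w \<in> U \<and> norm (f w - f z) \<le> M * norm (w - z)"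
    using locally_lipschitz_near_compact[OF f C] by metis
  show thesis
  proof (rule that)
    fix z v :: complex assume z: "z \<in> C" "z \<notin> N"
    then have zU: "z \<in> U" using C by auto
    let ?t = "\<lambda>n. - inverse (real (Suc n))"
    obtain D where D: "(f has_derivative D) (at z)"
      using N[OF zU z(2)] by (auto simp: differentiable_def)
    have "(\<lambda>n. \<bar>?t n\<bar> * norm v) \<longlonglongrightarrow> \<bar>0\<bar> * norm v"
      by (intro tendsto_intros inverse_Suc_tendsto)
    then have "\<forall>\<^sub>F n in sequentially. \<bar>?t n\<bar> * norm v < d"
      using dM by (auto dest: order_tendstoD)
    then have "\<forall>\<^sub>F n in sequentially. norm ((f (z + ?t n *\<^sub>R v) - f z) /\<^sub>R ?t n) \<le> M * norm v"
    proof eventually_elim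
      case (elim n)
      then have "norm (f (z + ?t n *\<^sub>R v) - f z) \<le> M * norm (?t n *\<^sub>R v)"
        using dM(3)[OF z(1), of "z + ?t n *\<^sub>R v"] by (simp add: dist_norm)
      then have *: "norm (f (z + ?t n *\<^sub>R v) - f z) \<le> \<bar>?t n\<bar> * (M * norm v)"
        by (simp add: mult_ac)
      have "norm ((f (z + s *\<^sub>R v) - f z) /\<^sub>R s) \<le> B" if "norm (f (z + s *\<^sub>R v) - f z) \<le> \<bar>s\<bar> * B" "s \<noteq> 0" for s B
        using that by (simp add: divide_simps mult.commute)
      from this[OF *] show ?case by simp
    qed
    then have "norm (D v) \<le> M * norm v"
      using directional_tendsto[OF D, of v] by (intro Lim_norm_ubound) auto
    moreover have "directional (\<lambda>z. indicator U z *\<^sub>R f z) v z = D v"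
      using zero_extension_has_derivative[OF locally_lipschitz_imp_open[OF f] zU D] by (rule directional_eq)
    ultimately show "norm (directional (\<lambda>z. indicator U z *\<^sub>R f z) v z) \<le> M * norm v" by simp
  qed
qed

text \<open>Here \<open>\<alpha>\<close> and \<open>\<beta>\<close> are the Wirtinger derivatives of \<open>f\<close> at \<open>z\<close>. The case \<open>\<alpha> = \<beta> = 0\<close> is included, so that
  composition with holomorphic maps preserves the property.\<close>
definition dilatation_at :: "real \<Rightarrow> (complex \<Rightarrow> complex) \<Rightarrow> complex \<Rightarrow> bool" where
  "dilatation_at k f z \<longleftrightarrow>
     (\<exists>\<alpha> \<beta>. (f has_derivative (\<lambda>v. \<alpha> * v + \<beta> * cnj v)) (at z) \<and> norm \<beta> \<le> k * norm \<alpha>)"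

lemma weak_derivatives_exist:
  assumes f: "locally_lipschitz U f" and N: "negligible N"
    and dil: "\<And>z. z \<in> U \<Longrightarrow> z \<notin> N \<Longrightarrow> dilatation_at k f z"
  shows "\<exists>p q. locally_L1 U p \<and> locally_L1 U q \<and> weak_dz U f p \<and> weak_dzbar U f q \<and>
            (AE z in lebesgue. z \<in> U \<longrightarrow> norm (q z) \<le> k * norm (p z))"
proof -
  have diff: "f differentiable (at z)" if "z \<in> U" "z \<notin> N" for z
    using dil[OF that] by (auto simp: dilatation_at_def differentiable_def)
  define G where "G = (\<lambda>z. indicator U z *\<^sub>R f z)"
  define p where "p = (\<lambda>z. (directional G 1 z - \<i> * directional G \<i> z) / 2)"
  define q where "q = (\<lambda>z. (directional G 1 z + \<i> * directional G \<i> z) / 2)"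
  have [measurable]: "G \<in> borel_measurable borel"
    unfolding G_def by (rule zero_extension_measurable[OF f])
  have [measurable]: "directional G v \<in> borel_measurable borel" for v
    by (rule directional_measurable) measurable
  have [measurable]: "p \<in> borel_measurable borel" "q \<in> borel_measurable borel"
    unfolding p_def q_def by measurable
  have [measurable]: "U \<in> sets borel" using locally_lipschitz_imp_open[OF f] by simp
  have L1: "locally_L1 U p \<and> locally_L1 U q"
    unfolding locally_L1_def
  proof (intro conjI allI impI)
    fix C assume C: "compact C \<and> C \<subseteq> U"
    then have [measurable]: "C \<in> sets borel" by (simp add: borel_compact)
    obtain B where B: "\<And>z v. z \<in> C \<Longrightarrow> z \<notin> N \<Longrightarrow> norm (directional G v z) \<le> B * norm v"
      using directional_bound[OF f _ _ diff, of C N] C unfolding G_def by blast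
    have bound: "set_integrable lebesgue C r"
      if r: "r \<in> borel_measurable borel"
        and le: "\<And>z. norm (r z) \<le> (norm (directional G 1 z) + norm (directional G \<i> z)) / 2"
        for r :: "complex \<Rightarrow> complex"
    proof -
      note [measurable] = r
      have "integrable lborel (\<lambda>z. indicator C z *\<^sub>R r z)"
      proof (rule integrableI_bounded_set_indicator[where B = B])
        show "emeasure lborel C < \<infinity>"
          using C emeasure_compact_finite by blast
        show "AE z in lborel. z \<in> C \<longrightarrow> norm (r z) \<le> B"
          using negligible_imp_AE_lborel[OF N]
        proof eventually_elim
          case (elim z)
          then show ?case using le[of z] B[of z 1] B[of z \<i>] by auto
        qed
      qed auto
      then show ?thesis
        unfolding set_integrable_def by (subst integrable_completion) auto
    qed
    have "norm (x - \<i> * y) / 2 \<le> (norm x + norm y) / 2" "norm (x + \<i> * y) / 2 \<le> (norm x + norm y) / 2" for x y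
      using norm_triangle_ineq4[of x "\<i> * y"] norm_triangle_ineq[of x "\<i> * y"] by (simp_all add: norm_mult)
    then show "set_integrable lebesgue C p" "set_integrable lebesgue C q"
      by (intro bound; simp add: p_def q_def norm_divide)+
  qed
  have parts: "(LINT z:U|lebesgue. f z * ((frechet_derivative \<phi> (at z) 1 + c * frechet_derivative \<phi> (at z) \<i>) / 2))
      = - (LINT z:U|lebesgue. ((directional G 1 z + c * directional G \<i> z) / 2) * \<phi> z)"
    if test: "test_function U \<phi>" for \<phi> c
  proof -
    let ?\<phi>' = "\<lambda>z. frechet_derivative \<phi> (at z)"
    have "\<And>z. indicator U z *\<^sub>R f z = G z" by (simp add: G_def)
    note bp = directional_by_parts[OF f test N diff, folded G_def, unfolded this]
    have \<phi>0: "\<phi> z = 0" if "z \<notin> U" for z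
      using test that by (auto simp: test_function_def)
    have 1: "(\<lambda>z. indicator U z *\<^sub>R (f z * ((?\<phi>' z 1 + c * ?\<phi>' z \<i>) / 2)))
        = (\<lambda>z. (G z * ?\<phi>' z 1 + c * (G z * ?\<phi>' z \<i>)) / 2)"
      by (auto simp: G_def fun_eq_iff indicator_def field_simps)
    have 2: "(\<lambda>z. indicator U z *\<^sub>R (((directional G 1 z + c * directional G \<i> z) / 2) * \<phi> z))
        = (\<lambda>z. (directional G 1 z * \<phi> z + c * (directional G \<i> z * \<phi> z)) / 2)"
      using \<phi>0 by (auto simp: fun_eq_iff indicator_def field_simps)
    have "integral\<^sup>L lebesgue (\<lambda>z. (G z * ?\<phi>' z 1 + c * (G z * ?\<phi>' z \<i>)) / 2)
        = integral\<^sup>L lborel (\<lambda>z. (G z * ?\<phi>' z 1 + c * (G z * ?\<phi>' z \<i>)) / 2)"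
      by (rule integral_completion, rule borel_measurable_integrable) (use bp(1) in simp)
    also have "\<dots> = (integral\<^sup>L lborel (\<lambda>z. G z * ?\<phi>' z 1)
        + c * integral\<^sup>L lborel (\<lambda>z. G z * ?\<phi>' z \<i>)) / 2"
      using bp(1) by simp
    also have "\<dots> = - ((integral\<^sup>L lborel (\<lambda>z. directional G 1 z * \<phi> z)
        + c * integral\<^sup>L lborel (\<lambda>z. directional G \<i> z * \<phi> z)) / 2)"
      using bp(3)[of 1] bp(3)[of "\<i>"] by (simp add: field_simps)
    also have "\<dots> = - integral\<^sup>L lborel (\<lambda>z. (directional G 1 z * \<phi> z + c * (directional G \<i> z * \<phi> z)) / 2)"
      using bp(2) by simp
    also have "integral\<^sup>L lborel (\<lambda>z. (directional G 1 z * \<phi> z + c * (directional G \<i> z * \<phi> z)) / 2)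
        = integral\<^sup>L lebesgue (\<lambda>z. (directional G 1 z * \<phi> z + c * (directional G \<i> z * \<phi> z)) / 2)"
      by (rule integral_completion[symmetric], rule borel_measurable_integrable) (use bp(2) in simp)
    finally show ?thesis
      unfolding set_lebesgue_integral_def 1 2 .
  qed
  have "weak_dz U f p"
    unfolding weak_dz_def wirtinger_dz_def p_def using parts[of _ "- \<i>"] by simp
  moreover have "weak_dzbar U f q"
    unfolding weak_dzbar_def wirtinger_dzbar_def q_def using parts[of _ "\<i>"] by simp
  moreover have "AE z in lebesgue. z \<in> U \<longrightarrow> norm (q z) \<le> k * norm (p z)"
    unfolding AE_completion_iff using negligible_imp_AE_lborel[OF N]
  proof (eventually_elim, intro impI)
    fix z assume "z \<notin> N" "z \<in> U"
    from dil[OF this(2,1)] obtain \<alpha> \<beta>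
      where ab: "(f has_derivative (\<lambda>v. \<alpha> * v + \<beta> * cnj v)) (at z)" "norm \<beta> \<le> k * norm \<alpha>"
      by (auto simp: dilatation_at_def)
    have "directional G v z = \<alpha> * v + \<beta> * cnj v" for v
      unfolding G_def
      using zero_extension_has_derivative[OF locally_lipschitz_imp_open[OF f] \<open>z \<in> U\<close> ab(1)] by (rule directional_eq)
    then have "p z = \<alpha>" "q z = \<beta>"
      by (simp_all add: p_def q_def algebra_simps)
    with ab show "norm (q z) \<le> k * norm (p z)" by simp
  qed
  ultimately show ?thesis using L1 by blast
qed

section \<open>Orientation of injective maps via winding numbers\<close>

text \<open>Loops are given as the horizontal sections of one map \<open>H\<close>; this suits families of image circles.\<close>
lemma winding_number_homotopy:
  fixes H :: "real \<times> real \<Rightarrow> complex"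
  assumes cont: "continuous_on ({0..1} \<times> {0..1}) H"
    and nz: "\<And>s t. 0 \<le> s \<Longrightarrow> s \<le> 1 \<Longrightarrow> 0 \<le> t \<Longrightarrow> t \<le> 1 \<Longrightarrow> H (s, t) \<noteq> 0"
    and loop: "\<And>s. H (s, 1) = H (s, 0)"
  shows "winding_number (\<lambda>t. H (0, t)) 0 = winding_number (\<lambda>t. H (1, t)) 0"
proof (rule winding_number_homotopic_loops)
  show "homotopic_loops (- {0}) (\<lambda>t. H (0, t)) (\<lambda>t. H (1, t))"
    unfolding homotopic_loops using cont nz loop
    by (intro exI[of _ H]) (auto simp: pathfinish_def pathstart_def)
qed

definition unit_circle :: "real \<Rightarrow> complex" where
  "unit_circle t = exp (2 * of_real pi * \<i> * of_real t)"

lemma unit_circle: "norm (unit_circle t) = 1" "unit_circle 1 = unit_circle 0"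
  by (simp_all add: unit_circle_def)

lemma continuous_on_unit_circle [continuous_intros]:
  "continuous_on A g \<Longrightarrow> continuous_on A (\<lambda>x. unit_circle (g x))"
  unfolding unit_circle_def by (intro continuous_intros)

text \<open>The quantity that \<^const>\<open>orientation_preserving_on\<close> requires to be 1.\<close>
definition circle_winding :: "(complex \<Rightarrow> complex) \<Rightarrow> complex \<Rightarrow> real \<Rightarrow> complex" where
  "circle_winding f z r = winding_number (f \<circ> circlepath z r) (f z)"

lemma circle_winding_eq:
  "circle_winding f z r = winding_number (\<lambda>t. f (z + of_real r * unit_circle t) - f z) 0"
  unfolding circle_winding_def winding_number_offset[of _ "f z"]
  by (simp add: circlepath unit_circle_def o_def)

text \<open>While a closed disk moves inside \<open>U\<close>, injectivity keeps the image of its boundary circle away from the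
  image of its centre.\<close>
lemma circle_winding_move:
  assumes f: "continuous_on U f" "inj_on f U"
    and c: "continuous_on {0..1} c" and \<rho>: "continuous_on {0..1} \<rho>"
    and disk: "\<And>s. 0 \<le> s \<Longrightarrow> s \<le> 1 \<Longrightarrow> \<rho> s > 0 \<and> cball (c s) (\<rho> s) \<subseteq> U"
  shows "circle_winding f (c (0::real)) (\<rho> (0::real)) = circle_winding f (c 1) (\<rho> 1)"
proof -
  define H where "H = (\<lambda>(s, t). f (c s + of_real (\<rho> s) * unit_circle t) - f (c s))"
  have mem: "c s + of_real (\<rho> s) * unit_circle t \<in> U" "c s \<in> U"
    if "0 \<le> s" "s \<le> 1" for s t
  proof -
    have "c s + of_real (\<rho> s) * unit_circle t \<in> cball (c s) (\<rho> s)" "c s \<in> cball (c s) (\<rho> s)"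
      using disk[OF that] by (auto simp: dist_norm norm_mult unit_circle)
    then show "c s + of_real (\<rho> s) * unit_circle t \<in> U" "c s \<in> U"
      using disk[OF that] by blast+
  qed
  have cs: "continuous_on ({0..1} \<times> {0..1}) (\<lambda>p::real\<times>real. c (fst p))"
    by (rule continuous_on_compose2[OF c]) (auto intro!: continuous_intros)
  have \<rho>s: "continuous_on ({0..1} \<times> {0..1}) (\<lambda>p::real\<times>real. \<rho> (fst p))"
    by (rule continuous_on_compose2[OF \<rho>]) (auto intro!: continuous_intros)
  have "continuous_on ({0..1} \<times> {0..1}) H"
    unfolding H_def case_prod_beta
    by (intro continuous_intros continuous_on_compose2[OF f(1)] cs \<rho>s) (use mem in auto)
  moreover have "H (s, t) \<noteq> 0" if s: "0 \<le> s" "s \<le> 1" for s t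
  proof
    assume "H (s, t) = 0"
    then have "f (c s + of_real (\<rho> s) * unit_circle t) = f (c s)" by (simp add: H_def)
    then have "c s + of_real (\<rho> s) * unit_circle t = c s"
      using f(2) mem[OF s] by (blast dest: inj_onD)
    then have "norm (of_real (\<rho> s) * unit_circle t) = 0" by simp
    then show False using disk[OF s] by (simp add: norm_mult unit_circle)
  qed
  moreover have "H (s, 1) = H (s, 0)" for s by (simp add: H_def unit_circle)
  ultimately show ?thesis
    unfolding circle_winding_eq using winding_number_homotopy[of H] by (simp add: H_def)
qed

text \<open>Two disks are joined by shrinking the first, moving it along a path in \<open>U\<close>, and enlarging it again.\<close>
lemma circle_winding_constant:
  assumes f: "continuous_on U f" "inj_on f U" and U: "open U" "connected U"
    and disks: "0 < r" "cball z r \<subseteq> U" "0 < r'" "cball w r' \<subseteq> U"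
  shows "circle_winding f z r = circle_winding f w r'"
proof -
  have resize: "circle_winding f a s = circle_winding f a s'"
    if "0 < s" "0 < s'" "s \<le> s'" "cball a s' \<subseteq> U" for a s s'
  proof -
    have "circle_winding f ((\<lambda>_. a) (0::real)) ((\<lambda>x. (1 - x) * s + x * s') 0)
        = circle_winding f ((\<lambda>_. a) (1::real)) ((\<lambda>x. (1 - x) * s + x * s') 1)"
    proof (rule circle_winding_move[OF f])
      fix x :: real assume x: "0 \<le> x" "x \<le> 1"
      have "x * s \<le> x * s'" "(1 - x) * s \<le> (1 - x) * s'" using x that by (auto intro: mult_left_mono)
      then have "s \<le> (1 - x) * s + x * s'" "(1 - x) * s + x * s' \<le> s'" by (simp_all add: algebra_simps)
      then show "0 < (1 - x) * s + x * s' \<and> cball a ((1 - x) * s + x * s') \<subseteq> U"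
        using that by (meson cball_subset_cball_iff less_le_trans order_trans subset_cball)
    qed (intro continuous_intros)+
    then show ?thesis by simp
  qed
  have "path_connected U" using U by (simp add: connected_open_path_connected)
  moreover have "z \<in> U" "w \<in> U" using disks by (auto dest: subsetD[of _ _ z] subsetD[of _ _ w])
  ultimately obtain g where g: "path g" "path_image g \<subseteq> U" "pathstart g = z" "pathfinish g = w"
    unfolding path_connected_def by meson
  obtain e where e: "e > 0" "\<And>x. x \<in> path_image g \<Longrightarrow> ball x e \<subseteq> U"
    using Heine_Borel_lemma[OF compact_path_image[OF g(1)], of "{U}"] g(2) U(1) by auto
  define \<delta> where "\<delta> = min (e / 2) (min r r')"
  have \<delta>: "0 < \<delta>" "\<delta> < e" "\<delta> \<le> r" "\<delta> \<le> r'" using e disks by (auto simp: \<delta>_def)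
  have "circle_winding f (g 0) \<delta> = circle_winding f (g 1) \<delta>"
  proof (rule circle_winding_move[OF f, where \<rho> = "\<lambda>_. \<delta>"])
    show "continuous_on {0..1} g" using g by (simp add: path_def)
    fix s :: real assume "0 \<le> s" "s \<le> 1"
    then have "ball (g s) e \<subseteq> U" using e by (auto simp: path_image_def)
    moreover have "cball (g s) \<delta> \<subseteq> ball (g s) e" using \<delta> by auto
    ultimately show "0 < \<delta> \<and> cball (g s) \<delta> \<subseteq> U" using \<delta>(1) by blast
  qed (intro continuous_intros)
  then have "circle_winding f z \<delta> = circle_winding f w \<delta>"
    using g by (simp add: pathstart_def pathfinish_def)
  then show ?thesis using resize[of \<delta> r z] resize[of \<delta> r' w] \<delta> disks by simp
qed

text \<open>The difference quotient \<open>g\<close> of \<open>f\<close> at \<open>z\<close>, with value \<open>b\<close> at \<open>z\<close>, is continuous and has no zeros.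
  Contracting its argument to \<open>z\<close> deforms the image circle to \<open>b\<close> times a circle of radius \<open>r\<close>, and the path
  \<open>exp (s log b)\<close> from \<open>1\<close> to \<open>b\<close> removes the factor.\<close>
lemma circle_winding_conformal:
  assumes f: "continuous_on U f" "inj_on f U" and r: "0 < r" "cball z r \<subseteq> U"
    and der: "(f has_field_derivative b) (at z)" "b \<noteq> 0"
  shows "circle_winding f z r = 1"
proof -
  define g where "g = (\<lambda>w. if w = z then b else (f w - f z) / (w - z))"
  have g_cont: "continuous_on (cball z r) g"
  proof -
    have fb: "continuous_on (cball z r) f" using f(1) r(2) by (rule continuous_on_subset)
    have "continuous (at w within cball z r) g" if "w \<in> cball z r" for w
    proof (cases "w = z")
      case True
      have "(\<lambda>x. (f x - f z) / (x - z)) \<midarrow>z\<rightarrow> b"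
        using der(1) by (simp add: has_field_derivative_iff)
      then have "g \<midarrow>z\<rightarrow> b"
        by (rule Lim_transform_eventually) (auto simp: g_def eventually_at intro!: exI[of _ 1])
      then have "isCont g z" by (simp add: isCont_def g_def)
      then show ?thesis using True continuous_at_imp_continuous_within by blast
    next
      case False
      have "continuous (at w within cball z r) (\<lambda>x. (f x - f z) / (x - z))"
        using fb that False by (intro continuous_intros) (auto simp: continuous_on_eq_continuous_within)
      then show ?thesis
        by (rule continuous_transform_within[where \<delta> = "dist w z"]) (use False that in \<open>auto simp: g_def dist_commute\<close>)
    qed
    then show ?thesis by (simp add: continuous_on_eq_continuous_within)
  qed
  have g_nz: "g w \<noteq> 0" if "w \<in> cball z r" for w
  proof -
    have "w \<in> U" "z \<in> U" using that r by (auto intro!: subsetD[OF r(2)])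
    then show ?thesis
      using inj_onD[OF f(2), of w z] der(2) by (auto simp: g_def)
  qed
  define H where "H = (\<lambda>(s, t). g (z + of_real (s * r) * unit_circle t) * (of_real r * unit_circle t))"
  have mem: "z + of_real (s * r) * unit_circle t \<in> cball z r" if "0 \<le> s" "s \<le> 1" for s t
    using that r by (simp add: dist_norm norm_mult unit_circle abs_mult mult_left_le_one_le)
  have "winding_number (\<lambda>t. H (0, t)) 0 = winding_number (\<lambda>t. H (1, t)) 0"
  proof (rule winding_number_homotopy)
    show "continuous_on ({0..1} \<times> {0..1}) H"
      unfolding H_def case_prod_beta
      by (intro continuous_intros continuous_on_compose2[OF g_cont]) (use mem in auto)
    show "H (s, t) \<noteq> 0" if "0 \<le> s" "s \<le> 1" for s t
    proof -
      have "unit_circle t \<noteq> 0" using unit_circle(1)[of t] by force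
      then show ?thesis using g_nz[OF mem[OF that]] r by (simp add: H_def)
    qed
  qed (simp add: H_def unit_circle)
  also have "(\<lambda>t. H (1, t)) = (\<lambda>t. f (z + of_real r * unit_circle t) - f z)"
  proof
    fix t
    have "unit_circle t \<noteq> 0" using unit_circle(1)[of t] by force
    then show "H (1, t) = f (z + of_real r * unit_circle t) - f z" using r by (simp add: H_def g_def)
  qed
  finally have 1: "circle_winding f z r = winding_number (\<lambda>t. H (0, t)) 0"
    by (simp add: circle_winding_eq)
  define l where "l = Ln b"
  define K where "K = (\<lambda>(s, t). exp (of_real s * l) * (of_real r * unit_circle t))"
  have "winding_number (\<lambda>t. K (0, t)) 0 = winding_number (\<lambda>t. K (1, t)) 0"
  proof (rule winding_number_homotopy)
    show "continuous_on ({0..1} \<times> {0..1}) K"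
      unfolding K_def case_prod_beta by (intro continuous_intros)
    show "K (s, t) \<noteq> 0" if "0 \<le> s" "s \<le> 1" for s t
    proof -
      have "unit_circle t \<noteq> 0" using unit_circle(1)[of t] by force
      then show ?thesis using r by (simp add: K_def)
    qed
  qed (simp add: K_def unit_circle)
  also have "(\<lambda>t. K (1, t)) = (\<lambda>t. H (0, t))"
    using der(2) by (simp add: K_def H_def g_def l_def)
  also have "(\<lambda>t. K (0, t)) = circlepath 0 r"
    by (simp add: K_def circlepath unit_circle_def)
  finally show ?thesis
    using 1 winding_number_circlepath_centre[OF r(1), of 0] by simp
qed

lemma orientation_preserving_onI:
  assumes f: "continuous_on U f" "inj_on f U" and U: "open U" "connected U"
    and S: "open S" "S \<subseteq> U" "S \<noteq> {}" "f holomorphic_on S"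
  shows "orientation_preserving_on U f"
  unfolding orientation_preserving_on_def circle_winding_def[symmetric]
proof (intro ballI allI impI)
  fix z r assume zr: "z \<in> U" "0 < r" "cball z r \<subseteq> U"
  obtain w where w: "w \<in> S" using S by blast
  then obtain s where s: "s > 0" "cball w s \<subseteq> U"
    using U S by (meson open_contains_cball subsetD)
  have "(f has_field_derivative deriv f w) (at w)"
    using S w holomorphic_derivI by blast
  moreover have "deriv f w \<noteq> 0"
    using S w inj_on_subset[OF f(2)] by (intro holomorphic_injective_imp_regular)
  ultimately have "circle_winding f w s = 1"
    using circle_winding_conformal[OF f s] by blast
  then show "circle_winding f z r = 1"
    using circle_winding_constant[OF f U zr(2,3) s] by simp
qed

section \<open>A criterion for quasiconformality on the sphere\<close>

lemma dilatation_at_compose_left: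
  assumes f: "dilatation_at k f z" and g: "(g has_field_derivative b) (at (f z))"
  shows "dilatation_at k (\<lambda>z. g (f z)) z"
proof -
  obtain \<alpha> \<beta> where ab: "(f has_derivative (\<lambda>v. \<alpha> * v + \<beta> * cnj v)) (at z)" "norm \<beta> \<le> k * norm \<alpha>"
    using f by (auto simp: dilatation_at_def)
  have "((\<lambda>z. g (f z)) has_derivative (\<lambda>v. b * (\<alpha> * v + \<beta> * cnj v))) (at z)"
    using has_derivative_compose[OF ab(1) g[unfolded has_field_derivative_def]] .
  moreover have "norm b * norm \<beta> \<le> norm b * (k * norm \<alpha>)"
    using ab(2) by (rule mult_left_mono) simp
  ultimately show ?thesis
    unfolding dilatation_at_def
    by (intro exI[of _ "b * \<alpha>"] exI[of _ "b * \<beta>"]) (simp add: norm_mult algebra_simps)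
qed

lemma dilatation_at_compose_right:
  assumes g: "(g has_field_derivative b) (at z)" and f: "dilatation_at k f (g z)"
  shows "dilatation_at k (\<lambda>z. f (g z)) z"
proof -
  obtain \<alpha> \<beta> where ab: "(f has_derivative (\<lambda>v. \<alpha> * v + \<beta> * cnj v)) (at (g z))" "norm \<beta> \<le> k * norm \<alpha>"
    using f by (auto simp: dilatation_at_def)
  have "((\<lambda>z. f (g z)) has_derivative (\<lambda>v. \<alpha> * (b * v) + \<beta> * cnj (b * v))) (at z)"
    using has_derivative_compose[OF g[unfolded has_field_derivative_def] ab(1)] .
  moreover have "norm b * norm \<beta> \<le> norm b * (k * norm \<alpha>)"
    using ab(2) by (rule mult_left_mono) simp
  ultimately show ?thesis
    unfolding dilatation_at_def
    by (intro exI[of _ "\<alpha> * b"] exI[of _ "\<beta> * cnj b"]) (simp add: norm_mult algebra_simps)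
qed

lemma dilatation_at_transform:
  assumes "dilatation_at k f z" "open S" "z \<in> S" "\<And>w. w \<in> S \<Longrightarrow> f w = g w"
  shows "dilatation_at k g z"
  using assms unfolding dilatation_at_def by (meson has_derivative_transform_within_open)

lemma locally_lipschitz_compose:
  assumes f: "locally_lipschitz U f" and g: "locally_lipschitz V g" and gV: "\<And>z. z \<in> V \<Longrightarrow> g z \<in> U"
  shows "locally_lipschitz V (\<lambda>z. f (g z))"
proof (rule locally_lipschitzI)
  fix z assume z: "z \<in> V"
  obtain d L where d: "d > 0" "ball z d \<subseteq> V" "L-lipschitz_on (ball z d) g"
    using g z by (auto simp: locally_lipschitz_def)
  obtain e M where e: "e > 0" "ball (g z) e \<subseteq> U" "M-lipschitz_on (ball (g z) e) f"
    using f gV[OF z] unfolding locally_lipschitz_def by meson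
  have "open V" using g by (rule locally_lipschitz_imp_open)
  then have "isCont g z"
    using locally_lipschitz_imp_continuous[OF g] z by (simp add: continuous_on_eq_continuous_at)
  then obtain d' where d': "d' > 0" "\<And>w. dist w z < d' \<Longrightarrow> dist (g w) (g z) < e"
    using e(1) unfolding continuous_at_eps_delta by blast
  define r where "r = min d d'"
  have r: "r > 0" "ball z r \<subseteq> ball z d" using d d' by (auto simp: r_def)
  have "g ` ball z r \<subseteq> ball (g z) e"
    using d' by (auto simp: r_def dist_commute)
  then have "(M * L)-lipschitz_on (ball z r) (\<lambda>z. f (g z))"
    using lipschitz_on_compose2[OF lipschitz_on_subset[OF d(3) r(2)] lipschitz_on_subset[OF e(3)]] by blast
  then show "\<exists>e>0. \<exists>M. ball z e \<subseteq> V \<and> M-lipschitz_on (ball z e) (\<lambda>z. f (g z))"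
    using r d by (intro exI[of _ r] conjI exI[of _ "M * L"]) auto
qed

lemma locally_lipschitz_subset:
  assumes f: "locally_lipschitz U f" and V: "open V" "V \<subseteq> U"
  shows "locally_lipschitz V f"
proof (rule locally_lipschitzI)
  fix z assume z: "z \<in> V"
  then obtain e where e: "e > 0" "ball z e \<subseteq> V" using V open_contains_ball by blast
  obtain d M where d: "d > 0" "M-lipschitz_on (ball z d) f"
    using f z V(2) unfolding locally_lipschitz_def by blast
  have "ball z (min e d) \<subseteq> V" "M-lipschitz_on (ball z (min e d)) f"
    using subset_ball[of "min e d" e z] e(2) lipschitz_on_subset[OF d(2), of "ball z (min e d)"]
    by (auto intro: order_trans simp: subset_ball)
  then show "\<exists>e>0. \<exists>M. ball z e \<subseteq> V \<and> M-lipschitz_on (ball z e) f"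
    using e d by (intro exI[of _ "min e d"] exI[of _ M] conjI) auto
qed

lemma locally_lipschitz_transform:
  assumes f: "locally_lipschitz U f" and eq: "\<And>z. z \<in> U \<Longrightarrow> f z = g z"
  shows "locally_lipschitz U g"
proof (rule locally_lipschitzI)
  fix z assume "z \<in> U"
  then obtain e M where e: "e > 0" "ball z e \<subseteq> U" "M-lipschitz_on (ball z e) f"
    using f unfolding locally_lipschitz_def by meson
  have "M-lipschitz_on (ball z e) g"
    by (rule lipschitz_on_transform[OF e(3)]) (use e(2) eq in auto)
  with e show "\<exists>e>0. \<exists>M. ball z e \<subseteq> U \<and> M-lipschitz_on (ball z e) g" by blast
qed

lemma locally_lipschitz_inverse: "locally_lipschitz (- {0}) inverse"
proof (rule locally_lipschitzI)
  fix z :: complex assume "z \<in> - {0}"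
  then have z: "norm z > 0" by simp
  define r where "r = norm z / 2"
  have far: "norm w \<ge> r" if "w \<in> ball z r" for w
    using that norm_triangle_ineq2[of z w] by (simp add: r_def dist_norm)
  have "(1 / r\<^sup>2)-lipschitz_on (ball z r) inverse"
  proof (rule lipschitz_onI)
    fix x y assume xy: "x \<in> ball z r" "y \<in> ball z r"
    have r: "r > 0" using z by (simp add: r_def)
    have nz: "x \<noteq> 0" "y \<noteq> 0" using far[OF xy(1)] far[OF xy(2)] r by auto
    have "dist (inverse x) (inverse y) = norm (x - y) / (norm x * norm y)"
      using nz by (simp add: dist_norm inverse_diff_inverse norm_mult norm_inverse divide_inverse norm_minus_commute)
    also have "\<dots> \<le> norm (x - y) / (r * r)"
      using far[OF xy(1)] far[OF xy(2)] r by (intro divide_left_mono mult_mono mult_pos_pos) auto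
    finally show "dist (inverse x) (inverse y) \<le> 1 / r\<^sup>2 * dist x y"
      by (simp add: dist_norm power2_eq_square)
  qed simp
  moreover have "ball z r \<subseteq> - {0}" using far z by (force simp: r_def)
  ultimately show "\<exists>e>0. \<exists>M. ball z e \<subseteq> - {0} \<and> M-lipschitz_on (ball z e) inverse"
    using z by (intro exI[of _ r]) (auto simp: r_def)
qed

text \<open>All parts of the definition follow from local Lipschitz continuity, injectivity, a dilatation bound
  almost everywhere and conformality on some open subset; the latter fixes the orientation.\<close>
lemma quasiconformal_onI:
  assumes f: "locally_lipschitz U f" "inj_on f U" and U: "connected U"
    and N: "negligible N" and dil: "\<And>z. z \<in> U \<Longrightarrow> z \<notin> N \<Longrightarrow> dilatation_at k f z"
    and S: "open S" "S \<subseteq> U" "S \<noteq> {}" "f holomorphic_on S"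
  shows "quasiconformal_on k U f"
proof -
  have "open U" "continuous_on U f"
    using f(1) by (rule locally_lipschitz_imp_open, rule locally_lipschitz_imp_continuous)
  moreover then obtain g where "homeomorphism U (f ` U) f g"
    using invariance_of_domain_homeomorphism[OF _ _ _ f(2)] by auto
  ultimately show ?thesis
    unfolding quasiconformal_on_def
    by (intro conjI exI[of _ g] orientation_preserving_onI[OF _ f(2) _ U S] weak_derivatives_exist[OF f(1) N dil])
qed

lemma negligible_inverse_image:
  fixes N :: "complex set"
  assumes "negligible N"
  shows "negligible {z. inverse z \<in> N}"
proof -
  have "negligible (inverse ` (N - {0}))"
  proof (rule negligible_differentiable_image_negligible)
    show "negligible (N - {0})" using assms by (rule negligible_diff)
    show "inverse differentiable_on (N - {0})"
      by (rule differentiable_on_subset[of _ "- {0}"])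
         (auto intro!: holomorphic_on_imp_differentiable_on holomorphic_intros)
  qed simp
  then have "negligible (insert 0 (inverse ` (N - {0})))" by simp
  then show ?thesis
  proof (rule negligible_subset, intro subsetI)
    fix z assume z: "z \<in> {z. inverse z \<in> N}"
    show "z \<in> insert 0 (inverse ` (N - {0}))"
    proof (cases "z = 0")
      case False
      then show ?thesis using z by (intro insertI2 image_eqI[of _ _ "inverse z"]) auto
    qed simp
  qed
qed

lemma connected_delete_point: "connected (- {w :: complex})"
  by (rule connected_punctured_universe) simp

lemma linear_growth_bound:
  fixes F :: "complex \<Rightarrow> complex"
  assumes m: "0 < m" and growth: "\<And>z. R \<le> norm z \<Longrightarrow> m * norm z \<le> norm (F z)"
    and B: "norm (F z) \<le> B"
  shows "norm z \<le> max R (B / m)"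
proof (cases "R \<le> norm z")
  case True
  then have "m * norm z \<le> B" using growth[of z] B by simp
  then have "norm z \<le> B / m" using m by (simp add: field_simps)
  then show ?thesis by simp
qed simp

text \<open>The range is open by invariance of domain, and closed because preimages of bounded sets are bounded.\<close>
lemma proper_injective_imp_surj:
  fixes F :: "complex \<Rightarrow> complex"
  assumes cont: "continuous_on UNIV F" and inj: "inj F"
    and m: "0 < m" and growth: "\<And>z. R \<le> norm z \<Longrightarrow> m * norm z \<le> norm (F z)"
  shows "surj F"
proof -
  have "closed (range F)"
    unfolding closed_sequential_limits
  proof (intro allI impI)
    fix x l assume xl: "(\<forall>n::nat. x n \<in> range F) \<and> x \<longlonglongrightarrow> l"
    then have "\<forall>n. \<exists>w. x n = F w" by auto
    then obtain y where y: "\<And>n. x n = F (y n)" by metis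
    obtain B where B: "\<And>n. norm (x n) \<le> B"
      using xl convergent_imp_bounded[of x l] by (auto simp: bounded_iff)
    have "norm (y n) \<le> max R (B / m)" for n
      using growth B[of n] y[of n] by (intro linear_growth_bound[of m R F] m) simp_all
    then have "bounded (range y)" unfolding bounded_iff by blast
    then obtain a s where a: "strict_mono s" "(y \<circ> s) \<longlonglongrightarrow> a"
      using bounded_imp_convergent_subsequence by blast
    have "isCont F a" using cont by (simp add: continuous_on_eq_continuous_at)
    then have "(\<lambda>n. F ((y \<circ> s) n)) \<longlonglongrightarrow> F a" using a(2) by (rule isCont_tendsto_compose)
    moreover have "(x \<circ> s) \<longlonglongrightarrow> l" using xl a(1) by (simp add: LIMSEQ_subseq_LIMSEQ)
    moreover have "(\<lambda>n. F ((y \<circ> s) n)) = x \<circ> s" using y by (simp add: fun_eq_iff)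
    ultimately have "l = F a" using LIMSEQ_unique by metis
    then show "l \<in> range F" by simp
  qed
  moreover have "open (range F)"
    using invariance_of_domain[OF cont _ inj] by simp
  ultimately show ?thesis
    using clopen[of "range F"] by simp
qed

text \<open>The sphere is compact and Hausdorff, so only continuity has to be checked. Neighbourhoods of infinity are
  complements of compact sets, and linear growth makes preimages of compact sets compact.\<close>
lemma homeomorphic_map_sphere:
  fixes F :: "complex \<Rightarrow> complex"
  assumes cont: "continuous_on UNIV F" and inj: "inj F"
    and m: "0 < m" and growth: "\<And>z. R \<le> norm z \<Longrightarrow> m * norm z \<le> norm (F z)"
  shows "homeomorphic_map riemann_sphere riemann_sphere (map_option F)"
proof (rule continuous_imp_homeomorphic_map)
  have top: "topspace riemann_sphere = UNIV"
    by (simp add: riemann_sphere_def UNIV_option_conv)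
  show "compact_space riemann_sphere" by (simp add: riemann_sphere_def)
  show "Hausdorff_space riemann_sphere"
    unfolding riemann_sphere_def Hausdorff_space_Alexandroff_compactification
    by (simp add: Hausdorff_space_euclidean locally_compact_space_euclidean)
  show "map_option F ` topspace riemann_sphere = topspace riemann_sphere"
  proof -
    have "y \<in> range (map_option F)" for y
    proof (cases y)
      case None then show ?thesis by (intro image_eqI[of _ _ None]) auto
    next
      case (Some b)
      obtain a where "b = F a" using proper_injective_imp_surj[OF assms] by (rule surjE)
      then show ?thesis using Some by (intro image_eqI[of _ _ "Some a"]) auto
    qed
    then show ?thesis by (auto simp: top)
  qed
  show "inj_on (map_option F) (topspace riemann_sphere)"
    using inj by (simp add: top option.inj_map)
  show "continuous_map riemann_sphere riemann_sphere (map_option F)"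
    unfolding continuous_map
  proof (intro conjI allI impI)
    fix V assume V: "openin riemann_sphere V"
    then consider (fin) W where "open W" "V = Some ` W"
      | (inf) C where "compact C" "V = insert None (Some ` (- C))"
      by (auto simp: riemann_sphere_def openin_Alexandroff_compactification Compl_eq_Diff_UNIV)
    then have "openin riemann_sphere (map_option F -` V)"
    proof cases
      case fin
      have "map_option F -` V = Some ` (F -` W)"
      proof (intro set_eqI)
        show "x \<in> map_option F -` V \<longleftrightarrow> x \<in> Some ` (F -` W)" for x
          by (cases x) (auto simp: fin)
      qed
      moreover have "open (F -` W)"
        using fin(1) cont by (rule open_vimage)
      ultimately show ?thesis by (simp add: riemann_sphere_def)
    next
      case inf
      have "map_option F -` V = insert None (Some ` (- (F -` C)))"
      proof (intro set_eqI)
        show "x \<in> map_option F -` V \<longleftrightarrow> x \<in> insert None (Some ` (- (F -` C)))" for x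
          by (cases x) (auto simp: inf)
      qed
      moreover have "compact (F -` C)"
      proof -
        have "closed (F -` C)"
          using compact_imp_closed[OF inf(1)] cont by (rule closed_vimage)
        moreover have "bounded (F -` C)"
        proof -
          obtain B where B: "\<And>w. w \<in> C \<Longrightarrow> norm w \<le> B"
            using compact_imp_bounded[OF inf(1)] by (auto simp: bounded_iff)
          have "norm z \<le> max R (B / m)" if "z \<in> F -` C" for z
            using growth B[of "F z"] that by (intro linear_growth_bound[of m R F] m) simp_all
          then show ?thesis unfolding bounded_iff by blast
        qed
        ultimately show ?thesis by (simp add: compact_eq_bounded_closed)
      qed
      ultimately show ?thesis
        unfolding riemann_sphere_def openin_Alexandroff_compactification
        by (auto simp: Compl_eq_Diff_UNIV compact_imp_closed intro!: disjI2 exI[of _ "F -` C"])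
    qed
    then show "openin riemann_sphere {x \<in> topspace riemann_sphere. map_option F x \<in> V}"
      by (simp add: top vimage_def)
  qed (simp add: top)
qed

text \<open>The chart expressions of a sphere map take arbitrary values outside their domains, so they agree with
  the usual formulas only on \<open>U\<close>.\<close>
lemma quasiconformal_on_transform:
  assumes f: "locally_lipschitz U f" "inj_on f U" and U: "connected U"
    and N: "negligible N" and dil: "\<And>z. z \<in> U \<Longrightarrow> z \<notin> N \<Longrightarrow> dilatation_at k f z"
    and S: "open S" "S \<subseteq> U" "S \<noteq> {}" "f holomorphic_on S"
    and eq: "\<And>z. z \<in> U \<Longrightarrow> f z = g z"
  shows "quasiconformal_on k U g"
proof (rule quasiconformal_onI[OF _ _ U N _ S(1-3)])
  have U_open: "open U" using f(1) by (rule locally_lipschitz_imp_open)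
  show "locally_lipschitz U g" using f(1) eq by (rule locally_lipschitz_transform)
  show "inj_on g U" using f(2) inj_on_cong[of U f g, OF eq] by simp
  show "dilatation_at k g z" if "z \<in> U" "z \<notin> N" for z
    by (rule dilatation_at_transform[OF dil[OF that] U_open that(1) eq])
  show "g holomorphic_on S"
    using S(2) eq by (intro holomorphic_transform[OF S(4)]) auto
qed

lemma negligible_inverse_preimage_insert:
  fixes N :: "complex set"
  assumes "negligible N"
  shows "negligible (insert 0 {z. inverse z \<in> N})"
  using negligible_inverse_image[OF assms] by simp

text \<open>Away from \<open>0\<close>, the expressions of \<open>F\<close> in the charts are compositions of \<open>F\<close> with inversions, which are
  conformal and locally Lipschitz. The one new point is infinity, that is, \<open>0\<close> in the chart \<open>1/F(1/z)\<close>: there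
  \<open>\<bar>1/F(1/x) - 1/F(1/y)\<bar> \<le> M \<bar>1/x - 1/y\<bar> (\<bar>x\<bar>/m) (\<bar>y\<bar>/m) = M/m\<^sup>2 \<bar>x - y\<bar>\<close>.\<close>
theorem quasiconformal_sphereI:
  fixes F :: "complex \<Rightarrow> complex"
  assumes lip: "M-lipschitz_on UNIV F" and inj: "inj F"
    and m: "0 < m" and growth: "\<And>z. R \<le> norm z \<Longrightarrow> m * norm z \<le> norm (F z)"
    and N: "negligible N" and dil: "\<And>z. z \<notin> N \<Longrightarrow> dilatation_at k F z"
    and V: "open V" "V \<noteq> {}" "F holomorphic_on V"
  shows "quasiconformal_sphere k (map_option F)"
proof -
  have cont: "continuous_on UNIV F" using lip by (rule lipschitz_on_continuous_on)
  have surj: "surj F" using cont inj m growth by (rule proper_injective_imp_surj)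
  obtain w0 where w0: "F w0 = 0"
    using surjD[OF surj, of 0] by auto
  have F0: "F z = 0 \<longleftrightarrow> z = w0" for z using injD[OF inj, of z w0] w0 by auto
  have LF: "locally_lipschitz UNIV F"
  proof (rule locally_lipschitzI)
    fix z
    have "M-lipschitz_on (ball z 1) F" by (rule lipschitz_on_subset[OF lip]) simp
    then show "\<exists>e>0. \<exists>M. ball z e \<subseteq> UNIV \<and> M-lipschitz_on (ball z e) F"
      by (intro exI[of _ 1] exI[of _ M] conjI) auto
  qed
  have inv_der: "(inverse has_field_derivative - inverse (z\<^sup>2)) (at z)" if "z \<noteq> 0" for z :: complex
    using DERIV_inverse[OF that] by (simp add: power2_eq_square)
  \<comment> \<open>A set of conformality on which the inversions before and after \<open>F\<close> are also conformal.\<close>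
  define W where "W = V - {0, w0}"
  have W: "open W" "F holomorphic_on W" "0 \<notin> W" "w0 \<notin> W"
    using V by (auto simp: W_def intro: holomorphic_on_subset)
  have "W \<noteq> {}"
  proof
    assume "W = {}"
    then have "V \<subseteq> {0, w0}" by (auto simp: W_def)
    then have "finite V" using finite_subset by blast
    then show False using V(1,2) finite_imp_not_open by blast
  qed
  then obtain w1 where w1: "w1 \<in> W" by blast
  define W' where "W' = {z \<in> - {0}. inverse z \<in> W}"
  have "continuous_on (- {0}) (inverse :: complex \<Rightarrow> complex)"
    using locally_lipschitz_inverse by (rule locally_lipschitz_imp_continuous)
  then have "open W'"
    using continuous_open_preimage[of "- {0}" inverse W] W(1) open_delete[OF open_UNIV, of "0::complex"]
    by (simp add: W'_def vimage_def Int_def Compl_eq_Diff_UNIV)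
  have "inverse w1 \<in> W'" using w1 W by (auto simp: W'_def)
  then have "W' \<noteq> {}" by blast
  have F_inv: "(\<lambda>z. F (inverse z)) holomorphic_on W'"
  proof (rule holomorphic_on_compose_gen[unfolded o_def, OF _ W(2)])
    show "inverse holomorphic_on W'"
      by (intro holomorphic_intros) (auto simp: W'_def)
    show "inverse ` W' \<subseteq> W" by (auto simp: W'_def)
  qed

  have chart1: "quasiconformal_on k UNIV F"
    by (rule quasiconformal_onI[OF LF inj connected_UNIV N _ V(1) subset_UNIV V(2,3)]) (rule dil)

  define f2 where "f2 = (\<lambda>z. F (inverse z))"
  have f2_dil: "dilatation_at k f2 z" if "z \<noteq> 0" "inverse z \<notin> N" for z
    unfolding f2_def by (rule dilatation_at_compose_right[OF inv_der[OF that(1)] dil[OF that(2)]])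
  have f2_lip: "locally_lipschitz (- {0}) f2"
    unfolding f2_def by (rule locally_lipschitz_compose[OF LF locally_lipschitz_inverse]) simp
  have f2_inj: "inj_on f2 (- {0})"
    unfolding f2_def by (rule inj_onI) (metis inj injD inverse_inverse_eq)
  have chart2: "quasiconformal_on k (- {0}) g" if eq: "\<And>z. z \<noteq> 0 \<Longrightarrow> f2 z = g z" for g
  proof (rule quasiconformal_on_transform[OF f2_lip f2_inj connected_delete_point
          negligible_inverse_image[OF N] _ \<open>open W'\<close> _ \<open>W' \<noteq> {}\<close>])
    show "W' \<subseteq> - {0}" by (auto simp: W'_def)
    show "f2 holomorphic_on W'" using F_inv by (simp add: f2_def)
    show "dilatation_at k f2 z" if "z \<in> - {0}" "z \<notin> {z. inverse z \<in> N}" for z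
      using that by (intro f2_dil) auto
    show "f2 z = g z" if "z \<in> - {0}" for z
      using that by (intro eq) auto
  qed

  define f3 where "f3 = (\<lambda>z. inverse (F z))"
  have f3_lip: "locally_lipschitz (- {w0}) f3"
  proof -
    have "locally_lipschitz (- {w0}) F" by (rule locally_lipschitz_subset[OF LF]) auto
    then show ?thesis
      unfolding f3_def by (rule locally_lipschitz_compose[OF locally_lipschitz_inverse]) (auto simp: F0)
  qed
  have chart3: "quasiconformal_on k (- {w0}) g" if eq: "\<And>z. z \<noteq> w0 \<Longrightarrow> f3 z = g z" for g
  proof (rule quasiconformal_on_transform[OF f3_lip _ connected_delete_point N _ W(1)])
    show "inj_on f3 (- {w0})"
      unfolding f3_def by (rule inj_onI) (metis inj injD inverse_inverse_eq)
    show "dilatation_at k f3 z" if "z \<in> - {w0}" "z \<notin> N" for z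
      unfolding f3_def
      by (rule dilatation_at_compose_left[OF dil inv_der]) (use that in \<open>auto simp: F0\<close>)
    show "f3 holomorphic_on W"
      unfolding f3_def using W by (intro holomorphic_intros) (auto simp: F0)
  qed (use W w1 eq in auto)

  define f4 where "f4 = (\<lambda>z. if z = 0 then 0 else inverse (F (inverse z)))"
  define U4 where "U4 = {z. z = 0 \<or> F (inverse z) \<noteq> 0}"
  have inv_w0: "inverse z = w0 \<longleftrightarrow> z = inverse w0" for z by auto
  have U4: "U4 = (if w0 = 0 then UNIV else - {inverse w0})"
    unfolding U4_def F0 inv_w0 by auto
  have f4_pos: "locally_lipschitz (U4 - {0}) f4"
  proof (rule locally_lipschitz_transform)
    have "locally_lipschitz (U4 - {0}) f2"
      by (rule locally_lipschitz_subset[OF f2_lip]) (auto simp: U4)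
    then show "locally_lipschitz (U4 - {0}) (\<lambda>z. inverse (f2 z))"
      by (rule locally_lipschitz_compose[OF locally_lipschitz_inverse]) (auto simp: U4_def f2_def)
  qed (simp add: f4_def f2_def)
  define e0 where "e0 = 1 / max R 1"
  have e0: "e0 > 0" by (simp add: e0_def)
  have near0: "m / norm z \<le> norm (F (inverse z))" if "z \<in> ball (0::complex) e0" "z \<noteq> 0" for z
  proof -
    have pos: "0 < max R 1" "0 < norm z" using that(2) by auto
    have "norm z < 1 / max R 1" using that by (simp add: e0_def)
    then have "norm z * max R 1 < 1"
      unfolding pos_less_divide_eq[OF pos(1)] .
    then have "max R 1 < 1 / norm z"
      unfolding pos_less_divide_eq[OF pos(2)] by (simp only: mult.commute)
    then have "R \<le> norm (inverse z)" by (simp add: inverse_eq_divide norm_divide)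
    then show ?thesis using growth[of "inverse z"] by (simp add: norm_inverse divide_inverse)
  qed
  have ball_U4: "ball (0::complex) e0 \<subseteq> U4"
  proof
    fix z :: complex assume z: "z \<in> ball 0 e0"
    show "z \<in> U4"
    proof (cases "z = 0")
      case False
      then have "0 < m / norm z" using m by simp
      then show ?thesis using near0[OF z False] by (auto simp: U4_def)
    qed (simp add: U4_def)
  qed
  have M0: "0 \<le> M" using lip by (rule lipschitz_on_nonneg)
  have f4_le: "norm (f4 z) \<le> norm z / m" if "z \<in> ball (0::complex) e0" for z
  proof (cases "z = 0")
    case False
    have "inverse (norm (F (inverse z))) \<le> inverse (m / norm z)"
      using near0[OF that False] m False by (intro le_imp_inverse_le) auto
    then show ?thesis using False by (simp add: f4_def norm_inverse)
  qed (simp add: f4_def)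
  have f4_0: "(max (M / m\<^sup>2) (1 / m))-lipschitz_on (ball (0::complex) e0) f4"
  proof (rule lipschitz_onI)
    fix x y assume xy: "x \<in> ball (0::complex) e0" "y \<in> ball (0::complex) e0"
    show "dist (f4 x) (f4 y) \<le> max (M / m\<^sup>2) (1 / m) * dist x y"
    proof (cases "x = 0 \<or> y = 0")
      case True
      then have "dist (f4 x) (f4 y) \<le> (1 / m) * dist x y"
        using f4_le[OF xy(1)] f4_le[OF xy(2)] by (auto simp: f4_def)
      also have "\<dots> \<le> max (M / m\<^sup>2) (1 / m) * dist x y"
        by (intro mult_right_mono) auto
      finally show ?thesis .
    next
      case False
      then have nz: "x \<noteq> 0" "y \<noteq> 0" by auto
      have Fnz: "F (inverse x) \<noteq> 0" "F (inverse y) \<noteq> 0"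
        using subsetD[OF ball_U4 xy(1)] subsetD[OF ball_U4 xy(2)] nz by (auto simp: U4_def)
      have "f4 x - f4 y = (F (inverse y) - F (inverse x)) * (f4 x * f4 y)"
        using nz Fnz by (simp add: f4_def field_simps)
      then have "dist (f4 x) (f4 y) = norm (F (inverse y) - F (inverse x)) * (norm (f4 x) * norm (f4 y))"
        by (simp add: dist_norm norm_mult)
      also have "\<dots> \<le> (M * norm (inverse y - inverse x)) * ((norm x / m) * (norm y / m))"
        using lipschitz_onD[OF lip, of "inverse y" "inverse x"] f4_le[OF xy(1)] f4_le[OF xy(2)] M0 m
        by (intro mult_mono) (auto simp: dist_norm)
      also have "inverse y - inverse x = (x - y) / (x * y)"
        using nz by (simp add: field_simps)
      also have "(M * norm ((x - y) / (x * y))) * ((norm x / m) * (norm y / m)) = M / m\<^sup>2 * dist x y"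
        using nz m by (simp add: norm_divide norm_mult dist_norm power2_eq_square field_simps)
      also have "\<dots> \<le> max (M / m\<^sup>2) (1 / m) * dist x y"
        by (intro mult_right_mono) auto
      finally show ?thesis .
    qed
  qed (use m in \<open>simp add: le_max_iff_disj\<close>)
  have f4_lip: "locally_lipschitz U4 f4"
  proof (rule locally_lipschitzI)
    fix z assume z: "z \<in> U4"
    show "\<exists>e>0. \<exists>M. ball z e \<subseteq> U4 \<and> M-lipschitz_on (ball z e) f4"
    proof (cases "z = 0")
      case True
      then show ?thesis using e0 ball_U4 f4_0 by blast
    next
      case False
      then obtain e M where "e > 0" "ball z e \<subseteq> U4 - {0}" "M-lipschitz_on (ball z e) f4"
        using f4_pos z unfolding locally_lipschitz_def by (metis DiffI singletonD)
      then show ?thesis by blast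
    qed
  qed
  have chart4: "quasiconformal_on k U4 g" if eq: "\<And>z. z \<in> U4 \<Longrightarrow> f4 z = g z" for g
  proof (rule quasiconformal_on_transform[OF f4_lip _ _ negligible_inverse_preimage_insert[OF N] _ \<open>open W'\<close> _ \<open>W' \<noteq> {}\<close> _ eq])
    show "connected U4" unfolding U4 by (simp add: connected_delete_point connected_UNIV)
    show "inj_on f4 U4"
    proof (rule inj_onI)
      fix x y assume xy: "x \<in> U4" "y \<in> U4" "f4 x = f4 y"
      have zero: "f4 x = 0 \<longleftrightarrow> x = 0" if "x \<in> U4" for x using that by (auto simp: f4_def U4_def)
      show "x = y"
      proof (cases "x = 0 \<or> y = 0")
        case False
        then have "F (inverse x) = F (inverse y)" using xy(3) by (simp add: f4_def)
        then have "inverse x = inverse y" using inj by (rule injD[rotated])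
        then show ?thesis by simp
      qed (use zero xy in metis)
    qed
    show "W' \<subseteq> U4"
      using W by (auto simp: W'_def U4_def F0)
    show "f4 holomorphic_on W'"
    proof (rule holomorphic_transform)
      show "(\<lambda>z. inverse (F (inverse z))) holomorphic_on W'"
        using W(4) by (intro holomorphic_intros F_inv) (auto simp: F0 W'_def)
    qed (auto simp: W'_def f4_def)
    show "dilatation_at k f4 z" if z: "z \<in> U4" "z \<notin> insert 0 {z. inverse z \<in> N}" for z
    proof (rule dilatation_at_transform[where S = "- {0}"])
      show "dilatation_at k (\<lambda>z. inverse (f2 z)) z"
        by (rule dilatation_at_compose_left[OF f2_dil inv_der]) (use z in \<open>auto simp: U4_def f2_def\<close>)
    qed (use z in \<open>auto simp: f4_def f2_def\<close>)
  qed

  have homeo: "homeomorphic_map riemann_sphere riemann_sphere (map_option F)"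
    by (rule homeomorphic_map_sphere[OF cont inj m growth])
  have dom2: "{z. (id \<circ> map_option F \<circ> sphere_inverse) (Some z) \<noteq> None} = - {0}"
    by auto
  have dom3: "{z. (sphere_inverse \<circ> map_option F \<circ> id) (Some z) \<noteq> None} = - {w0}"
    by (auto simp: F0)
  have dom4: "{z. (sphere_inverse \<circ> map_option F \<circ> sphere_inverse) (Some z) \<noteq> None} = U4"
    by (auto simp: U4_def)
  let ?chart = "\<lambda>A B. quasiconformal_on k {z. (B \<circ> map_option F \<circ> A) (Some z) \<noteq> None}
      (\<lambda>z. the ((B \<circ> map_option F \<circ> A) (Some z)))"
  have "?chart id id"
    using chart1 by simp
  moreover have "?chart sphere_inverse id"
    unfolding dom2 by (rule chart2) (simp add: f2_def)
  moreover have "?chart id sphere_inverse"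
    unfolding dom3 by (rule chart3) (simp add: f3_def F0)
  moreover have "?chart sphere_inverse sphere_inverse"
  proof (unfold dom4, rule chart4)
    fix z assume "z \<in> U4"
    then show "f4 z = the ((sphere_inverse \<circ> map_option F \<circ> sphere_inverse) (Some z))"
      by (cases "z = 0") (simp_all add: f4_def U4_def)
  qed
  ultimately have charts: "?chart A B" if "A \<in> {id, sphere_inverse}" "B \<in> {id, sphere_inverse}" for A B
    using that by - (elim insertE emptyE; hypsubst; assumption)
  show ?thesis
    unfolding quasiconformal_sphere_def
  proof (intro conjI ballI)
    show "homeomorphic_map riemann_sphere riemann_sphere (map_option F)" by (rule homeo)
    show "?chart A B" if "A \<in> {id, sphere_inverse}" "B \<in> {id, sphere_inverse}" for A B
      using that by (rule charts)
  qed
qed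

section \<open>The extension in the disk coordinate\<close>

text \<open>On the unit circle the condition \<open>\<bar>X\<bar> \<le> k \<bar>1 - u X\<bar>\<close> means that \<open>X\<close> lies in a closed disk; the identity
  exhibits its centre and its radius.\<close>
lemma boundary_disk_identity:
  fixes u X :: complex and k :: real
  assumes "norm u = 1" and k: "k\<^sup>2 < 1"
  shows "(norm X)\<^sup>2 - k\<^sup>2 * (norm (1 - u * X))\<^sup>2
       = (1 - k\<^sup>2) * ((norm (X - - of_real (k\<^sup>2 / (1 - k\<^sup>2)) * cnj u))\<^sup>2 - (k / (1 - k\<^sup>2))\<^sup>2)"
proof -
  define t where "t = k\<^sup>2 / (1 - k\<^sup>2)"
  have t: "(1 - k\<^sup>2) * t = k\<^sup>2" using k by (simp add: t_def)
  have u: "(Re u)\<^sup>2 + (Im u)\<^sup>2 = 1" using assms(1) cmod_power2[of u] by simp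
  have "(norm (X - - of_real t * cnj u))\<^sup>2
      = (norm X)\<^sup>2 + 2 * t * (Re u * Re X - Im u * Im X) + t\<^sup>2 * ((Re u)\<^sup>2 + (Im u)\<^sup>2)"
    unfolding cmod_power2 by (simp add: power2_eq_square algebra_simps)
  then have 1: "(norm (X - - of_real t * cnj u))\<^sup>2 = (norm X)\<^sup>2 + 2 * t * (Re u * Re X - Im u * Im X) + t\<^sup>2"
    by (simp add: u)
  have "(norm (1 - u * X))\<^sup>2
      = 1 - 2 * (Re u * Re X - Im u * Im X) + ((Re u)\<^sup>2 + (Im u)\<^sup>2) * (norm X)\<^sup>2"
    unfolding cmod_power2 by (simp add: power2_eq_square algebra_simps)
  then have 2: "(norm (1 - u * X))\<^sup>2 = 1 - 2 * (Re u * Re X - Im u * Im X) + (norm X)\<^sup>2"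
    by (simp add: u)
  have "(k / (1 - k\<^sup>2))\<^sup>2 = k\<^sup>2 / (1 - k\<^sup>2)\<^sup>2" by (simp add: power_divide)
  also have "\<dots> = t * (1 / (1 - k\<^sup>2))" by (simp add: t_def power2_eq_square)
  also have "1 / (1 - k\<^sup>2) = 1 + t" using k by (simp add: t_def field_simps)
  also have "t * (1 + t) = t + t\<^sup>2" by (simp add: power2_eq_square algebra_simps)
  finally have 3: "(k / (1 - k\<^sup>2))\<^sup>2 = t + t\<^sup>2" .
  define s where "s = Re u * Re X - Im u * Im X"
  have "(1 - k\<^sup>2) * ((norm X)\<^sup>2 + 2 * t * s + t\<^sup>2 - (t + t\<^sup>2))
      = (1 - k\<^sup>2) * (norm X)\<^sup>2 + ((1 - k\<^sup>2) * t) * (2 * s - 1)"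
    by (simp add: algebra_simps)
  also have "\<dots> = (norm X)\<^sup>2 - k\<^sup>2 * (1 - 2 * s + (norm X)\<^sup>2)"
    unfolding t by (simp add: algebra_simps)
  finally show ?thesis
    unfolding t_def[symmetric] 1 2 3 s_def by simp
qed

lemma disk_condition_bound:
  fixes u X :: complex
  assumes k: "0 \<le> k" "k < 1" and u: "norm u \<le> 1" and X: "norm X \<le> k * norm (1 - u * X)"
  shows "norm X \<le> k / (1 - k)"
proof -
  have "norm (1 - u * X) \<le> 1 + norm u * norm X"
    using norm_triangle_ineq4[of 1 "u * X"] by (simp add: norm_mult)
  also have "\<dots> \<le> 1 + 1 * norm X"
    using u by (intro add_left_mono mult_right_mono) auto
  finally have "k * norm (1 - u * X) \<le> k * (1 + norm X)"
    using k by (intro mult_left_mono) auto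
  then have "norm X * (1 - k) \<le> k" using X by (simp add: algebra_simps)
  then show ?thesis using k by (simp add: field_simps)
qed

lemma exp_lipschitz_bound:
  fixes a b :: complex
  assumes "Re a \<le> R" "Re b \<le> R"
  shows "norm (exp a - exp b) \<le> exp R * norm (a - b)"
proof (rule field_differentiable_bound[of "{z. Re z \<le> R}" exp exp])
  show "convex {z. Re z \<le> R}" by (rule convex_halfspace_Re_le)
  show "(exp has_field_derivative exp z) (at z within {z. Re z \<le> R})" for z :: complex
    by (rule has_field_derivative_at_within) (rule DERIV_exp)
  show "norm (exp z) \<le> exp R" if "z \<in> {z. Re z \<le> R}" for z :: complex
    using that by simp
qed (use assms in auto)

definition clamp01 :: "real \<Rightarrow> real" where
  "clamp01 x = min 1 (max 0 x)"

lemma clamp01_lipschitz: "\<bar>clamp01 x - clamp01 y\<bar> \<le> \<bar>x - y\<bar>"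
  by (auto simp: clamp01_def min_def max_def)

lemma clamp01_simps:
  "x \<le> 0 \<Longrightarrow> clamp01 x = 0" "0 \<le> x \<Longrightarrow> x \<le> 1 \<Longrightarrow> clamp01 x = x" "1 \<le> x \<Longrightarrow> clamp01 x = 1"
  "0 \<le> clamp01 x" "0 < x \<Longrightarrow> 0 < clamp01 x" "0 \<le> x \<Longrightarrow> clamp01 x \<le> x" "clamp01 x \<le> 1"
  by (auto simp: clamp01_def min_def max_def)

lemma clamp01_Re_le_norm: "clamp01 (Re z) \<le> norm z"
  using complex_Re_le_cmod[of z] clamp01_simps(6)[of "Re z"]
  by (cases "0 \<le> Re z") (simp_all add: clamp01_simps(1))

text \<open>For \<open>E = log ((h + a)/\<zeta>)\<close> as a function of \<open>u = 2/\<zeta> - 1\<close>, the derivative condition is the hypothesis of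
  the extension theorem. The Lipschitz condition on the closed disk says that \<open>E\<close> stands for the
  continuous extension of this logarithm.\<close>
locale disk_logarithm =
  fixes k :: real and E :: "complex \<Rightarrow> complex"
  assumes k: "0 \<le> k" "k < 1"
    and E_hol: "E holomorphic_on ball 0 1"
    and E_lip: "(k / (1 - k))-lipschitz_on (cball 0 1) E"
    and E_deriv: "\<And>u. u \<in> ball 0 1 \<Longrightarrow> norm (deriv E u) \<le> k * norm (1 - u * deriv E u)"
begin

definition lip_const :: real where "lip_const = k / (1 - k)"

lemma lip_const_nonneg: "0 \<le> lip_const" using k by (simp add: lip_const_def)

lemma E_lipschitz: "u \<in> cball 0 1 \<Longrightarrow> w \<in> cball 0 1 \<Longrightarrow> norm (E u - E w) \<le> lip_const * norm (u - w)"
  using lipschitz_onD[OF E_lip] by (simp add: lip_const_def dist_norm)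

lemma E_cont: "continuous_on (cball 0 1) E"
  using E_lip by (rule lipschitz_on_continuous_on)

definition log_bound :: real where "log_bound = norm (E 0) + lip_const"

lemma E_bound: "u \<in> cball 0 1 \<Longrightarrow> norm (E u) \<le> log_bound"
proof -
  assume u: "u \<in> cball 0 1"
  have "norm (E u) \<le> norm (E 0) + norm (E u - E 0)" using norm_triangle_sub by blast
  also have "norm (E u - E 0) \<le> lip_const * norm (u - 0)" by (rule E_lipschitz[OF u]) simp
  also have "\<dots> \<le> lip_const * 1" using u lip_const_nonneg by (intro mult_left_mono) auto
  finally show ?thesis by (simp add: log_bound_def)
qed

text \<open>For \<open>Re z \<ge> 1\<close> this is the conformal map \<open>2/z - 1\<close> into the closed disk, in the strip \<open>0 < Re z < 1\<close> it is
  \<open>cnj z/z\<close> on the unit circle, and for \<open>Re z \<le> 0\<close> it is the constant \<open>-1\<close> (also at \<open>z = 0\<close>, by the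
  convention for division by zero).\<close>
definition disk_point :: "complex \<Rightarrow> complex" where
  "disk_point z = 2 * of_real (clamp01 (Re z)) / z - 1"

definition \<Psi> :: "complex \<Rightarrow> complex" where
  "\<Psi> z = z * exp (E (disk_point z))"

lemma disk_point_mem: "disk_point z \<in> cball 0 1"
proof (cases "z = 0")
  case False
  let ?t = "clamp01 (Re z)"
  have "?t * (?t - Re z) \<le> 0"
    by (cases "0 \<le> Re z") (auto simp: clamp01_simps mult_nonneg_nonpos)
  then have "(norm (2 * of_real ?t - z))\<^sup>2 \<le> (norm z)\<^sup>2"
    unfolding cmod_power2 by (simp add: power2_eq_square algebra_simps)
  then have "norm (2 * of_real ?t - z) \<le> norm z" by (rule power2_le_imp_le) simp
  moreover have "disk_point z = (2 * of_real ?t - z) / z" using False by (simp add: disk_point_def field_simps)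
  ultimately show ?thesis using False by (simp add: norm_divide)
qed (simp add: disk_point_def)

lemma Re_E_disk_point: "Re (E (disk_point z)) \<le> log_bound" "- log_bound \<le> Re (E (disk_point z))"
  using E_bound[OF disk_point_mem, of z] abs_Re_le_cmod[of "E (disk_point z)"] by auto

lemma \<Psi>_lower: "exp (- log_bound) * norm z \<le> norm (\<Psi> z)"
  using Re_E_disk_point(2)[of z] by (simp add: \<Psi>_def norm_mult mult.commute mult_left_mono)

lemma \<Psi>_upper: "norm (\<Psi> z) \<le> exp log_bound * norm z"
  using Re_E_disk_point(1)[of z] by (simp add: \<Psi>_def norm_mult mult.commute mult_left_mono)

text \<open>Although \<^const>\<open>disk_point\<close> is discontinuous at \<open>0\<close>, the product \<open>\<bar>w\<bar> \<bar>disk_point z - disk_point w\<bar>\<close> is at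
  most \<open>4 \<bar>z - w\<bar>\<close>, because the truncation satisfies \<open>\<tau> \<le> \<bar>z\<bar>\<close>.\<close>
lemma \<Psi>_lipschitz: "(exp log_bound * (1 + 4 * lip_const))-lipschitz_on UNIV \<Psi>"
proof (rule lipschitz_onI)
  show "0 \<le> exp log_bound * (1 + 4 * lip_const)" using lip_const_nonneg by simp
  fix z w :: complex
  have one: "exp log_bound * r \<le> exp log_bound * (1 + 4 * lip_const) * r" if "0 \<le> r" for r
    using lip_const_nonneg that by (simp add: algebra_simps)
  show "dist (\<Psi> z) (\<Psi> w) \<le> exp log_bound * (1 + 4 * lip_const) * dist z w"
  proof (cases "z = 0 \<or> w = 0")
    case True
    then have "dist (\<Psi> z) (\<Psi> w) \<le> exp log_bound * dist z w"
      using \<Psi>_upper[of z] \<Psi>_upper[of w] by (auto simp: \<Psi>_def)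
    also have "\<dots> \<le> exp log_bound * (1 + 4 * lip_const) * dist z w" by (rule one) simp
    finally show ?thesis .
  next
    case False
    then have nz: "z \<noteq> 0" "w \<noteq> 0" by auto
    let ?t = "clamp01 (Re z)" and ?s = "clamp01 (Re w)"
    let ?a = "E (disk_point z)" and ?b = "E (disk_point w)"
    have "norm w * norm (disk_point z - disk_point w) = norm (w * (disk_point z - disk_point w))"
      by (simp add: norm_mult)
    also have "w * (disk_point z - disk_point w) = 2 * (of_real (?t - ?s) + of_real ?t * ((w - z) / z))"
      using nz by (simp add: disk_point_def field_simps)
    also have "norm \<dots> \<le> 2 * (\<bar>?t - ?s\<bar> + ?t * (norm (w - z) / norm z))"
    proof -
      have "norm (of_real (?t - ?s) :: complex) = \<bar>?t - ?s\<bar>" by (rule norm_of_real)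
      moreover have "norm (of_real ?t * ((w - z) / z)) = ?t * (norm (w - z) / norm z)"
        using clamp01_simps(4)[of "Re z"] by (simp add: norm_mult norm_divide)
      ultimately have "norm (of_real (?t - ?s) + of_real ?t * ((w - z) / z)) \<le> \<bar>?t - ?s\<bar> + ?t * (norm (w - z) / norm z)"
        using norm_triangle_ineq[of "of_real (?t - ?s)" "of_real ?t * ((w - z) / z)"] by (simp only:)
      then show ?thesis by (simp only: norm_mult norm_numeral) simp
    qed
    also have "\<dots> \<le> 2 * (norm (z - w) + norm (z - w))"
    proof -
      have "\<bar>?t - ?s\<bar> \<le> norm (z - w)"
        using clamp01_lipschitz[of "Re z" "Re w"] abs_Re_le_cmod[of "z - w"] by simp
      moreover have "?t * (norm (w - z) / norm z) \<le> norm (z - w)"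
      proof -
        have "?t * norm (w - z) \<le> norm z * norm (w - z)"
          by (intro mult_right_mono clamp01_Re_le_norm) auto
        then show ?thesis using nz by (simp add: norm_minus_commute field_simps)
      qed
      ultimately show ?thesis by simp
    qed
    finally have arg: "norm w * norm (disk_point z - disk_point w) \<le> 4 * norm (z - w)" by simp
    have "norm w * norm (exp ?a - exp ?b) \<le> norm w * (exp log_bound * norm (?a - ?b))"
      by (intro mult_left_mono exp_lipschitz_bound Re_E_disk_point) auto
    also have "\<dots> \<le> norm w * (exp log_bound * (lip_const * norm (disk_point z - disk_point w)))"
      by (intro mult_left_mono E_lipschitz disk_point_mem) auto
    also have "\<dots> = exp log_bound * (lip_const * (norm w * norm (disk_point z - disk_point w)))" by simp
    also have "\<dots> \<le> exp log_bound * (lip_const * (4 * norm (z - w)))"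
      by (intro mult_left_mono arg lip_const_nonneg) auto
    finally have 2: "norm (w * (exp ?a - exp ?b)) \<le> exp log_bound * (4 * lip_const) * norm (z - w)"
      by (simp add: norm_mult)
    have 1: "norm ((z - w) * exp ?a) \<le> exp log_bound * norm (z - w)"
      using Re_E_disk_point(1)[of z] by (simp add: norm_mult mult.commute mult_left_mono)
    have "\<Psi> z - \<Psi> w = (z - w) * exp ?a + w * (exp ?a - exp ?b)"
      by (simp add: \<Psi>_def algebra_simps)
    then have "norm (\<Psi> z - \<Psi> w) \<le> exp log_bound * norm (z - w) + exp log_bound * (4 * lip_const) * norm (z - w)"
      using norm_triangle_le[OF add_mono[OF 1 2]] by simp
    then show ?thesis by (simp add: dist_norm algebra_simps)
  qed
qed

end

section \<open>Injectivity of the extension\<close>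

context disk_logarithm
begin

lemma disk_point_halfplane:
  assumes "1 \<le> Re z"
  shows "disk_point z = 2 / z - 1"
  using assms by (simp add: disk_point_def clamp01_simps)

lemma disk_point_ball:
  assumes "1 < Re z"
  shows "2 / z - 1 \<in> ball 0 1"
proof -
  have z: "z \<noteq> 0" using assms by auto
  have "(norm (2 - z))\<^sup>2 < (norm z)\<^sup>2"
    using assms unfolding cmod_power2 by (simp add: power2_eq_square algebra_simps)
  then have "norm (2 - z) < norm z" by (rule power2_less_imp_less) simp
  moreover have "2 / z - 1 = (2 - z) / z" using z by (simp add: field_simps)
  ultimately show ?thesis using z by (simp add: norm_divide)
qed

definition log\<Psi> :: "complex \<Rightarrow> complex" where
  "log\<Psi> z = Ln z + E (2 / z - 1)"

lemma \<Psi>_eq_exp_log\<Psi>: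
  assumes "1 \<le> Re z"
  shows "\<Psi> z = exp (log\<Psi> z)"
proof -
  have "z \<noteq> 0" using assms by auto
  then show ?thesis by (simp add: \<Psi>_def log\<Psi>_def disk_point_halfplane[OF assms] exp_add)
qed

lemma E_has_derivative: "u \<in> ball 0 1 \<Longrightarrow> (E has_field_derivative deriv E u) (at u)"
  using E_hol by (rule holomorphic_derivI) auto

lemma log\<Psi>_cont: "continuous_on {z. 1 \<le> Re z} log\<Psi>"
proof -
  have "continuous_on {z. 1 \<le> Re z} Ln"
    by (intro continuous_on_Ln continuous_on_id) (auto simp: complex_nonpos_Reals_iff)
  moreover have "continuous_on {z. 1 \<le> Re z} (\<lambda>z. E (2 / z - 1))"
  proof (rule continuous_on_compose2[OF E_cont])
    show "continuous_on {z. 1 \<le> Re z} (\<lambda>z. 2 / z - 1)"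
      by (intro continuous_intros) auto
    have "2 / z - 1 \<in> cball 0 1" if "1 \<le> Re z" for z
      using disk_point_mem[of z] disk_point_halfplane[OF that] by simp
    then show "(\<lambda>z. 2 / z - 1) ` {z. 1 \<le> Re z} \<subseteq> cball 0 1" by blast
  qed
  ultimately show ?thesis
    unfolding log\<Psi>_def by (rule continuous_on_add)
qed

text \<open>With \<open>X = b/(1 + u b)\<close> and \<open>\<bar>b\<bar> \<le> k\<close> the derivative of \<^const>\<open>log\<Psi>\<close> becomes \<open>1/W\<close> for
  \<open>W = z - 1 + (1 + b)/(1 - b)\<close>. The last summand lies in the closed hyperbolic disk of radius
  \<open>1/2 log ((1 + k)/(1 - k))\<close> about 1, which gives the lower bound for \<open>Re W\<close>.\<close>
lemma log\<Psi>_derivative: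
  assumes z: "1 < Re z"
  obtains W where "(log\<Psi> has_field_derivative 1 / W) (at z)" "(1 - k) / (1 + k) \<le> Re W" "norm W \<le> norm z + 2 * lip_const"
proof -
  define u where "u = 2 / z - 1"
  define X where "X = deriv E u"
  have z0: "z \<noteq> 0" using z by auto
  have u: "u \<in> ball 0 1" unfolding u_def by (rule disk_point_ball[OF z])
  have zu: "z * u = 2 - z" using z0 by (simp add: u_def field_simps)
  have X: "norm X \<le> k * norm (1 - u * X)" unfolding X_def by (rule E_deriv[OF u])
  have Y0: "1 - u * X \<noteq> 0"
  proof
    assume Y: "1 - u * X = 0"
    then have "X = 0" using X by simp
    with Y show False by simp
  qed
  define b where "b = X / (1 - u * X)"
  have b: "norm b \<le> k" using X Y0 by (simp add: b_def norm_divide divide_le_eq)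
  have b1: "1 - b \<noteq> 0" using b k by auto
  have "b * (1 - u * X) = X" using Y0 by (simp add: b_def)
  then have "X * (1 + u * b) = b" by (simp add: algebra_simps)
  moreover have ub: "1 + u * b \<noteq> 0"
  proof
    assume "1 + u * b = 0"
    then have "norm (u * b) = 1" by (metis add.inverse_unique norm_minus_cancel norm_one)
    moreover have "norm (u * b) \<le> 1 * k" unfolding norm_mult using u b by (intro mult_mono) auto
    ultimately show False using k by simp
  qed
  ultimately have Xb: "X = b / (1 + u * b)" by (simp add: field_simps)
  define W where "W = z + 2 * b / (1 - b)"
  have Wz: "W * (1 - b) = z * (1 + u * b)"
  proof -
    have "W * (1 - b) = z * (1 - b) + 2 * b / (1 - b) * (1 - b)" by (simp only: W_def distrib_right)
    also have "2 * b / (1 - b) * (1 - b) = 2 * b" using b1 by simp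
    finally have "W * (1 - b) = z * (1 - b) + 2 * b" .
    also have "\<dots> = z + (2 - z) * b" by (simp add: algebra_simps)
    also have "\<dots> = z * (1 + u * b)" unfolding zu[symmetric] by (simp add: algebra_simps)
    finally show ?thesis .
  qed
  have W0: "W \<noteq> 0"
  proof
    assume "W = 0"
    then have "z * (1 + u * b) = 0" using Wz by simp
    then show False using z0 ub by simp
  qed
  have "((\<lambda>z. 2 / z - 1) has_field_derivative - (2 / z\<^sup>2)) (at z)"
    using z0 by (auto intro!: derivative_eq_intros simp: power2_eq_square)
  then have "((\<lambda>z. E (2 / z - 1)) has_field_derivative X * (- (2 / z\<^sup>2))) (at z)"
    using E_has_derivative[OF u] unfolding X_def u_def
    by (rule DERIV_chain2[of E _ "\<lambda>z. 2 / z - 1", rotated])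
  moreover have "(Ln has_field_derivative 1 / z) (at z)"
    using z by (intro derivative_eq_intros) (auto simp: complex_nonpos_Reals_iff inverse_eq_divide)
  ultimately have "(log\<Psi> has_field_derivative (1 / z + X * (- (2 / z\<^sup>2)))) (at z)"
    unfolding log\<Psi>_def by (rule DERIV_add[rotated])
  also have "1 / z + X * (- (2 / z\<^sup>2)) = (1 / z) * (1 - (2 / z) * X)"
    by (simp add: algebra_simps power2_eq_square diff_divide_distrib)
  also have "2 / z = 1 + u" by (simp add: u_def)
  also have "1 - (1 + u) * X = (1 - b) / (1 + u * b)"
    unfolding Xb using ub by (simp add: field_simps)
  also have "(1 / z) * ((1 - b) / (1 + u * b)) = (1 - b) / (z * (1 + u * b))"
    by simp
  also have "\<dots> = 1 / W"
    unfolding Wz[symmetric] using b1 by simp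
  finally have 1: "(log\<Psi> has_field_derivative 1 / W) (at z)" .
  have b_far: "1 - k \<le> norm (1 - b)" "norm (1 - b) \<le> 1 + k"
    using norm_triangle_ineq2[of 1 b] norm_triangle_ineq4[of 1 b] b by simp_all
  have "norm (2 * b / (1 - b)) \<le> 2 * k / (1 - k)"
    unfolding norm_divide norm_mult using b b_far k by (intro frac_le mult_mono) auto
  then have 3: "norm W \<le> norm z + 2 * lip_const"
    unfolding W_def lip_const_def using norm_triangle_ineq[of z "2 * b / (1 - b)"] by simp
  have "2 * b / (1 - b) = (1 + b) / (1 - b) - 1" using b1 by (simp add: field_simps)
  then have "Re W = Re z - 1 + Re ((1 + b) / (1 - b))" by (simp add: W_def)
  also have "Re ((1 + b) / (1 - b)) = (1 - (norm b)\<^sup>2) / (norm (1 - b))\<^sup>2"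
    unfolding Re_divide cmod_power2 by (simp add: power2_eq_square algebra_simps)
  finally have ReW: "Re W = Re z - 1 + (1 - (norm b)\<^sup>2) / (norm (1 - b))\<^sup>2" .
  have "(1 - k) / (1 + k) = (1 - k\<^sup>2) / (1 + k)\<^sup>2"
    using k by (simp add: divide_simps) (simp add: power2_eq_square algebra_simps)
  also have "\<dots> \<le> (1 - (norm b)\<^sup>2) / (norm (1 - b))\<^sup>2"
  proof (rule frac_le)
    have "(norm b)\<^sup>2 \<le> k\<^sup>2" using b by (intro power_mono) auto
    then show "1 - k\<^sup>2 \<le> 1 - (norm b)\<^sup>2" by simp
    moreover have "k\<^sup>2 \<le> 1" using k by (intro power_le_one) auto
    ultimately show "0 \<le> 1 - (norm b)\<^sup>2" by simp
    show "0 < (norm (1 - b))\<^sup>2" using b1 by simp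
    show "(norm (1 - b))\<^sup>2 \<le> (1 + k)\<^sup>2" using b_far by (intro power_mono) auto
  qed
  finally have 2: "(1 - k) / (1 + k) \<le> Re W" using ReW z by simp
  show thesis using 1 2 3 by (rule that)
qed

lemma Re_inverse_ge:
  assumes "0 < m" "m \<le> Re W" "norm W \<le> R"
  shows "m / R\<^sup>2 \<le> Re (1 / W)"
proof -
  have W: "W \<noteq> 0" using assms by auto
  have "m / R\<^sup>2 \<le> Re W / (norm W)\<^sup>2"
    using assms W by (intro frac_le power_mono) auto
  also have "\<dots> = Re (1 / W)" by (simp add: Re_divide cmod_power2)
  finally show ?thesis .
qed

text \<open>A quantitative form of the criterion of Noshiro and Warschawski: a lower bound for \<open>Re f'\<close> on a convex set
  makes \<open>f\<close> strictly monotone there. The explicit constant lets the strict inequality survive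
  the passage to the boundary in the next lemma.\<close>
lemma log\<Psi>_monotone_open:
  assumes z: "1 < Re z" "norm z \<le> R" and w: "1 < Re w" "norm w \<le> R"
  shows "(1 - k) / (1 + k) / (R + 2 * lip_const)\<^sup>2 * (norm (z - w))\<^sup>2 \<le> Re ((log\<Psi> z - log\<Psi> w) * cnj (z - w))"
proof -
  define c where "c = (1 - k) / (1 + k) / (R + 2 * lip_const)\<^sup>2"
  define p where "p = (\<lambda>t::real. w + of_real t * (z - w))"
  have mem: "1 < Re (p t)" "norm (p t) \<le> R" if "0 \<le> t" "t \<le> 1" for t
  proof -
    have p: "p t = (1 - t) *\<^sub>R w + t *\<^sub>R z" by (simp add: p_def scaleR_conv_of_real algebra_simps)
    have "p t \<in> {z. Re z > 1} \<inter> cball 0 R"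
      unfolding p using that z w
      by (intro convexD_alt convex_Int convex_halfspace_Re_gt convex_cball) auto
    then show "1 < Re (p t)" "norm (p t) \<le> R" by auto
  qed
  define \<phi> where "\<phi> = (\<lambda>t. Re (log\<Psi> (p t) * cnj (z - w)) - c * (norm (z - w))\<^sup>2 * t)"
  have "\<phi> 0 \<le> \<phi> 1"
  proof (rule DERIV_nonneg_imp_nondecreasing[of 0 1 \<phi>])
    fix t :: real assume t: "0 \<le> t" "t \<le> 1"
    obtain W where W: "(log\<Psi> has_field_derivative 1 / W) (at (p t))" "(1 - k) / (1 + k) \<le> Re W" "norm W \<le> norm (p t) + 2 * lip_const"
      using log\<Psi>_derivative[OF mem(1)[OF t]] by blast
    have c: "c \<le> Re (1 / W)"
      unfolding c_def by (rule Re_inverse_ge) (use k W mem(2)[OF t] in auto)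
    have "(p has_vector_derivative (z - w)) (at t)"
      unfolding p_def by (auto intro!: derivative_eq_intros simp: has_vector_derivative_def scaleR_conv_of_real)
    from field_vector_diff_chain_at[OF this W(1)]
    have "((\<lambda>t. log\<Psi> (p t)) has_vector_derivative (z - w) * (1 / W)) (at t)"
      by (simp add: o_def)
    then have "((\<lambda>t. log\<Psi> (p t) * cnj (z - w)) has_vector_derivative (z - w) * (1 / W) * cnj (z - w)) (at t)"
      by (rule has_vector_derivative_mult_left)
    then have "((\<lambda>t. Re (log\<Psi> (p t) * cnj (z - w))) has_vector_derivative Re ((z - w) * (1 / W) * cnj (z - w))) (at t)"
      by (rule bounded_linear.has_vector_derivative[OF bounded_linear_Re])
    then have "((\<lambda>t. Re (log\<Psi> (p t) * cnj (z - w))) has_real_derivative Re ((z - w) * (1 / W) * cnj (z - w))) (at t)"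
      by (simp only: has_real_derivative_iff_has_vector_derivative)
    moreover have "((\<lambda>t. c * (norm (z - w))\<^sup>2 * t) has_real_derivative c * (norm (z - w))\<^sup>2) (at t)"
      by (auto intro!: derivative_eq_intros)
    ultimately have "(\<phi> has_real_derivative Re ((z - w) * (1 / W) * cnj (z - w)) - c * (norm (z - w))\<^sup>2) (at t)"
      unfolding \<phi>_def by (rule DERIV_diff)
    moreover have "(z - w) * (1 / W) * cnj (z - w) = of_real ((norm (z - w))\<^sup>2) * (1 / W)"
      using complex_norm_square[of "z - w"] by (simp add: mult_ac)
    then have "Re ((z - w) * (1 / W) * cnj (z - w)) = (norm (z - w))\<^sup>2 * Re (1 / W)"
      by (simp only: Re_complex_of_real Im_complex_of_real times_complex.sel)
    moreover have "0 \<le> (norm (z - w))\<^sup>2 * Re (1 / W) - c * (norm (z - w))\<^sup>2"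
      using mult_left_mono[OF c, of "(norm (z - w))\<^sup>2"] by (simp add: mult.commute)
    ultimately show "\<exists>y. (\<phi> has_real_derivative y) (at t) \<and> 0 \<le> y" by auto
  qed simp
  then show ?thesis by (simp add: \<phi>_def p_def c_def left_diff_distrib)
qed

text \<open>Shifting both points by the same small amount into the open half plane does not change their
  difference.\<close>
lemma log\<Psi>_monotone:
  assumes z: "1 \<le> Re z" and w: "1 \<le> Re w" and ne: "z \<noteq> w"
  shows "0 < Re ((log\<Psi> z - log\<Psi> w) * cnj (z - w))"
proof -
  define R where "R = norm z + norm w + 1"
  define c where "c = (1 - k) / (1 + k) / (R + 2 * lip_const)\<^sup>2"
  define e where "e = (\<lambda>n. complex_of_real (inverse (real (Suc n))))"
  have R: "0 < R" by (simp add: R_def add_nonneg_pos)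
  have c: "0 < c" using k R lip_const_nonneg by (simp add: c_def)
  have e0: "e \<longlonglongrightarrow> 0"
    using tendsto_of_real[OF LIMSEQ_inverse_real_of_nat, where ?'a = complex] by (simp add: e_def)
  have Re_e: "0 < Re (e n)" for n by (simp add: e_def)
  have norm_e: "norm (e n) \<le> 1" for n   proof -
    have "norm (e n) = inverse (real (Suc n))" by (simp add: e_def norm_inverse del: of_nat_Suc)
    also have "\<dots> \<le> 1" by (simp add: field_simps)
    finally show ?thesis .
  qed
  have step: "c * (norm (z - w))\<^sup>2 \<le> Re ((log\<Psi> (z + e n) - log\<Psi> (w + e n)) * cnj (z - w))" for n
  proof -
    have "norm (z + e n) \<le> R" "norm (w + e n) \<le> R"
      using norm_triangle_ineq[of z "e n"] norm_triangle_ineq[of w "e n"] norm_e[of n]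
      by (simp_all add: R_def add_increasing add_increasing2 order_trans)
    moreover have "1 < Re (z + e n)" "1 < Re (w + e n)" using z w Re_e[of n] by auto
    ultimately show ?thesis
      using log\<Psi>_monotone_open[of "z + e n" R "w + e n"] by (simp add: c_def)
  qed
  have lim: "(\<lambda>n. log\<Psi> (x + e n)) \<longlonglongrightarrow> log\<Psi> x" if x: "1 \<le> Re x" for x
  proof (rule continuous_on_tendsto_compose[OF log\<Psi>_cont])
    show "(\<lambda>n. x + e n) \<longlonglongrightarrow> x" using tendsto_add[OF tendsto_const e0, of x] by simp
    show "\<forall>\<^sub>F n in sequentially. x + e n \<in> {z. 1 \<le> Re z}"
      using x Re_e by (intro always_eventually) (auto simp: less_imp_le add_increasing2)
  qed (use x in auto)
  have "c * (norm (z - w))\<^sup>2 \<le> Re ((log\<Psi> z - log\<Psi> w) * cnj (z - w))"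
  proof (rule LIMSEQ_le_const)
    show "(\<lambda>n. Re ((log\<Psi> (z + e n) - log\<Psi> (w + e n)) * cnj (z - w))) \<longlonglongrightarrow> Re ((log\<Psi> z - log\<Psi> w) * cnj (z - w))"
      by (intro tendsto_intros lim z w)
  qed (use step in auto)
  moreover have "0 < c * (norm (z - w))\<^sup>2" using c ne by simp
  ultimately show ?thesis by linarith
qed

end

context disk_logarithm
begin

lemma Im_log\<Psi>_strict_mono:
  assumes "1 \<le> x" "y < y'"
  shows "Im (log\<Psi> (Complex x y)) < Im (log\<Psi> (Complex x y'))"
proof -
  have "0 < Re ((log\<Psi> (Complex x y') - log\<Psi> (Complex x y)) * cnj (Complex x y' - Complex x y))"
    by (rule log\<Psi>_monotone) (use assms in auto)
  then have "0 < (Im (log\<Psi> (Complex x y')) - Im (log\<Psi> (Complex x y))) * (y' - y)"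
    by (simp add: algebra_simps)
  then show ?thesis using assms by (simp add: zero_less_mult_iff)
qed

lemma E_disk_point_vertical_limit:
  assumes x: "1 \<le> x" and s: "s = 1 \<or> s = - (1::real)"
  shows "(\<lambda>n. E (2 / Complex x (y + s * real n) - 1)) \<longlonglongrightarrow> E (- 1)"
proof (rule continuous_on_tendsto_compose[OF E_cont])
  let ?z = "\<lambda>n. Complex x (y + s * real n)"
  have "filterlim ?z at_infinity sequentially"
  proof (rule filterlim_norm_at_top_imp_at_infinity, rule filterlim_at_top_mono)
    show "filterlim (\<lambda>n. - \<bar>y\<bar> + real n) at_top sequentially"
      by (rule filterlim_tendsto_add_at_top[OF tendsto_const filterlim_real_sequentially])
    have "- \<bar>y\<bar> + real n \<le> norm (?z n)" for n
      using abs_Im_le_cmod[of "?z n"] s by auto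
    then show "\<forall>\<^sub>F n in sequentially. - \<bar>y\<bar> + real n \<le> norm (?z n)"
      by (rule always_eventually[OF allI])
  qed
  then have "(\<lambda>n. 2 / ?z n) \<longlonglongrightarrow> 0" by (rule tendsto_divide_0[OF tendsto_const])
  then show "(\<lambda>n. 2 / ?z n - 1) \<longlonglongrightarrow> - 1"
    using tendsto_diff[OF _ tendsto_const, of "\<lambda>n. 2 / ?z n" 0 sequentially 1] by simp
  have "2 / ?z n - 1 \<in> cball 0 1" for n
    using disk_point_mem[of "?z n"] disk_point_halfplane[of "?z n"] x by simp
  then show "\<forall>\<^sub>F n in sequentially. 2 / ?z n - 1 \<in> cball 0 1"
    by (rule always_eventually[OF allI])
qed simp

lemma Im_Ln_halfplane: "0 < Re z \<Longrightarrow> - (pi / 2) < Im (Ln z) \<and> Im (Ln z) < pi / 2"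
  using Re_Ln_pos_lt[of z] by fastforce

text \<open>By monotonicity the imaginary part increases along every vertical line, and far away on that line it
  differs from \<open>arg z + Im E(-1)\<close> by an arbitrarily small amount.\<close>
lemma Im_log\<Psi>_bound:
  assumes "1 \<le> Re z"
  shows "\<bar>Im (log\<Psi> z) - Im (E (- 1))\<bar> < pi / 2"
proof -
  define x y where "x = Re z" and "y = Im z"
  have x: "1 \<le> x" and z: "z = Complex x y" using assms by (simp_all add: x_def y_def)
  have log\<Psi>: "Im (log\<Psi> (Complex x t)) = Im (Ln (Complex x t)) + Im (E (2 / Complex x t - 1))" for t
    by (simp add: log\<Psi>_def)
  have up: "Im (log\<Psi> (Complex x (y + 1))) \<le> pi / 2 + Im (E (- 1))"
  proof (rule LIMSEQ_le_const)
    let ?w = "\<lambda>n. Complex x (y + 1 + 1 * real n)"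
    show "(\<lambda>n. pi / 2 + Im (E (2 / ?w n - 1))) \<longlonglongrightarrow> pi / 2 + Im (E (- 1))"
      by (intro tendsto_intros E_disk_point_vertical_limit x) simp
    have "Im (log\<Psi> (Complex x (y + 1))) \<le> pi / 2 + Im (E (2 / ?w n - 1))" for n
    proof -
      have "Im (log\<Psi> (Complex x (y + 1))) \<le> Im (log\<Psi> (?w n))"
        using Im_log\<Psi>_strict_mono[OF x, of "y + 1" "y + 1 + 1 * real n"] by (cases "n = 0") auto
      also have "\<dots> \<le> pi / 2 + Im (E (2 / ?w n - 1))"
        unfolding log\<Psi> using Im_Ln_halfplane[of "?w n"] x by simp
      finally show ?thesis .
    qed
    then show "\<exists>N. \<forall>n\<ge>N. Im (log\<Psi> (Complex x (y + 1))) \<le> pi / 2 + Im (E (2 / ?w n - 1))" by blast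
  qed
  have low: "- (pi / 2) + Im (E (- 1)) \<le> Im (log\<Psi> (Complex x (y - 1)))"
  proof (rule LIMSEQ_le_const2)
    let ?w = "\<lambda>n. Complex x (y - 1 + (- 1) * real n)"
    show "(\<lambda>n. - (pi / 2) + Im (E (2 / ?w n - 1))) \<longlonglongrightarrow> - (pi / 2) + Im (E (- 1))"
      by (intro tendsto_intros E_disk_point_vertical_limit x) simp
    have "- (pi / 2) + Im (E (2 / ?w n - 1)) \<le> Im (log\<Psi> (Complex x (y - 1)))" for n
    proof -
      have "- (pi / 2) + Im (E (2 / ?w n - 1)) \<le> Im (log\<Psi> (?w n))"
        unfolding log\<Psi> using Im_Ln_halfplane[of "?w n"] x by simp
      also have "\<dots> \<le> Im (log\<Psi> (Complex x (y - 1)))"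
        using Im_log\<Psi>_strict_mono[OF x, of "y - 1 + (- 1) * real n" "y - 1"] by (cases "n = 0") auto
      finally show ?thesis .
    qed
    then show "\<exists>N. \<forall>n\<ge>N. - (pi / 2) + Im (E (2 / ?w n - 1)) \<le> Im (log\<Psi> (Complex x (y - 1)))" by blast
  qed
  have "Im (log\<Psi> (Complex x (y - 1))) < Im (log\<Psi> z)" "Im (log\<Psi> z) < Im (log\<Psi> (Complex x (y + 1)))"
    unfolding z by (rule Im_log\<Psi>_strict_mono[OF x]; simp)+
  with up low show ?thesis by linarith
qed

text \<open>On the segment of the ray from \<open>0\<close> through \<open>z\<close> that lies in the strip, \<open>\<Psi>\<close> is homogeneous; \<^term>\<open>foot z\<close> is
  the point at which this segment ends, and \<open>z\<close> itself if \<open>Re z \<ge> 1\<close>.\<close>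
definition foot :: "complex \<Rightarrow> complex" where
  "foot z = z / of_real (clamp01 (Re z))"

lemma foot:
  assumes "0 < Re z"
  shows "1 \<le> Re (foot z)" "clamp01 (Re z) < 1 \<Longrightarrow> Re (foot z) = 1"
    "z = of_real (clamp01 (Re z)) * foot z" "\<Psi> z = of_real (clamp01 (Re z)) * exp (log\<Psi> (foot z))"
proof -
  let ?t = "clamp01 (Re z)"
  have t: "0 < ?t" using assms by (simp add: clamp01_simps)
  have Re_foot: "Re (foot z) = Re z / ?t" by (simp add: foot_def Re_divide_of_real)
  show ge: "1 \<le> Re (foot z)"
    unfolding Re_foot using t clamp01_simps(6)[of "Re z"] assms by simp
  show "Re (foot z) = 1" if "?t < 1"
  proof -
    have "Re z < 1" using that clamp01_simps(3)[of "Re z"] by fastforce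
    then show ?thesis unfolding Re_foot using assms by (simp add: clamp01_simps)
  qed
  show eq: "z = of_real ?t * foot z" using t by (simp add: foot_def)
  have "foot z \<noteq> 0" using ge by auto
  have "disk_point z = disk_point (foot z)"
    unfolding disk_point_halfplane[OF ge] using t by (simp add: disk_point_def foot_def)
  then have "\<Psi> z = of_real ?t * \<Psi> (foot z)"
    unfolding \<Psi>_def by (subst eq) simp
  then show "\<Psi> z = of_real ?t * exp (log\<Psi> (foot z))" by (simp only: \<Psi>_eq_exp_log\<Psi>[OF ge])
qed

lemma \<Psi>_left: "Re z \<le> 0 \<Longrightarrow> \<Psi> z = z * exp (E (- 1))"
  by (simp add: \<Psi>_def disk_point_def clamp01_simps)

lemma \<Psi>_right_image:
  assumes "0 < Re z"
  shows "0 < Re (\<Psi> z * exp (- E (- 1)))"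
proof -
  let ?t = "clamp01 (Re z)" and ?w = "log\<Psi> (foot z) - E (- 1)"
  have "\<Psi> z * exp (- E (- 1)) = of_real ?t * exp ?w"
    by (simp add: foot(4)[OF assms] exp_diff exp_minus divide_inverse)
  then have "Re (\<Psi> z * exp (- E (- 1))) = ?t * (exp (Re ?w) * cos (Im ?w))"
    by (simp add: Re_exp)
  moreover have "0 < cos (Im ?w)"
    using Im_log\<Psi>_bound[OF foot(1)[OF assms]] unfolding minus_complex.sel abs_less_iff
    by (intro cos_gt_zero_pi) linarith+
  moreover have "0 < ?t" using assms by (simp add: clamp01_simps)
  ultimately show ?thesis by simp
qed

text \<open>Equal values give \<open>log\<Psi>(foot z) - log\<Psi>(foot w) = log t - log s\<close> for the truncated real parts \<open>s\<close> and \<open>t\<close>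
  of \<open>z\<close> and \<open>w\<close>; a multiple of \<open>2 \<pi> i\<close> is excluded by the bound for the imaginary part. By monotonicity
  the foot with the larger value of \<^const>\<open>log\<Psi>\<close> has the larger real part, which exceeds 1,
  so its truncated real part is 1. This contradicts the sign of \<open>log t - log s\<close>.\<close>
lemma \<Psi>_inj_right:
  assumes z: "0 < Re z" and w: "0 < Re w" and eq: "\<Psi> z = \<Psi> w"
  shows "z = w"
proof -
  define s t where "s = clamp01 (Re z)" and "t = clamp01 (Re w)"
  have st: "0 < s" "s \<le> 1" "0 < t" "t \<le> 1" using z w by (simp_all add: s_def t_def clamp01_simps)
  note fz = foot[OF z, folded s_def] and fw = foot[OF w, folded t_def]
  define r where "r = ln t - ln s"
  let ?d = "log\<Psi> (foot z) - log\<Psi> (foot w)"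
  have "exp (log\<Psi> (foot z)) = of_real (t / s) * exp (log\<Psi> (foot w))"
    using eq fz(4) fw(4) st by (simp add: field_simps)
  also have "of_real (t / s) = exp (of_real r :: complex)"
    using st by (simp add: r_def exp_diff exp_of_real)
  finally have "exp (?d - of_real r) = 1" by (simp add: exp_diff)
  then obtain n :: int where Re0: "Re (?d - of_real r) = 0" and n: "Im (?d - of_real r) = of_int (2 * n) * pi"
    unfolding exp_eq_1 by blast
  have "\<bar>Im ?d\<bar> < pi"
    using Im_log\<Psi>_bound[OF fz(1)] Im_log\<Psi>_bound[OF fw(1)] unfolding minus_complex.sel abs_less_iff by linarith
  then have "\<bar>of_int (2 * n) * pi\<bar> < 1 * pi" using n by simp
  then have "\<bar>real_of_int (2 * n)\<bar> < 1" unfolding abs_mult by (simp add: mult_less_cancel_right)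
  then have "n = 0" by linarith
  then have d: "?d = of_real r" using Re0 n by (simp add: complex_eq_iff)
  have "foot z = foot w"
  proof (rule ccontr)
    assume ne: "foot z \<noteq> foot w"
    have "0 < r * (Re (foot z) - Re (foot w))"
      using log\<Psi>_monotone[OF fz(1) fw(1) ne] unfolding d by simp
    then consider "0 < r" "Re (foot w) < Re (foot z)" | "r < 0" "Re (foot z) < Re (foot w)"
      by (auto simp: zero_less_mult_iff)
    then show False
    proof cases
      case 1
      then have "s = 1" using fz(2) fw(1) st by force
      then have "r \<le> 0" using st by (simp add: r_def)
      then show False using 1 by simp
    next
      case 2
      then have "t = 1" using fw(2) fz(1) st by force
      then have "0 \<le> r" using st by (simp add: r_def)
      then show False using 2 by simp
    qed
  qed
  moreover from this d have "r = 0" by simp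
  then have "s = t" using st by (simp add: r_def)
  ultimately show ?thesis using fz(3) fw(3) by metis
qed

lemma inj_\<Psi>: "inj \<Psi>"
proof (rule injI)
  have side: "0 < Re z \<longleftrightarrow> 0 < Re (\<Psi> z * exp (- E (- 1)))" for z
  proof (cases "0 < Re z")
    case False
    then have "\<Psi> z * exp (- E (- 1)) = z" by (simp add: \<Psi>_left exp_minus)
    then show ?thesis by simp
  qed (use \<Psi>_right_image in blast)
  fix z w assume eq: "\<Psi> z = \<Psi> w"
  then have "0 < Re z \<longleftrightarrow> 0 < Re w" using side[of z] side[of w] by simp
  then show "z = w"
    using \<Psi>_inj_right[of z w] eq by (cases "0 < Re z") (auto simp: \<Psi>_left)
qed

end

section \<open>The dilatation of the extension\<close>

lemma dilatation_at_conformal: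
  assumes "(f has_field_derivative d) (at z)" "0 \<le> k"
  shows "dilatation_at k f z"
  unfolding dilatation_at_def
  using assms by (intro exI[of _ d] exI[of _ 0]) (simp add: has_field_derivative_def)

lemma norm_vector_derivative_le:
  fixes f :: "real \<Rightarrow> complex"
  assumes f: "(f has_vector_derivative d) (at x)"
    and bound: "\<forall>\<^sub>F y in at x. norm (f y - f x) \<le> L * \<bar>y - x\<bar>"
  shows "norm d \<le> L"
proof -
  obtain e where e: "e > 0" "\<And>y. y \<noteq> x \<Longrightarrow> \<bar>y - x\<bar> < e \<Longrightarrow> norm (f y - f x) \<le> L * \<bar>y - x\<bar>"
    using bound by (auto simp: eventually_at dist_real_def)
  let ?t = "\<lambda>n. - inverse (real (Suc n))"
  have "(\<lambda>n. (f (x + ?t n *\<^sub>R 1) - f x) /\<^sub>R ?t n) \<longlonglongrightarrow> 1 *\<^sub>R d"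
    by (rule directional_quotient_tendsto[OF f[unfolded has_vector_derivative_def] inverse_Suc_tendsto]) simp
  moreover have "(\<lambda>n. \<bar>?t n\<bar>) \<longlonglongrightarrow> \<bar>0\<bar>"
    by (intro tendsto_intros inverse_Suc_tendsto)
  then have "\<forall>\<^sub>F n in sequentially. \<bar>?t n\<bar> < e"
    using e(1) by (auto dest: order_tendstoD)
  then have "\<forall>\<^sub>F n in sequentially. norm ((f (x + ?t n *\<^sub>R 1) - f x) /\<^sub>R ?t n) \<le> L"
  proof eventually_elim
    case (elim n)
    have t0: "?t n \<noteq> 0" by simp
    have *: "norm (w /\<^sub>R t) \<le> L" if "norm w \<le> L * \<bar>t\<bar>" "t \<noteq> 0" for w :: complex and t
      using that by (simp add: field_simps)
    have "norm (f (x + t) - f x) \<le> L * \<bar>t\<bar>" if "\<bar>t\<bar> < e" "t \<noteq> 0" for t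
      using e(2)[of "x + t"] that by simp
    from this[OF elim t0] show ?case by (intro *) (simp_all del: of_nat_Suc)
  qed
  ultimately show ?thesis by (intro Lim_norm_ubound) auto
qed

lemma cis_lipschitz: "norm (exp (- 2 * \<i> * of_real x) - exp (- 2 * \<i> * of_real y)) \<le> 2 * \<bar>x - y\<bar>"
proof -
  have "norm (exp (- 2 * \<i> * of_real x) - exp (- 2 * \<i> * of_real y))
      \<le> exp 0 * norm (- 2 * \<i> * of_real x - - 2 * \<i> * of_real y)"
    by (rule exp_lipschitz_bound) auto
  also have "- 2 * \<i> * of_real x - - 2 * \<i> * of_real y = - 2 * \<i> * of_real (x - y)"
    by (simp add: algebra_simps)
  also have "norm \<dots> = 2 * \<bar>x - y\<bar>" by (simp add: norm_mult del: of_real_diff)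
  finally show ?thesis by simp
qed

context disk_logarithm
begin

lemma \<Psi>_holomorphic: "\<Psi> holomorphic_on {z. 1 < Re z}"
proof (rule holomorphic_transform)
  have "(\<lambda>z. 2 / z - 1) holomorphic_on {z. 1 < Re z}"
    by (intro holomorphic_intros) auto
  moreover have "(\<lambda>z. 2 / z - 1) ` {z. 1 < Re z} \<subseteq> ball 0 1"
    using disk_point_ball by blast
  ultimately have "(E \<circ> (\<lambda>z. 2 / z - 1)) holomorphic_on {z. 1 < Re z}"
    by (rule holomorphic_on_compose_gen[OF _ E_hol])
  then show "(\<lambda>z. z * exp (E (2 / z - 1))) holomorphic_on {z. 1 < Re z}"
    unfolding o_def by (intro holomorphic_intros)
qed (simp add: \<Psi>_def disk_point_halfplane)

lemma dilatation_right:
  assumes "1 < Re z"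
  shows "dilatation_at k \<Psi> z"
  using holomorphic_derivI[OF \<Psi>_holomorphic open_halfspace_Re_gt] assms k(1)
  by (intro dilatation_at_conformal) auto

lemma dilatation_left:
  assumes "Re z < 0"
  shows "dilatation_at k \<Psi> z"
proof (rule dilatation_at_transform)
  show "dilatation_at k (\<lambda>z. z * exp (E (- 1))) z"
    by (rule dilatation_at_conformal[OF _ k(1)]) (auto intro!: derivative_eq_intros)
  show "open {z. Re z < 0}" by (rule open_halfspace_Re_lt)
qed (use assms in \<open>auto simp: \<Psi>_left\<close>)

text \<open>The boundary values of \<open>E\<close>, parametrised by the argument \<open>t\<close> of the points \<open>z\<close> of the strip that are sent
  to \<open>u = cnj z/z = exp (- 2 i t)\<close>.\<close>
definition boundary_log :: "real \<Rightarrow> complex" where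
  "boundary_log t = E (exp (- 2 * \<i> * of_real t))"

lemma boundary_log_lipschitz: "(2 * lip_const)-lipschitz_on UNIV boundary_log"
proof (rule lipschitz_onI)
  fix x y :: real
  have "norm (boundary_log x - boundary_log y)
      \<le> lip_const * norm (exp (- 2 * \<i> * of_real x) - exp (- 2 * \<i> * of_real y))"
    unfolding boundary_log_def by (rule E_lipschitz) auto
  also have "\<dots> \<le> lip_const * (2 * \<bar>x - y\<bar>)"
    by (intro mult_left_mono cis_lipschitz lip_const_nonneg)
  finally show "dist (boundary_log x) (boundary_log y) \<le> 2 * lip_const * dist x y"
    by (simp add: dist_norm)
qed (use lip_const_nonneg in simp)

lemma deriv_E_bound:
  assumes "u \<in> ball 0 1"
  shows "norm (deriv E u) \<le> lip_const"
  unfolding lip_const_def using assms E_deriv[OF assms] k by (intro disk_condition_bound[of k u]) auto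

text \<open>Near a boundary point \<open>u\<close> the values of \<open>E'\<close> lie in an arbitrarily small enlargement of the disk from
  \<open>boundary_disk_identity\<close>. Subtracting the linear function given by its centre turns this into a Lipschitz
  estimate on a convex set, which extends to the closure.\<close>
lemma boundary_increment:
  assumes u: "norm u = 1" and \<eta>: "0 < \<eta>"
  defines "c \<equiv> - of_real (k\<^sup>2 / (1 - k\<^sup>2)) * cnj u"
  shows "\<forall>\<^sub>F w in at u within cball 0 1.
      norm ((E w - c * w) - (E u - c * u)) \<le> sqrt ((k / (1 - k\<^sup>2))\<^sup>2 + \<eta>) * norm (w - u)"
proof -
  have k2: "k\<^sup>2 < 1" using k by (simp add: power_less_one_iff abs_square_less_1)
  define \<rho> where "\<rho> = sqrt ((k / (1 - k\<^sup>2))\<^sup>2 + \<eta>)"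
  have "continuous (at 0) (\<lambda>s. 2 * (1 + lip_const) * (lip_const * s) + (lip_const * s)\<^sup>2)"
    by (intro continuous_intros)
  then have "((\<lambda>s. 2 * (1 + lip_const) * (lip_const * s) + (lip_const * s)\<^sup>2) \<longlongrightarrow> 0) (at 0)"
    by (simp add: isCont_def)
  moreover have "0 < (1 - k\<^sup>2) * \<eta>" using k2 \<eta> by simp
  ultimately have "\<forall>\<^sub>F s in at 0. 2 * (1 + lip_const) * (lip_const * s) + (lip_const * s)\<^sup>2 < (1 - k\<^sup>2) * \<eta>"
    by (rule order_tendstoD)
  then obtain d where d: "d > 0" "\<And>s. s \<noteq> 0 \<Longrightarrow> \<bar>s\<bar> < d \<Longrightarrow> 2 * (1 + lip_const) * (lip_const * s) + (lip_const * s)\<^sup>2 < (1 - k\<^sup>2) * \<eta>"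
    by (auto simp: eventually_at dist_real_def)
  define A where "A = ball u d \<inter> ball 0 1"
  have deriv_bound: "norm (deriv E w - c) \<le> \<rho>" if w: "w \<in> A" for w
  proof -
    let ?X = "deriv E w"
    let ?s = "norm (w - u)"
    have w1: "w \<in> ball 0 1" and s: "?s < d" "?s \<noteq> 0"
      using w u by (auto simp: A_def dist_norm norm_minus_commute)
    have X: "norm ?X \<le> lip_const" by (rule deriv_E_bound[OF w1])
    have "1 - w * ?X = (1 - u * ?X) - (w - u) * ?X" by (simp add: algebra_simps)
    then have "norm (1 - w * ?X) \<le> norm (1 - u * ?X) + ?s * norm ?X"
      using norm_triangle_ineq4[of "1 - u * ?X" "(w - u) * ?X"] by (simp only: norm_mult)
    also have "\<dots> \<le> norm (1 - u * ?X) + lip_const * ?s"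
      using X by (simp add: mult.commute mult_right_mono)
    finally have "k * norm (1 - w * ?X) \<le> k * norm (1 - u * ?X) + k * (lip_const * ?s)"
      using k by (simp add: distrib_left[symmetric] mult_left_mono)
    also have "k * (lip_const * ?s) \<le> 1 * (lip_const * ?s)"
      using k lip_const_nonneg by (intro mult_right_mono) auto
    finally have le: "norm ?X \<le> k * norm (1 - u * ?X) + lip_const * ?s" using E_deriv[OF w1] by simp
    have "norm (1 - u * ?X) \<le> 1 + lip_const"
      using norm_triangle_ineq4[of 1 "u * ?X"] X u by (simp add: norm_mult)
    then have "k * norm (1 - u * ?X) \<le> 1 * (1 + lip_const)"
      using k lip_const_nonneg by (intro mult_mono) auto
    then have cross: "k * norm (1 - u * ?X) * (lip_const * ?s) \<le> (1 + lip_const) * (lip_const * ?s)"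
      using lip_const_nonneg by (intro mult_right_mono) auto
    have "(norm ?X)\<^sup>2 \<le> (k * norm (1 - u * ?X) + lip_const * ?s)\<^sup>2"
      using le by (intro power_mono) auto
    also have "\<dots> = k\<^sup>2 * (norm (1 - u * ?X))\<^sup>2 + 2 * (k * norm (1 - u * ?X) * (lip_const * ?s)) + (lip_const * ?s)\<^sup>2"
      by (simp add: power2_eq_square algebra_simps)
    also have "\<dots> \<le> k\<^sup>2 * (norm (1 - u * ?X))\<^sup>2 + 2 * (1 + lip_const) * (lip_const * ?s) + (lip_const * ?s)\<^sup>2"
    proof -
      have "2 * (k * norm (1 - u * ?X) * (lip_const * ?s)) \<le> 2 * ((1 + lip_const) * (lip_const * ?s))"
        using cross by (rule mult_left_mono) simp
      then show ?thesis by (intro add_mono order_refl) (simp only: mult.assoc)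
    qed
    also have "\<dots> < k\<^sup>2 * (norm (1 - u * ?X))\<^sup>2 + (1 - k\<^sup>2) * \<eta>"
      using d(2)[of ?s] s by simp
    finally have "(1 - k\<^sup>2) * ((norm (?X - c))\<^sup>2 - (k / (1 - k\<^sup>2))\<^sup>2) < (1 - k\<^sup>2) * \<eta>"
      using boundary_disk_identity[OF u k2, of ?X] by (simp add: c_def)
    then have "(norm (?X - c))\<^sup>2 - (k / (1 - k\<^sup>2))\<^sup>2 < \<eta>"
      using k2 by (simp add: mult_less_cancel_left)
    then show ?thesis unfolding \<rho>_def by (intro real_le_rsqrt) simp
  qed
  have \<rho>0: "0 \<le> \<rho>" using \<eta> by (simp add: \<rho>_def)
  have "\<rho>-lipschitz_on A (\<lambda>w. E w - c * w)"
  proof (rule lipschitz_onI[OF _ \<rho>0])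
    fix x y assume xy: "x \<in> A" "y \<in> A"
    have "norm ((E x - c * x) - (E y - c * y)) \<le> \<rho> * norm (x - y)"
    proof (rule field_differentiable_bound[of A _ "\<lambda>w. deriv E w - c"])
      show "convex A" unfolding A_def by (intro convex_Int convex_ball)
      show "((\<lambda>w. E w - c * w) has_field_derivative deriv E w - c) (at w within A)" if "w \<in> A" for w
      proof -
        have "(E has_field_derivative deriv E w) (at w)"
          using that by (intro E_has_derivative) (simp add: A_def)
        moreover have "((\<lambda>w. c * w) has_field_derivative c) (at w)"
          by (auto intro!: derivative_eq_intros)
        ultimately have "((\<lambda>w. E w - c * w) has_field_derivative deriv E w - c) (at w)"
          by (rule DERIV_diff)
        then show ?thesis by (rule has_field_derivative_at_within)
      qed
    qed (use deriv_bound xy in auto)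
    then show "dist (E x - c * x) (E y - c * y) \<le> \<rho> * dist x y" by (simp add: dist_norm)
  qed
  moreover have "closure A \<subseteq> cball 0 1"
    by (rule closure_minimal) (auto simp: A_def)
  then have "continuous_on (closure A) (\<lambda>w. E w - c * w)"
    by (intro continuous_intros continuous_on_subset[OF E_cont])
  ultimately have lip: "\<rho>-lipschitz_on (closure A) (\<lambda>w. E w - c * w)"
    by (rule lipschitz_on_closure)
  have cl: "w \<in> closure A" if "w \<in> cball 0 1" "dist w u < d" for w
  proof -
    have "ball u d \<inter> closure (ball 0 1) \<subseteq> closure (ball u d \<inter> ball 0 1)"
      by (rule open_Int_closure_subset) simp
    then show ?thesis using that by (auto simp: A_def dist_commute)
  qed
  have "norm ((E w - c * w) - (E u - c * u)) \<le> \<rho> * norm (w - u)" if "w \<in> cball 0 1" "dist w u < d" for w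
  proof -
    have "w \<in> closure A" "u \<in> closure A" using that cl u d by auto
    then show ?thesis using lipschitz_onD[OF lip] by (simp add: dist_norm)
  qed
  then show ?thesis
    unfolding \<rho>_def[symmetric] eventually_at using d(1) by blast
qed

text \<open>At a point of differentiability the tangential derivative \<open>X\<close> of \<open>E\<close> satisfies the same inequality as
  \<open>E'\<close> inside: the radii in \<open>boundary_increment\<close> bound \<open>\<bar>X - c\<bar>\<close>, and \<open>\<eta>\<close> is arbitrary.\<close>
lemma boundary_log_derivative:
  assumes d: "(boundary_log has_vector_derivative d) (at t)"
  defines "u \<equiv> exp (- 2 * \<i> * of_real t)"
  obtains X where "d = - 2 * \<i> * u * X" "norm X \<le> k * norm (1 - u * X)"
proof -
  define X where "X = d / (- 2 * \<i> * u)"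
  define c where "c = - of_real (k\<^sup>2 / (1 - k\<^sup>2)) * cnj u"
  have u: "norm u = 1" by (simp add: u_def)
  have k2: "k\<^sup>2 < 1" using k by (simp add: power_less_one_iff abs_square_less_1)
  have dX: "d = - 2 * \<i> * u * X" using u by (auto simp: X_def u_def)
  let ?e = "\<lambda>s::real. exp (- 2 * \<i> * of_real s)"
  have e: "(?e has_vector_derivative - 2 * \<i> * u) (at t)"
    unfolding u_def by (auto intro!: derivative_eq_intros has_vector_derivative_real_field)
  have "((\<lambda>s. boundary_log s - c * ?e s) has_vector_derivative (d - c * (- 2 * \<i> * u))) (at t)"
    by (intro has_vector_derivative_diff d has_vector_derivative_mult_right e)
  also have "d - c * (- 2 * \<i> * u) = - 2 * \<i> * u * (X - c)"
    by (simp add: dX algebra_simps)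
  finally have der: "((\<lambda>s. boundary_log s - c * ?e s) has_vector_derivative - 2 * \<i> * u * (X - c)) (at t)" .
  have "(norm (X - c))\<^sup>2 \<le> (k / (1 - k\<^sup>2))\<^sup>2 + \<eta>" if \<eta>: "0 < \<eta>" for \<eta>
  proof -
    define \<rho> where "\<rho> = sqrt ((k / (1 - k\<^sup>2))\<^sup>2 + \<eta>)"
    have "0 \<le> (k / (1 - k\<^sup>2))\<^sup>2 + \<eta>" using \<eta> by simp
    then have \<rho>: "0 \<le> \<rho>" "\<rho>\<^sup>2 = (k / (1 - k\<^sup>2))\<^sup>2 + \<eta>"
      unfolding \<rho>_def by (auto simp del: real_sqrt_pow2_iff)
    obtain \<delta> where \<delta>: "\<delta> > 0" "\<And>w. w \<in> cball 0 1 \<Longrightarrow> w \<noteq> u \<Longrightarrow> dist w u < \<delta> \<Longrightarrow>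
        norm ((E w - c * w) - (E u - c * u)) \<le> \<rho> * norm (w - u)"
      using boundary_increment[OF u \<eta>] unfolding eventually_at c_def \<rho>_def by blast
    have "norm (- 2 * \<i> * u * (X - c)) \<le> \<rho> * 2"
    proof (rule norm_vector_derivative_le[OF der])
      have "norm ((boundary_log s - c * ?e s) - (boundary_log t - c * ?e t)) \<le> \<rho> * 2 * \<bar>s - t\<bar>"
        if s: "\<bar>s - t\<bar> < \<delta> / 2" for s
      proof -
        have close: "norm (?e s - u) \<le> 2 * \<bar>s - t\<bar>" unfolding u_def by (rule cis_lipschitz)
        have "norm ((E (?e s) - c * ?e s) - (E u - c * u)) \<le> \<rho> * norm (?e s - u)"
        proof (cases "?e s = u")
          case False
          then show ?thesis using close s by (intro \<delta>(2)) (auto simp: dist_norm)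
        qed simp
        also have "\<dots> \<le> \<rho> * (2 * \<bar>s - t\<bar>)" using close \<rho>(1) by (rule mult_left_mono)
        finally show ?thesis by (simp add: boundary_log_def u_def)
      qed
      then show "\<forall>\<^sub>F s in at t. norm ((boundary_log s - c * ?e s) - (boundary_log t - c * ?e t)) \<le> \<rho> * 2 * \<bar>s - t\<bar>"
        unfolding eventually_at dist_real_def using \<delta>(1) by (intro exI[of _ "\<delta> / 2"]) auto
    qed
    then have "norm (X - c) \<le> \<rho>" using u by (simp add: norm_mult)
    then have "(norm (X - c))\<^sup>2 \<le> \<rho>\<^sup>2" by (intro power_mono) auto
    then show ?thesis by (simp only: \<rho>(2))
  qed
  then have "(norm (X - c))\<^sup>2 \<le> (k / (1 - k\<^sup>2))\<^sup>2" by (rule field_le_epsilon)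
  then have "(1 - k\<^sup>2) * ((norm (X - c))\<^sup>2 - (k / (1 - k\<^sup>2))\<^sup>2) \<le> 0"
    using k2 by (intro mult_nonneg_nonpos) auto
  then have "(norm X)\<^sup>2 \<le> (k * norm (1 - u * X))\<^sup>2"
    using boundary_disk_identity[OF u k2, of X] by (simp add: c_def power_mult_distrib)
  then have "norm X \<le> k * norm (1 - u * X)"
    by (rule power2_le_imp_le) (use k in simp)
  with dX show thesis by (rule that)
qed

end

text \<open>A null set of arguments gives a null set in the plane, since polar coordinates are differentiable.\<close>
lemma negligible_sector:
  assumes N: "negligible (N :: real set)"
  shows "negligible ((\<lambda>(r, t). exp (of_real r + \<i> * of_real t)) ` (UNIV \<times> N) :: complex set)"
proof (rule negligible_differentiable_image_negligible)
  obtain N' where N': "N' \<in> null_sets lborel" "N \<subseteq> N'"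
    using N unfolding negligible_iff_null_sets null_sets_completion_iff2 by blast
  have "UNIV \<times> N' \<in> null_sets (lborel \<Otimes>\<^sub>M lborel :: (real \<times> real) measure)"
    using N'(1) by (intro lborel.times_in_null_sets2) auto
  then have "negligible (UNIV \<times> N' :: (real \<times> real) set)"
    by (simp add: lborel_prod negligible_iff_null_sets null_sets_completionI)
  then show "negligible (UNIV \<times> N :: (real \<times> real) set)"
    by (rule negligible_subset) (use N'(2) in auto)
  show "(\<lambda>(r, t). exp (of_real r + \<i> * of_real t) :: complex) differentiable_on (UNIV \<times> N)"
    unfolding differentiable_on_def case_prod_beta differentiable_def
  proof
    fix p :: "real \<times> real"
    have "((\<lambda>p. of_real (fst p) + \<i> * of_real (snd p) :: complex) has_derivative
        (\<lambda>h. of_real (fst h) + \<i> * of_real (snd h))) (at p within UNIV \<times> N)"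
      by (auto intro!: derivative_eq_intros)
    from has_derivative_compose[OF this DERIV_exp[unfolded has_field_derivative_def]]
    show "\<exists>D. ((\<lambda>p. exp (of_real (fst p) + \<i> * of_real (snd p)) :: complex) has_derivative D) (at p within UNIV \<times> N)"
      by blast
  qed
qed simp

lemma cnj_over_self:
  assumes "z \<noteq> 0"
  shows "cnj z / z = exp (- 2 * \<i> * of_real (Im (Ln z)))"
proof -
  have "cnj z = exp (cnj (Ln z))" using assms by (simp add: exp_cnj[symmetric])
  then have "cnj z / z = exp (cnj (Ln z) - Ln z)" using assms by (simp add: exp_diff)
  also have "cnj (Ln z) - Ln z = - 2 * \<i> * of_real (Im (Ln z))" by (simp add: complex_eq_iff)
  finally show ?thesis .
qed

context disk_logarithm
begin

lemma \<Psi>_strip: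
  assumes "0 < Re z" "Re z < 1"
  shows "\<Psi> z = z * exp (boundary_log (Im (Ln z)))"
proof -
  have z: "z \<noteq> 0" using assms by auto
  have "disk_point z = 2 * of_real (Re z) / z - 1"
    using assms by (simp add: disk_point_def clamp01_simps)
  also have "2 * complex_of_real (Re z) = z + cnj z" by (simp add: complex_add_cnj)
  also have "(z + cnj z) / z - 1 = cnj z / z" using z by (simp add: field_simps)
  also have "cnj z / z = exp (- 2 * \<i> * of_real (Im (Ln z)))" by (rule cnj_over_self[OF z])
  finally show ?thesis by (simp add: \<Psi>_def boundary_log_def)
qed

text \<open>The chain rule gives the complex derivatives \<open>e (1 - u X)\<close> and \<open>e X\<close>, with \<open>u z = cnj z\<close>; the dilatation
  bound for \<open>\<Psi>\<close> is literally the disk condition for \<open>X\<close>.\<close>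
lemma dilatation_strip:
  assumes z: "0 < Re z" "Re z < 1"
    and d: "(boundary_log has_vector_derivative d) (at (Im (Ln z)))"
  shows "dilatation_at k \<Psi> z"
proof (rule dilatation_at_transform)
  define u where "u = exp (- 2 * \<i> * of_real (Im (Ln z)))"
  obtain X where X: "d = - 2 * \<i> * u * X" "norm X \<le> k * norm (1 - u * X)"
    using boundary_log_derivative[OF d] unfolding u_def by blast
  have z0: "z \<noteq> 0" using z by auto
  have u: "u * z = cnj z"
    unfolding u_def cnj_over_self[OF z0, symmetric] using z0 by simp
  define e where "e = exp (boundary_log (Im (Ln z)))"
  have "(Ln has_field_derivative 1 / z) (at z)"
    using z by (intro derivative_eq_intros) (auto simp: complex_nonpos_Reals_iff inverse_eq_divide)
  then have "(Ln has_derivative (\<lambda>v. 1 / z * v)) (at z)"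
    by (simp only: has_field_derivative_def)
  then have "((\<lambda>w. Im (Ln w)) has_derivative (\<lambda>v. Im (1 / z * v))) (at z)"
    by (rule bounded_linear.has_derivative[OF bounded_linear_Im])
  from has_derivative_compose[OF this d[unfolded has_vector_derivative_def]]
  have "((\<lambda>w. boundary_log (Im (Ln w))) has_derivative (\<lambda>v. Im (1 / z * v) *\<^sub>R d)) (at z)" .
  from has_derivative_compose[OF this DERIV_exp[unfolded has_field_derivative_def]]
  have "((\<lambda>w. exp (boundary_log (Im (Ln w)))) has_derivative (\<lambda>v. e * (Im (1 / z * v) *\<^sub>R d))) (at z)"
    unfolding e_def .
  from has_derivative_mult[OF has_derivative_ident this]
  have der: "((\<lambda>w. w * exp (boundary_log (Im (Ln w)))) has_derivative
      (\<lambda>v. z * (e * (Im (1 / z * v) *\<^sub>R d)) + v * e)) (at z)"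
    unfolding e_def .
  have "z * (e * (Im (1 / z * v) *\<^sub>R d)) + v * e = e * (1 - u * X) * v + e * X * cnj v" for v
  proof -
    have "2 * \<i> * of_real (Im (v / z)) = v / z - cnj (v / z)"
      unfolding complex_diff_cnj by (simp add: mult_ac)
    then have "z * (Im (1 / z * v) *\<^sub>R d) = - (u * X * (z * (v / z - cnj (v / z))))"
      unfolding X(1) scaleR_conv_of_real by (simp add: mult_ac)
    also have "z * (v / z - cnj (v / z)) = v - z * cnj v / cnj z"
      using z0 by (simp add: right_diff_distrib)
    also have "- (u * X * (v - z * cnj v / cnj z)) = - (u * X * v) + X * cnj v"
      using z0 by (simp add: u[symmetric] right_diff_distrib) (simp add: u_def)
    finally have eq: "z * (Im (1 / z * v) *\<^sub>R d) = - (u * X * v) + X * cnj v" .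
    have "z * (e * (Im (1 / z * v) *\<^sub>R d)) = e * (z * (Im (1 / z * v) *\<^sub>R d))"
      by (rule mult.left_commute)
    then show ?thesis unfolding eq by (simp add: algebra_simps)
  qed
  with der have "((\<lambda>w. w * exp (boundary_log (Im (Ln w)))) has_derivative
      (\<lambda>v. e * (1 - u * X) * v + e * X * cnj v)) (at z)"
    by simp
  moreover have "norm (e * X) \<le> k * norm (e * (1 - u * X))"
    using mult_left_mono[OF X(2), of "norm e"] by (simp add: norm_mult mult_ac)
  ultimately show "dilatation_at k (\<lambda>w. w * exp (boundary_log (Im (Ln w)))) z"
    unfolding dilatation_at_def by blast
  show "open ({z. 0 < Re z} \<inter> {z. Re z < 1})"
    by (intro open_Int open_halfspace_Re_gt open_halfspace_Re_lt)
qed (use z \<Psi>_strip in auto)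

lemma dilatation_ae:
  obtains N where "negligible N" "\<And>z. z \<notin> N \<Longrightarrow> dilatation_at k \<Psi> z"
proof -
  obtain N0 where N0: "negligible N0" "\<And>t. t \<notin> N0 \<Longrightarrow> \<exists>d. (boundary_log has_vector_derivative d) (at t)"
    by (rule lipschitz_complex_differentiable_ae[OF boundary_log_lipschitz]) (rule that)
  define S where "S = ((\<lambda>(r, t). exp (of_real r + \<i> * of_real t)) ` (UNIV \<times> N0) :: complex set)"
  define N where "N = {z. Re z = 0} \<union> {z. Re z = 1} \<union> S"
  have line: "negligible {z :: complex. Re z = b}" for b
    using negligible_hyperplane[of "1 :: complex" b] by (simp add: inner_complex_def)
  have "negligible N"
    unfolding N_def S_def by (intro negligible_Un line negligible_sector N0(1))
  moreover have "dilatation_at k \<Psi> z" if z: "z \<notin> N" for z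
  proof -
    have "Re z \<noteq> 0" "Re z \<noteq> 1" using z by (auto simp: N_def)
    then consider "Re z < 0" | "0 < Re z" "Re z < 1" | "1 < Re z" by linarith
    then show ?thesis
    proof cases
      case 2
      have "Im (Ln z) \<notin> N0"
      proof
        assume "Im (Ln z) \<in> N0"
        moreover have "z = exp (of_real (Re (Ln z)) + \<i> * of_real (Im (Ln z)))"
          using 2 complex_eq[of "Ln z"] by (metis exp_Ln less_irrefl zero_complex.sel(1))
        ultimately have "z \<in> S"
          unfolding S_def by (intro image_eqI[of _ _ "(Re (Ln z), Im (Ln z))"]) auto
        with z show False by (simp add: N_def)
      qed
      then obtain d where "(boundary_log has_vector_derivative d) (at (Im (Ln z)))"
        using N0(2) by meson
      with 2 show ?thesis by (rule dilatation_strip)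
    qed (simp_all add: dilatation_left dilatation_right)
  qed
  ultimately show thesis by (rule that)
qed

end

section \<open>The extension theorem\<close>

lemma holomorphic_log_on_ball:
  assumes "f holomorphic_on ball a r" "\<And>z. z \<in> ball a r \<Longrightarrow> f z \<noteq> 0"
  obtains g where "g holomorphic_on ball a r" "\<And>z. z \<in> ball a r \<Longrightarrow> f z = exp (g z)"
  using contractible_imp_holomorphic_log[OF assms(1) convex_imp_contractible[OF convex_ball] assms(2)]
  by metis

context disk_logarithm
begin

text \<open>The affine change of coordinates \<open>z \<mapsto> (z + c)/r\<close> maps the right half plane onto \<open>Re z > 1\<close>.\<close>
theorem qc_extension:
  assumes r: "0 < r" and c: "Re c = r"
    and h: "\<And>z. z \<in> right_halfplane \<Longrightarrow> h z + a = \<Psi> ((z + c) / of_real r)"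
  shows "has_qc_extension_fixing_infinity k h"
proof -
  define A where "A = (\<lambda>z. (z + c) / complex_of_real r)"
  define F where "F = (\<lambda>z. \<Psi> (A z) - a)"
  have ReA: "Re (A z) = (Re z + r) / r" for z using c by (simp add: A_def)
  have A_der: "(A has_field_derivative 1 / of_real r) (at z)" for z
    unfolding A_def using r by (auto intro!: derivative_eq_intros)
  have A_inj: "inj A" using r by (auto intro!: injI simp: A_def)
  define M where "M = exp log_bound * (1 + 4 * lip_const)"
  obtain N where N: "negligible N" "\<And>z. z \<notin> N \<Longrightarrow> dilatation_at k \<Psi> z"
    using dilatation_ae by blast
  have "quasiconformal_sphere k (map_option F)"
  proof (rule quasiconformal_sphereI)
    show "(M / r)-lipschitz_on UNIV F"
    proof (rule lipschitz_onI)
      show "0 \<le> M / r" using r lip_const_nonneg by (simp add: M_def)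
      fix x y
      have "dist (F x) (F y) = dist (\<Psi> (A x)) (\<Psi> (A y))" by (simp add: F_def dist_norm)
      also have "\<dots> \<le> M * dist (A x) (A y)"
        unfolding M_def by (rule lipschitz_onD[OF \<Psi>_lipschitz]) auto
      also have "A x - A y = (x - y) / of_real r" by (simp add: A_def diff_divide_distrib[symmetric])
      then have "dist (A x) (A y) = dist x y / r" using r by (simp add: dist_norm norm_divide)
      finally show "dist (F x) (F y) \<le> M / r * dist x y" by simp
    qed
    show "inj F"
    proof (rule injI)
      fix x y assume "F x = F y"
      then have "\<Psi> (A x) = \<Psi> (A y)" by (simp add: F_def)
      from injD[OF inj_\<Psi> this] show "x = y" using A_inj by (rule injD[rotated])
    qed
    define m where "m = exp (- log_bound) / (2 * r)"
    show m: "0 < m" using r by (simp add: m_def)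
    show "m * norm z \<le> norm (F z)" if "2 * norm c + norm a / m \<le> norm z" for z
    proof -
      have 1: "exp (- log_bound) * norm (A z) \<le> norm (F z) + norm a"
        using \<Psi>_lower[of "A z"] norm_triangle_ineq[of "\<Psi> (A z) - a" a] by (simp add: F_def)
      have "norm z - norm c \<le> norm (z + c)" by (rule norm_diff_ineq)
      then have "2 * m * (norm z - norm c) \<le> 2 * m * norm (z + c)"
        using m by (intro mult_left_mono) auto
      also have "\<dots> = exp (- log_bound) * norm (A z)"
        using r by (simp add: m_def A_def norm_divide)
      finally have 2: "2 * m * (norm z - norm c) \<le> norm (F z) + norm a" using 1 by linarith
      have "m * (2 * norm c + norm a / m) \<le> m * norm z"
        using that m by (intro mult_left_mono) auto
      then have "2 * m * norm c + norm a \<le> m * norm z"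
        using m by (simp add: distrib_left)
      with 2 show ?thesis by (simp add: algebra_simps)
    qed
    show "negligible ((\<lambda>z. of_real r * z - c) ` N)"
    proof (rule negligible_differentiable_image_negligible)
      show "(\<lambda>z. of_real r * z - c) differentiable_on N"
        by (intro derivative_intros)
    qed (use N in auto)
    show "dilatation_at k F z" if z: "z \<notin> (\<lambda>z. of_real r * z - c) ` N" for z
    proof -
      have "A z \<notin> N"
      proof
        assume "A z \<in> N"
        moreover have "z = of_real r * A z - c" using r by (simp add: A_def)
        ultimately show False using z by blast
      qed
      then have "dilatation_at k (\<lambda>z. \<Psi> (A z)) z"
        using N(2) by (intro dilatation_at_compose_right[OF A_der])
      moreover have "((\<lambda>w. w - a) has_field_derivative 1) (at (\<Psi> (A z)))"
        by (auto intro!: derivative_eq_intros)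
      ultimately show ?thesis
        unfolding F_def by (rule dilatation_at_compose_left)
    qed
    show "open {z. 0 < Re z}" by (rule open_halfspace_Re_gt)
    show "{z. 0 < Re z} \<noteq> {}" by (auto intro!: exI[of _ 1])
    have "A holomorphic_on {z. 0 < Re z}"
      unfolding A_def using r by (intro holomorphic_intros) auto
    moreover have "A ` {z. 0 < Re z} \<subseteq> {z. 1 < Re z}"
      using r by (auto simp: ReA)
    ultimately have "(\<Psi> \<circ> A) holomorphic_on {z. 0 < Re z}"
      by (rule holomorphic_on_compose_gen[OF _ \<Psi>_holomorphic])
    then show "F holomorphic_on {z. 0 < Re z}"
      unfolding F_def o_def by (intro holomorphic_intros)
  qed
  moreover have "F z = h z" if "z \<in> right_halfplane" for z
    using h[OF that] by (simp add: F_def A_def algebra_simps)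
  ultimately show ?thesis
    unfolding has_qc_extension_fixing_infinity_def by (intro exI[of _ "map_option F"]) auto
qed

end

text \<open>It remains to produce \<open>E\<close>. Where \<open>h'\<close> vanishes, the quotient in the hypothesis is \<open>0\<close> by convention and
  \<open>-z\<close> is not in \<open>D\<close>; hence \<open>h'\<close> and \<open>h + a\<close> have no zeros and the logarithm exists.\<close>
theorem theorem5p11:
  fixes k K :: real and h :: "complex \<Rightarrow> complex" and a c :: complex and D :: "complex set"
  assumes "0 \<le> k" and "k < 1" and "K = (1 + k) / (1 - k)"
    and "h holomorphic_on right_halfplane"
    and "c \<in> right_halfplane" and "D = hyp_cball c (1/2 * ln K)"
    and "\<forall>z\<in>right_halfplane. (h z + a) / deriv h z - z \<in> D"
  shows "has_qc_extension_fixing_infinity k h"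
proof -
  define r where "r = Re c"
  have r: "0 < r" using assms(5) by (simp add: r_def right_halfplane_def)
  have r2: "c + cnj c = 2 * of_real r" by (simp add: r_def complex_add_cnj)
  define p where "p = (\<lambda>z. (h z + a) / deriv h z - z)"
  have p: "0 < Re (p z)" "norm (p z - c) \<le> k * norm (p z + cnj c)" if "0 < Re z" for z
  proof -
    have "p z \<in> hyp_cball c (1 / 2 * ln ((1 + k) / (1 - k)))"
      using assms(3,6,7) that by (simp add: p_def right_halfplane_def)
    then show "0 < Re (p z)" "norm (p z - c) \<le> k * norm (p z + cnj c)"
      using hyp_cball_eq[OF assms(5,1,2)] by (auto simp: right_halfplane_def)
  qed
  have nz: "deriv h z \<noteq> 0" "h z + a \<noteq> 0" "h z + a = deriv h z * (z + p z)" if z: "0 < Re z" for z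
  proof -
    show h': "deriv h z \<noteq> 0"
    proof
      assume "deriv h z = 0"
      then have "p z = - z" by (simp add: p_def)
      then show False using p(1)[OF z] z by simp
    qed
    show eq: "h z + a = deriv h z * (z + p z)" using h' by (simp add: p_def)
    have "Re (z + p z) \<noteq> 0" using p(1)[OF z] z by simp
    then have "z + p z \<noteq> 0" by (metis zero_complex.sel(1))
    then show "h z + a \<noteq> 0" unfolding eq using h' by simp
  qed
  \<comment> \<open>The inverse of \<open>z \<mapsto> 2 r/(z + c) - 1\<close>, a conformal map of the disk onto the half plane.\<close>
  define \<zeta> where "\<zeta> = (\<lambda>u::complex. of_real (2 * r) / (1 + u) - c)"
  have u1: "1 + u \<noteq> 0" if "u \<in> ball 0 1" for u :: complex
  proof
    assume "1 + u = 0"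
    then have "u = - 1" by (simp add: add_eq_0_iff)
    then show False using that by simp
  qed
  have Re\<zeta>: "0 < Re (\<zeta> u)" if u: "u \<in> ball 0 1" for u
  proof -
    have "(norm u)\<^sup>2 < 1" using u by (simp add: power_less_one_iff abs_square_less_1)
    then have "(norm (1 + u))\<^sup>2 < 2 * Re (1 + u)"
      unfolding cmod_power2 by (simp add: power2_eq_square algebra_simps)
    moreover have "0 < (norm (1 + u))\<^sup>2" using u1[OF u] by simp
    ultimately have "1 < 2 * Re (1 + u) / (norm (1 + u))\<^sup>2" by (simp add: field_simps)
    then have "r * 1 < r * (2 * Re (1 + u) / (norm (1 + u))\<^sup>2)" using r by (intro mult_strict_left_mono)
    also have "\<dots> = Re (of_real (2 * r) / (1 + u))"
      by (simp add: Re_divide cmod_power2)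
    finally show ?thesis by (simp add: \<zeta>_def r_def)
  qed
  have \<zeta>_hol: "\<zeta> holomorphic_on ball 0 1"
    unfolding \<zeta>_def using u1 by (intro holomorphic_intros) auto
  define q where "q = (\<lambda>u. (h (\<zeta> u) + a) * (1 + u) / 2)"
  have h\<zeta>: "(h \<circ> \<zeta>) holomorphic_on ball 0 1"
    by (rule holomorphic_on_compose_gen[OF \<zeta>_hol assms(4)]) (use Re\<zeta> in \<open>auto simp: right_halfplane_def\<close>)
  have q_hol: "q holomorphic_on ball 0 1"
    unfolding q_def using h\<zeta>[unfolded o_def] by (intro holomorphic_intros) auto
  have q0: "q u \<noteq> 0" if "u \<in> ball 0 1" for u
    using nz(2)[OF Re\<zeta>[OF that]] u1[OF that] by (simp add: q_def)
  obtain L where L: "L holomorphic_on ball 0 1" "\<And>u. u \<in> ball 0 1 \<Longrightarrow> q u = exp (L u)"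
    using holomorphic_log_on_ball[OF q_hol q0] by metis
  have L_deriv: "norm (deriv L u) \<le> k * norm (1 - u * deriv L u)" if u: "u \<in> ball 0 1" for u
  proof -
    let ?z = "\<zeta> u" and ?p = "p (\<zeta> u)"
    note z = Re\<zeta>[OF u] and v = u1[OF u]
    have \<zeta>': "(\<zeta> has_field_derivative - of_real (2 * r) / (1 + u)\<^sup>2) (at u)"
      unfolding \<zeta>_def using v by (auto intro!: derivative_eq_intros simp: power2_eq_square)
    have "(h has_field_derivative deriv h ?z) (at ?z)"
      using assms(4) z by (intro holomorphic_derivI[of h right_halfplane])
        (auto simp: right_halfplane_def open_halfspace_Re_gt)
    from DERIV_chain2[OF this \<zeta>']
    have h': "((\<lambda>u. h (\<zeta> u)) has_field_derivative deriv h ?z * (- of_real (2 * r) / (1 + u)\<^sup>2)) (at u)" .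
    have "(q has_field_derivative
        (deriv h ?z * (- of_real (2 * r) / (1 + u)\<^sup>2) * (1 + u) + (h ?z + a)) / 2) (at u)"
      unfolding q_def by (auto intro!: derivative_eq_intros h')
    moreover have "((\<lambda>u. exp (L u)) has_field_derivative exp (L u) * deriv L u) (at u)"
      using holomorphic_derivI[OF L(1) open_ball u] by (auto intro!: derivative_eq_intros)
    then have "(q has_field_derivative exp (L u) * deriv L u) (at u)"
      by (rule has_field_derivative_transform_within_open[of _ _ _ "ball 0 1"]) (use u L(2) in auto)
    ultimately have "q u * deriv L u = (deriv h ?z * (- of_real (2 * r) / (1 + u)\<^sup>2) * (1 + u) + (h ?z + a)) / 2"
      unfolding L(2)[OF u] by (metis DERIV_unique)
    also have "\<dots> = (deriv h ?z * (- of_real (2 * r) / (1 + u)) + deriv h ?z * (?z + ?p)) / 2"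
      unfolding nz(3)[OF z, symmetric] using v by (simp add: power2_eq_square)
    finally have q_L: "q u * deriv L u
        = (deriv h ?z * (- of_real (2 * r) / (1 + u)) + deriv h ?z * (?z + ?p)) / 2" .
    have "deriv h ?z * ((?z + ?p) * (1 + u) * deriv L u) = 2 * (q u * deriv L u)"
      unfolding q_def nz(3)[OF z] by simp
    also have "\<dots> = deriv h ?z * (- of_real (2 * r) / (1 + u) + (?z + ?p))"
      unfolding q_L by (simp only: distrib_left) simp
    finally have "deriv h ?z * ((?z + ?p) * (1 + u) * deriv L u)
        = deriv h ?z * (- of_real (2 * r) / (1 + u) + (?z + ?p))" .
    then have "(?z + ?p) * (1 + u) * deriv L u = - of_real (2 * r) / (1 + u) + (?z + ?p)"
      using nz(1)[OF z] by (simp only: mult_cancel_left) simp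
    also have "\<dots> = ?p - c" by (simp add: \<zeta>_def)
    also have "(?z + ?p) * (1 + u) = (?p + cnj c) + u * (?p - c)"
    proof -
      have "?z * (1 + u) = of_real (2 * r) - c * (1 + u)"
        using v by (simp add: \<zeta>_def left_diff_distrib)
      also have "of_real (2 * r) = c + cnj c" using r2 by simp
      finally show ?thesis by (simp add: algebra_simps)
    qed
    \<comment> \<open>This is \<open>(1 + u b) L' = b\<close> for \<open>b = (p - c)/(p + cnj c)\<close>.\<close>
    finally have rel: "((?p + cnj c) + u * (?p - c)) * deriv L u = ?p - c" .
    have "Re (?p + cnj c) \<noteq> 0" using p(1)[OF z] r by (simp add: r_def)
    then have pc: "?p + cnj c \<noteq> 0" by (metis zero_complex.sel(1))
    have "(?p + cnj c) * deriv L u = (?p - c) * (1 - u * deriv L u)"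
      using rel by (simp add: algebra_simps)
    then have "norm (?p + cnj c) * norm (deriv L u) = norm (?p - c) * norm (1 - u * deriv L u)"
      by (metis norm_mult)
    also have "\<dots> \<le> k * norm (?p + cnj c) * norm (1 - u * deriv L u)"
      using p(2)[OF z] by (intro mult_right_mono) auto
    finally have "norm (?p + cnj c) * norm (deriv L u) \<le> norm (?p + cnj c) * (k * norm (1 - u * deriv L u))"
      by (simp add: mult_ac)
    moreover have "0 < norm (?p + cnj c)" using pc by simp
    ultimately show ?thesis by (rule mult_left_le_imp_le)
  qed
  have "(k / (1 - k))-lipschitz_on (ball 0 1) L"
  proof (rule lipschitz_onI)
    show "0 \<le> k / (1 - k)" using assms(1,2) by simp
    fix x y :: complex assume xy: "x \<in> ball 0 1" "y \<in> ball 0 1"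
    have "norm (L x - L y) \<le> k / (1 - k) * norm (x - y)"
    proof (rule field_differentiable_bound[of "ball 0 1" L "deriv L"])
      show "(L has_field_derivative deriv L u) (at u within ball 0 1)" if "u \<in> ball 0 1" for u
        using holomorphic_derivI[OF L(1) open_ball that] by (rule has_field_derivative_at_within)
      show "norm (deriv L u) \<le> k / (1 - k)" if u: "u \<in> ball 0 1" for u
        using L_deriv[OF u] u assms(1,2) by (intro disk_condition_bound[of k u]) auto
    qed (use xy in auto)
    then show "dist (L x) (L y) \<le> k / (1 - k) * dist x y" by (simp add: dist_norm)
  qed
  from lipschitz_extend_closure[OF this]
  obtain E where E: "(k / (1 - k))-lipschitz_on (cball 0 1) E" "\<And>u. u \<in> ball 0 1 \<Longrightarrow> E u = L u"
    by auto
  have deriv_E: "deriv E u = deriv L u" if "u \<in> ball 0 1" for u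
  proof (rule deriv_cong_ev)
    show "\<forall>\<^sub>F w in nhds u. E w = L w"
      using that E(2) by (intro eventually_nhds_in_open[THEN eventually_mono, of "ball 0 1"]) auto
  qed simp
  interpret disk_logarithm k E
  proof
    show "E holomorphic_on ball 0 1"
      by (rule holomorphic_transform[OF L(1)]) (simp add: E(2))
    show "norm (deriv E u) \<le> k * norm (1 - u * deriv E u)" if "u \<in> ball 0 1" for u
      using L_deriv[OF that] deriv_E[OF that] by simp
  qed (use assms E in auto)
  show ?thesis
  proof (rule qc_extension[OF r])
    show "Re c = r" by (simp add: r_def)
    fix z assume "z \<in> right_halfplane"
    then have z: "0 < Re z" by (simp add: right_halfplane_def)
    define w where "w = (z + c) / of_real r"
    have Re_w: "1 < Re w" using z r by (simp add: w_def r_def field_simps)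
    have w0: "w \<noteq> 0" using Re_w by auto
    define u where "u = 2 / w - 1"
    have u: "u \<in> ball 0 1" unfolding u_def by (rule disk_point_ball[OF Re_w])
    have "\<zeta> u = of_real r * w - c" using w0 by (simp add: \<zeta>_def u_def)
    also have "\<dots> = z" using r by (simp add: w_def)
    finally have "q u = (h z + a) / w" by (simp add: q_def) (simp add: u_def)
    then have "h z + a = w * exp (E u)"
      using L(2)[OF u] E(2)[OF u] w0 by (simp add: field_simps)
    also have "\<dots> = \<Psi> w"
      using Re_w by (simp add: \<Psi>_def disk_point_halfplane u_def)
    finally show "h z + a = \<Psi> ((z + c) / of_real r)" by (simp add: w_def)
  qed
qed

end
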